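(* Let $B:[0,T]\to\mathrm{Sym}(2n)$ be continuous, let $\phi:[0,T]\to\mathrm{Sp}(2n)$ be the fundamental solution of $z'(t)=J_0B(t)z(t)$ (i.e. $\phi'=J_0B\phi$, $\phi(0)=\mathrm{Id}$), let $L,L_1,L_2\in\Lambda(n)$ and $\ell(t)=\phi(t)L$. Define $$\epsilon_1=L\cap\ell(T)+\ell(T)\cap L_1,\quad \epsilon_2=L\cap\ell(T)+\ell(T)\cap L_2,\quad \delta_1=L\cap L_1+L_1\cap L_2,\quad \delta_2=\ell(T)\cap L_1+L_1\cap L_2,$$ $k_1=\min\{\dim\epsilon_1,\dim\epsilon_2\}$, $k_2=\min\{\dim\delta_1,\dim\delta_2\}$, $k=\max\{k_1,k_2\}$. Then $$\Big|\iota^{\mathrm{CLM}}\big(L_2,\ell(t);t\in[0,T]\big)-\iota^{\mathrm{CLM}}\big(L_1,\ell(t);t\in[0,T]\big)\Big|\le n-k.$$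
   Context: The standard symplectic space is $\mathbb R^{2n}=\mathbb R^n\oplus\mathbb R^n$ with coordinates $z=(p,q)$, symplectic form $\omega_0((p_1,q_1),(p_2,q_2))=\langle p_1,q_2\rangle-\langle q_1,p_2\rangle$ and complex structure $J_0(p,q)=(-q,p)$, so $\omega_0(z_1,z_2)=\langle J_0z_1,z_2\rangle$; $\mathrm{Sp}(2n)$ is its symplectic group, $\Lambda(n)$ its Lagrangian Grassmannian, $\mathrm{Sym}(2n)$ the real symmetric $2n\times 2n$ matrices. For a $2n$-dimensional real symplectic space $(V,\omega)$ with Lagrangian Grassmannian $\Lambda(V,\omega)$, $L_0\in\Lambda(V,\omega)$ and a continuous path $\ell:[a,b]\to\Lambda(V,\omega)$, $\iota^{\mathrm{CLM}}(L_0,\ell(t);t\in[a,b])\in\mathbb Z$ denotes the Cappell–Lee–Miller Maslov index: the intersection index of $\ell$ with the Maslov cycle $\Sigma(L_0)=\{L: L\cap L_0\neq\{0\}\}$; it is invariant under fixed-endpoint homotopies, additive under concatenation, and for $\mathscr C^1$ paths with only regular crossings equals $n_+(\Gamma(\ell,L_0,a))+\sum_{a<t<b}\operatorname{sgn}\Gamma(\ell,L_0,t)-n_-(\Gamma(\ell,L_0,b))$, where a crossing is $t_0$ with $\ell(t_0)\cap L_0\ne\{0\}$, the crossing form on $\ell(t_0)\cap L_0$ is $\Gamma(\ell,L_0,t_0)[v]=\frac{d}{dt}|_{t=t_0}\omega(v,w(t))$ with $w(t)\in W$ the unique vector with $v+w(t)\in\ell(t)$ for a fixed Lagrangian $W$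 transversal to $\ell(t_0)$, and regular means nondegenerate. *)

theory Defs
  imports "HOL-Analysis.Analysis"
begin

type_synonym 'n sympl = "(real ^ 'n) \<times> (real ^ 'n)"

definition omega0 :: "'n::finite sympl \<Rightarrow> 'n sympl \<Rightarrow> real" where
  "omega0 z1 z2 = inner (fst z1) (snd z2) - inner (snd z1) (fst z2)"

definition J0 :: "'n::finite sympl \<Rightarrow> 'n sympl" where
  "J0 z = (- snd z, fst z)"

definition J0L :: "'n::finite sympl \<Rightarrow>\<^sub>L 'n sympl" where
  "J0L = Blinfun J0"

definition lagrangian :: "'n::finite sympl set \<Rightarrow> bool" where
  "lagrangian L \<longleftrightarrow> subspace L \<and> dim L = CARD('n)
     \<and> (\<forall>x\<in>L. \<forall>y\<in>L. omega0 x y = 0)"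

text \<open>Topology of Lambda(n): a Lagrangian is identified with the orthogonal projection
  onto it (closest_point). Continuity / C^1 of paths of Lagrangians is measured through
  these projections (pointwise = in operator norm, finite dimension).\<close>

definition lag_path :: "(real \<Rightarrow> 'n::finite sympl set) \<Rightarrow> real \<Rightarrow> real \<Rightarrow> bool" where
  "lag_path l a b \<longleftrightarrow> (\<forall>t\<in>{a..b}. lagrangian (l t))
     \<and> (\<forall>x. continuous_on {a..b} (\<lambda>t. closest_point (l t) x))"

definition lag_path_C1 :: "(real \<Rightarrow> 'n::finite sympl set) \<Rightarrow> real \<Rightarrow> real \<Rightarrow> bool" where
  "lag_path_C1 l a b \<longleftrightarrow> lag_path l a b \<and>
     (\<forall>x. \<exists>D. (\<forall>t\<in>{a..b}. ((\<lambda>s. closest_point (l s) x) has_vector_derivative D t)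
                  (at t within {a..b})) \<and> continuous_on {a..b} D)"

definition lag_homotopy ::
  "(real \<Rightarrow> real \<Rightarrow> 'n::finite sympl set) \<Rightarrow> real \<Rightarrow> real \<Rightarrow> bool" where
  "lag_homotopy H a b \<longleftrightarrow> (\<forall>s\<in>{0..1}. \<forall>t\<in>{a..b}. lagrangian (H s t))
     \<and> (\<forall>x. continuous_on ({0..1} \<times> {a..b}) (\<lambda>(s,t). closest_point (H s t) x))"

definition transversal_lag :: "'n::finite sympl set \<Rightarrow> 'n sympl set" where
  "transversal_lag M = (SOME W. lagrangian W \<and> W \<inter> M = {0})"

definition crossing_form ::
  "(real \<Rightarrow> 'n::finite sympl set) \<Rightarrow> real \<Rightarrow> real \<Rightarrow> real \<Rightarrow> 'n sympl \<Rightarrow> real" where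
  "crossing_form l a b t0 v =
     (let W = transversal_lag (l t0);
          w = (\<lambda>t. THE w. w \<in> W \<and> v + w \<in> l t)
      in THE d. ((\<lambda>t. omega0 v (w t)) has_real_derivative d) (at t0 within {a..b}))"

definition n_plus :: "('a::real_vector \<Rightarrow> real) \<Rightarrow> 'a set \<Rightarrow> nat" where
  "n_plus Q S = (GREATEST d. \<exists>U. subspace U \<and> U \<subseteq> S \<and> dim U = d
                    \<and> (\<forall>u\<in>U. u \<noteq> 0 \<longrightarrow> Q u > 0))"

definition n_minus :: "('a::real_vector \<Rightarrow> real) \<Rightarrow> 'a set \<Rightarrow> nat" where
  "n_minus Q S = n_plus (\<lambda>v. - Q v) S"

definition sgn_form :: "('a::real_vector \<Rightarrow> real) \<Rightarrow> 'a set \<Rightarrow> int" where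
  "sgn_form Q S = int (n_plus Q S) - int (n_minus Q S)"

definition nondeg_form :: "('a::euclidean_space \<Rightarrow> real) \<Rightarrow> 'a set \<Rightarrow> bool" where
  "nondeg_form Q S \<longleftrightarrow> n_plus Q S + n_minus Q S = dim S"

definition crossings :: "'n::finite sympl set \<Rightarrow> (real \<Rightarrow> 'n sympl set) \<Rightarrow> real \<Rightarrow> real \<Rightarrow> real set" where
  "crossings L0 l a b = {t\<in>{a..b}. l t \<inter> L0 \<noteq> {0}}"

definition regular_path :: "'n::finite sympl set \<Rightarrow> (real \<Rightarrow> 'n sympl set) \<Rightarrow> real \<Rightarrow> real \<Rightarrow> bool" where
  "regular_path L0 l a b \<longleftrightarrow> lag_path_C1 l a b \<and> finite (crossings L0 l a b)
     \<and> (\<forall>t\<in>crossings L0 l a b. nondeg_form (crossing_form l a b t) (l t \<inter> L0))"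

definition crossing_sum :: "'n::finite sympl set \<Rightarrow> (real \<Rightarrow> 'n sympl set) \<Rightarrow> real \<Rightarrow> real \<Rightarrow> int" where
  "crossing_sum L0 l a b =
     int (n_plus (crossing_form l a b a) (l a \<inter> L0))
     + (\<Sum>t\<in>crossings L0 l a b \<inter> {a<..<b}. sgn_form (crossing_form l a b t) (l t \<inter> L0))
     - int (n_minus (crossing_form l a b b) (l b \<inter> L0))"

text \<open>The Cappell--Lee--Miller Maslov index, characterised as the (unique) integer
  invariant of continuous Lagrangian paths which is invariant under fixed-endpoint
  homotopies, additive under concatenation, and given by the crossing-form formula
  on C^1 paths with only regular crossings (value 0 on invalid input, for definiteness).\<close>

definition clm_axioms ::
  "('n::finite sympl set \<Rightarrow> (real \<Rightarrow> 'n sympl set) \<Rightarrow> real \<Rightarrow> real \<Rightarrow> int) \<Rightarrow> bool" where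
  "clm_axioms \<mu> \<longleftrightarrow>
     (\<forall>L0 l a b. \<not> (lagrangian L0 \<and> a < b \<and> lag_path l a b) \<longrightarrow> \<mu> L0 l a b = 0)
   \<and> (\<forall>L0 l a b. lagrangian L0 \<and> a < b \<and> regular_path L0 l a b
        \<longrightarrow> \<mu> L0 l a b = crossing_sum L0 l a b)
   \<and> (\<forall>L0 H a b. lagrangian L0 \<and> a < b \<and> lag_homotopy H a b
        \<and> (\<forall>s\<in>{0..1}. H s a = H 0 a \<and> H s b = H 0 b)
        \<longrightarrow> \<mu> L0 (H 0) a b = \<mu> L0 (H 1) a b)
   \<and> (\<forall>L0 l a c b. lagrangian L0 \<and> a < c \<and> c < b \<and> lag_path l a b
        \<longrightarrow> \<mu> L0 l a b = \<mu> L0 l a c + \<mu> L0 l c b)"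

definition clm_index :: "'n::finite sympl set \<Rightarrow> (real \<Rightarrow> 'n sympl set) \<Rightarrow> real \<Rightarrow> real \<Rightarrow> int" where
  "clm_index = (THE \<mu>. clm_axioms \<mu>)"

end

theory Submission
  imports Defs
begin

text \<open>
  If \<open>W\<close> is transversal to the Lagrangians \<open>A\<close> and \<open>B\<close>, then \<open>B\<close> is the graph of a symmetric form on \<open>A\<close>
  with values in \<open>W\<close>; let \<open>h\<^sub>W(A, B)\<close> be its positive index. The exchange identity
  \<open>h\<^sub>W(A, B) - h\<^sub>W'(A, B) = h\<^sub>B(W, W') - h\<^sub>A(W, W')\<close> shows that \<open>h\<^sub>W(L0, l) - h\<^sub>W'(L0, l)\<close> is locally
  constant in \<open>l\<close>, so the local functions \<open>h\<^sub>W(L0, l(t))\<close> glue to a function of \<open>t\<close> whose increment is the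
  Maslov index; this gives existence of the index. It is determined by its axioms because in a chart every
  path is homotopic to one moving first in a positive and then in a negative definite direction.

  The exchange identity also makes \<open>\<iota>(A, B, C) = h\<^sub>W(A, B) + h\<^sub>W(B, C) - h\<^sub>W(A, C)\<close> independent of \<open>W\<close>.
  In forms this is \<open>n\<^sub>+(x) + n\<^sub>+(y) - n\<^sub>+(x + y)\<close>, where \<open>x\<close> and \<open>y\<close> have the kernels \<open>A \<inter> B\<close> and \<open>B \<inter> C\<close>,
  hence \<open>0 \<le> \<iota>(A, B, C) \<le> n - dim (A \<inter> B + B \<inter> C)\<close>. The difference of the two Maslov indices equals both
  \<open>\<iota>(L2, L1, L) - \<iota>(L2, L1, l(T))\<close> and \<open>\<iota>(L2, l(T), L) - \<iota>(L1, l(T), L)\<close>.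
\<close>

section \<open>Inertia indices of quadratic forms\<close>

text \<open>\<open>clm_index\<close> is a description over all functions satisfying
  \<open>clm_axioms\<close>, so nothing can be computed about it until one such function is built
  and shown to be the only one. The positive index, rather than the signature, is the right local
  quantity: it jumps by \<open>n_plus\<close> of the crossing form when a crossing is left forwards
  and by \<open>n_minus\<close> when it is left backwards, which is the endpoint convention of
  \<open>crossing_sum\<close>. The obstacle is that \<open>hind W L0 (l t)\<close> is discontinuous
  at crossings and that no single \<open>W\<close> need be transversal to a whole path. The exchange
  identity moves the varying Lagrangian out of the form and into the chart: there the form lives on
  the fixed space \<open>W\<close> with the fixed radical \<open>W \<inter> W'\<close>, so its index
  cannot jump. The identity itself comes from splitting one nondegenerate form on the whole space
  orthogonally in two ways.\<close>

lemma dim_Int_ge: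
  fixes S T X :: "'a::euclidean_space set"
  assumes "subspace S" "subspace T" "subspace X" "S \<subseteq> X" "T \<subseteq> X"
  shows "dim S + dim T \<le> dim X + dim (S \<inter> T)"
proof -
  have "{x + y |x y. x \<in> S \<and> y \<in> T} \<subseteq> X"
    using assms by (auto intro!: subspace_add)
  then have "dim {x + y |x y. x \<in> S \<and> y \<in> T} \<le> dim X" by (rule dim_subset)
  with dim_sums_Int[OF assms(1,2)] show ?thesis by linarith
qed

lemma dim_disjoint_le:
  fixes S T X :: "'a::euclidean_space set"
  assumes "subspace S" "subspace T" "subspace X" "S \<subseteq> X" "T \<subseteq> X" "S \<inter> T \<subseteq> {0}"
  shows "dim S + dim T \<le> dim X"
proof -
  have "dim (S \<inter> T) = 0" using assms(6) by simp
  with dim_Int_ge[OF assms(1-5)] show ?thesis by simp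
qed

lemma subspace_complement_exists:
  fixes R U :: "'a::euclidean_space set"
  assumes R: "subspace R" and U: "subspace U" and RU: "R \<subseteq> U"
  obtains N where "subspace N" "N \<subseteq> U" "N \<inter> R \<subseteq> {0}" "dim N + dim R = dim U"
proof -
  define N where "N = {y\<in>U. \<forall>x\<in>R. orthogonal x y}"
  have "subspace N" unfolding N_def using U
    by (auto simp: subspace_def orthogonal_def inner_right_distrib)
  moreover have "N \<subseteq> U" "N \<inter> R \<subseteq> {0}" by (auto simp: N_def orthogonal_def)
  moreover have "dim N + dim R = dim U"
    unfolding N_def by (rule dim_subspace_orthogonal_to_vectors[OF R U RU])
  ultimately show ?thesis using that by blast
qed

text \<open>The \<open>b\<close>-orthogonal complement of \<open>U\<close> in \<open>S\<close>
  contains the kernel of the map from \<open>S\<close> to \<open>U\<close> with coordinates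
  \<open>b x i\<close> in a basis of \<open>U\<close>, and the rank of that map is at most
  \<open>dim U\<close>.\<close>

lemma dim_orthocomp_ge:
  fixes b :: "'a::euclidean_space \<Rightarrow> 'a \<Rightarrow> real"
  assumes b: "bilinear b" and S: "subspace S" and U: "subspace U"
  shows "dim S \<le> dim U + dim {x\<in>S. \<forall>u\<in>U. b x u = 0}"
proof -
  obtain B where B: "B \<subseteq> U" "independent B" "U \<subseteq> span B" "card B = dim U"
    using basis_exists by blast
  have finB: "finite B" using B(2) by (rule independent_imp_finite)
  define f where "f x = (\<Sum>i\<in>B. b x i *\<^sub>R i)" for x
  have lin: "linear (\<lambda>x. b x y)" for y using b by (simp add: bilinear_def)
  have linr: "linear (b x)" for x using b by (simp add: bilinear_def)
  have f: "linear f"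
    unfolding f_def by (rule linearI)
      (simp_all add: linear_add[OF lin] linear_scale[OF lin] sum.distrib scaleR_add_left scaleR_sum_right)
  have ker: "{x\<in>S. f x = 0} \<subseteq> {x\<in>S. \<forall>u\<in>U. b x u = 0}"
  proof safe
    fix x u assume x: "x \<in> S" "f x = 0" and u: "u \<in> U"
    have z: "b x i = 0" if "i \<in> B" for i
      using x(2) B(2) that finB unfolding f_def independent_explicit by metis
    have "u \<in> span B" using u B(3) by blast
    then show "b x u = 0"
      by (induction rule: span_induct) (auto simp: z subspace_def linear_0[OF linr] linear_add[OF linr] linear_scale[OF linr])
  qed
  have fU: "f x \<in> U" for x
    unfolding f_def using B(1) by (auto intro!: subspace_sum[OF U] subspace_scale[OF U])
  have K: "subspace {x\<in>S. f x = 0}"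
    using S by (auto simp: subspace_def linear_0[OF f] linear_add[OF f] linear_scale[OF f])
  obtain C where C: "subspace C" "C \<subseteq> S" "C \<inter> {x\<in>S. f x = 0} \<subseteq> {0}" "dim C + dim {x\<in>S. f x = 0} = dim S"
    using subspace_complement_exists[OF K S] by blast
  have "inj_on f C"
    using C by (intro linear_inj_on_iff_eq_0[OF f C(1), THEN iffD2]) blast
  then have "dim (f ` C) = dim C"
    using dim_image_eq[OF f] by (metis C(1) span_eq_iff)
  moreover have "dim (f ` C) \<le> dim U" by (rule dim_subset) (use fU in blast)
  moreover have "dim {x\<in>S. f x = 0} \<le> dim {x\<in>S. \<forall>u\<in>U. b x u = 0}"
    using ker by (rule dim_subset)
  ultimately show ?thesis using C(4) by linarith
qed

section \<open>Positive index: attainment and invariance under injective linear maps\<close>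

lemma n_plus_ge:
  fixes Q :: "'a::euclidean_space \<Rightarrow> real"
  assumes "subspace U" "U \<subseteq> S" "\<And>u. u \<in> U \<Longrightarrow> u \<noteq> 0 \<Longrightarrow> Q u > 0"
  shows "dim U \<le> n_plus Q S"
  unfolding n_plus_def
  by (rule Greatest_le_nat[where b = "DIM('a)"]) (use assms dim_subset_UNIV in auto)

lemma n_plus_witness:
  fixes Q :: "'a::euclidean_space \<Rightarrow> real"
  assumes "subspace S"
  obtains U where "subspace U" "U \<subseteq> S" "dim U = n_plus Q S" "\<And>u. u \<in> U \<Longrightarrow> u \<noteq> 0 \<Longrightarrow> Q u > 0"
proof -
  have "\<exists>U. subspace U \<and> U \<subseteq> S \<and> dim U = n_plus Q S \<and> (\<forall>u\<in>U. u \<noteq> 0 \<longrightarrow> Q u > 0)"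
    unfolding n_plus_def
  proof (rule GreatestI_nat[where b = "DIM('a)" and k = 0])
    show "\<exists>U. subspace U \<and> U \<subseteq> S \<and> dim U = 0 \<and> (\<forall>u\<in>U. u \<noteq> 0 \<longrightarrow> Q u > 0)"
      using subspace_0[OF assms] by (intro exI[of _ "{0}"]) auto
  qed (use dim_subset_UNIV in auto)
  then show ?thesis using that by blast
qed

lemma n_plus_cong:
  assumes "\<And>x. x \<in> S \<Longrightarrow> Q x = Q' x"
  shows "n_plus Q S = n_plus Q' S"
proof -
  have "(U \<subseteq> S \<and> dim U = d \<and> (\<forall>u\<in>U. u \<noteq> 0 \<longrightarrow> Q u > 0)) \<longleftrightarrow>
        (U \<subseteq> S \<and> dim U = d \<and> (\<forall>u\<in>U. u \<noteq> 0 \<longrightarrow> Q' u > 0))" for U d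
    using assms by (metis subsetD)
  then show ?thesis unfolding n_plus_def by simp
qed

lemma n_minus_cong:
  assumes "\<And>x. x \<in> S \<Longrightarrow> Q x = Q' x"
  shows "n_minus Q S = n_minus Q' S"
  unfolding n_minus_def by (rule n_plus_cong) (simp add: assms)

lemma n_plus_le_image:
  fixes f :: "'a::euclidean_space \<Rightarrow> 'b::euclidean_space"
  assumes f: "linear f" and S: "subspace S" and inj: "\<And>x. x \<in> S \<Longrightarrow> f x = 0 \<Longrightarrow> x = 0"
    and sub: "f ` S \<subseteq> S'" and Q: "\<And>x. x \<in> S \<Longrightarrow> Q' (f x) = Q x"
  shows "n_plus Q S \<le> n_plus Q' S'"
proof -
  obtain U where U: "subspace U" "U \<subseteq> S" "dim U = n_plus Q S" "\<And>u. u \<in> U \<Longrightarrow> u \<noteq> 0 \<Longrightarrow> Q u > 0"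
    using n_plus_witness[OF S] by blast
  have "inj_on f U"
    using inj U(2) by (intro linear_inj_on_iff_eq_0[OF f U(1), THEN iffD2]) blast
  then have "dim (f ` U) = dim U"
    using dim_image_eq[OF f] by (metis U(1) span_eq_iff)
  moreover have "dim (f ` U) \<le> n_plus Q' S'"
  proof (rule n_plus_ge)
    show "subspace (f ` U)" using linear_subspace_image[OF f U(1)] .
    show "f ` U \<subseteq> S'" using U(2) sub by blast
    fix u assume "u \<in> f ` U" "u \<noteq> 0"
    then obtain x where "x \<in> U" "u = f x" "x \<noteq> 0" using linear_0[OF f] by auto
    then show "Q' u > 0" using Q U by auto
  qed
  ultimately show ?thesis using U(3) by simp
qed

lemma n_plus_image:
  fixes f :: "'a::euclidean_space \<Rightarrow> 'b::euclidean_space"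
  assumes f: "linear f" and S: "subspace S" and inj: "\<And>x. x \<in> S \<Longrightarrow> f x = 0 \<Longrightarrow> x = 0"
    and Q: "\<And>x. x \<in> S \<Longrightarrow> Q' (f x) = Q x"
  shows "n_plus Q' (f ` S) = n_plus Q S"
proof (rule antisym)
  have injS: "inj_on f S" using inj by (intro linear_inj_on_iff_eq_0[OF f S, THEN iffD2]) blast
  obtain g where g: "linear g" "\<And>x. x \<in> S \<Longrightarrow> g (f x) = x"
    using linear_exists_left_inverse_on[OF f S injS] by blast
  show "n_plus Q' (f ` S) \<le> n_plus Q S"
    by (rule n_plus_le_image[OF g(1) linear_subspace_image[OF f S]])
       (auto simp: g Q linear_0[OF f])
  show "n_plus Q S \<le> n_plus Q' (f ` S)"
    by (rule n_plus_le_image[OF f S]) (use inj Q in auto)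
qed

section \<open>Symmetric forms on a subspace, their radical and Sylvester's law\<close>

definition rad :: "('a \<Rightarrow> 'a \<Rightarrow> real) \<Rightarrow> 'a set \<Rightarrow> 'a set" where
  "rad b S = {x\<in>S. \<forall>y\<in>S. b x y = 0}"

text \<open>Symmetry is required on \<open>S\<close> only: the slope forms to come are bilinear on
  the whole space but symmetric on Lagrangian subspaces.\<close>

locale sym_form =
  fixes b :: "'a::euclidean_space \<Rightarrow> 'a \<Rightarrow> real" and S :: "'a set"
  assumes bil: "bilinear b" and S: "subspace S"
    and sym: "\<And>x y. x \<in> S \<Longrightarrow> y \<in> S \<Longrightarrow> b x y = b y x"
begin

lemma expand: "x \<in> S \<Longrightarrow> y \<in> S \<Longrightarrow> b (x + c *\<^sub>R y) (x + c *\<^sub>R y) = b x x + 2 * c * b x y + c\<^sup>2 * b y y"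
  by (simp add: bilinear_ladd[OF bil] bilinear_radd[OF bil] bilinear_lmul[OF bil] bilinear_rmul[OF bil]
      sym[of y x] algebra_simps power2_eq_square)

lemma subspace_orth: "subspace {x\<in>S. \<forall>u\<in>U. b x u = 0}"
  using S by (auto simp: subspace_def bilinear_ladd[OF bil] bilinear_lmul[OF bil] bilinear_lzero[OF bil])

lemma subspace_rad: "subspace (rad b S)"
  unfolding rad_def by (rule subspace_orth)

lemma restrict: "subspace T \<Longrightarrow> T \<subseteq> S \<Longrightarrow> sym_form b T"
  using bil sym by unfold_locales auto

lemma uminus: "sym_form (\<lambda>x y. - b x y) S"
proof unfold_locales
  show "bilinear (\<lambda>x y. - b x y)" using bil by (auto simp: bilinear_def intro: linear_compose_neg)
qed (use S sym in auto)

text \<open>A null vector of a nonpositive form is a maximum, so the first variation in every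
  direction \<open>y\<close> must vanish.\<close>

lemma semidef_rad:
  assumes nonpos: "\<And>x. x \<in> S \<Longrightarrow> b x x \<le> 0" and x: "x \<in> S" "b x x = 0"
  shows "x \<in> rad b S"
proof -
  have "b x y = 0" if y: "y \<in> S" for y
  proof (rule ccontr)
    assume ne: "b x y \<noteq> 0"
    \<comment> \<open>With this \<open>c\<close> the linear term \<open>2 * c * b x y\<close> equals
      \<open>2 * c\<^sup>2 * (1 + \<bar>b y y\<bar>)\<close> and outweighs the quadratic
      one.\<close>
    define c where "c = b x y / (1 + \<bar>b y y\<bar>)"
    have "b (x + c *\<^sub>R y) (x + c *\<^sub>R y) \<le> 0"
      using x y S by (intro nonpos) (auto intro: subspace_add subspace_scale)
    then have le: "2 * c * b x y + c\<^sup>2 * b y y \<le> 0" using expand[OF x(1) y] x(2) by simp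
    have d: "1 + \<bar>b y y\<bar> > 0" by linarith
    have cb: "c * (1 + \<bar>b y y\<bar>) = b x y" using d by (simp add: c_def)
    have "c \<noteq> 0" using ne d by (simp add: c_def)
    have "2 * c * b x y + c\<^sup>2 * b y y = c\<^sup>2 * (2 + 2 * \<bar>b y y\<bar> + b y y)"
      by (subst cb[symmetric]) (simp add: algebra_simps power2_eq_square)
    moreover have "c\<^sup>2 * (2 + 2 * \<bar>b y y\<bar> + b y y) > 0"
      using \<open>c \<noteq> 0\<close> by (intro mult_pos_pos) auto
    ultimately show False using le by linarith
  qed
  then show ?thesis using x by (simp add: rad_def)
qed

text \<open>\<open>P\<close> is a positive subspace of maximal dimension and \<open>N\<close> its
  orthogonal complement; a vector of \<open>N\<close> with positive square could be added to
  \<open>P\<close>, against maximality.\<close>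

lemma nonpos_complement:
  obtains P N where "subspace P" "P \<subseteq> S" "dim P = n_plus (\<lambda>v. b v v) S"
    "\<And>u. u \<in> P \<Longrightarrow> u \<noteq> 0 \<Longrightarrow> b u u > 0"
    "subspace N" "N \<subseteq> S" "dim P + dim N = dim S" "\<And>x. x \<in> N \<Longrightarrow> b x x \<le> 0"
    "\<And>u x. u \<in> P \<Longrightarrow> x \<in> N \<Longrightarrow> b x u = 0" "P \<inter> N \<subseteq> {0}"
proof -
  obtain P where P: "subspace P" "P \<subseteq> S" "dim P = n_plus (\<lambda>v. b v v) S"
    "\<And>u. u \<in> P \<Longrightarrow> u \<noteq> 0 \<Longrightarrow> b u u > 0"
    using n_plus_witness[OF S] by blast
  define N where "N = {x\<in>S. \<forall>u\<in>P. b x u = 0}"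
  have N: "subspace N" "N \<subseteq> S" unfolding N_def using subspace_orth by auto
  have dis: "P \<inter> N \<subseteq> {0}" unfolding N_def using P(4) by fastforce
  have d: "dim P + dim N = dim S"
    using dim_orthocomp_ge[OF bil S P(1)] dim_disjoint_le[OF P(1) N(1) S P(2) N(2) dis]
    unfolding N_def by linarith
  have np: "b x x \<le> 0" if x: "x \<in> N" for x
  proof (rule ccontr)
    assume pos: "\<not> b x x \<le> 0"
    then have x0: "x \<noteq> 0" using bilinear_lzero[OF bil] by auto
    define U where "U = {p + y |p y. p \<in> P \<and> y \<in> span {x}}"
    have U: "subspace U" unfolding U_def using subspace_sums[OF P(1) subspace_span[of "{x}"]] .
    have "dim U \<le> n_plus (\<lambda>v. b v v) S"
    proof (rule n_plus_ge[OF U])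
      show "U \<subseteq> S" unfolding U_def using P(2) N x S
        by (auto simp: span_singleton intro!: subspace_add[OF S] subspace_scale[OF S])
      fix u assume u: "u \<in> U" "u \<noteq> 0"
      then obtain p c where pc: "p \<in> P" "u = p + c *\<^sub>R x" unfolding U_def by (auto simp: span_singleton)
      have "b p x = 0" using x pc(1) P(2) N(2) sym[of p x] by (auto simp: N_def)
      then have e: "b u u = b p p + c\<^sup>2 * b x x"
        unfolding pc(2) using expand[of p x c] P(2) pc(1) N(2) x by auto
      show "b u u > 0"
      proof (cases "p = 0")
        case True
        then have "c \<noteq> 0" using u pc by auto
        then show ?thesis using e True pos bilinear_lzero[OF bil] by simp
      next
        case False
        then have "b p p > 0" using P(4) pc by auto
        moreover have "c\<^sup>2 * b x x \<ge> 0" using pos by simp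
        ultimately show ?thesis using e by linarith
      qed
    qed
    moreover have "P \<inter> span {x} \<subseteq> {0}"
      using dis N(1) x by (auto simp: span_singleton dest: subspace_scale)
    then have "dim U = dim P + 1"
      using dim_sums_Int[OF P(1) subspace_span[of "{x}"]] x0 unfolding U_def
      by (simp add: dim_eq_0[THEN iffD2])
    ultimately show False using P(3) by linarith
  qed
  have orth: "b x u = 0" if "u \<in> P" "x \<in> N" for u x using that by (simp add: N_def)
  show thesis using that[OF P N d np orth dis] by simp
qed

text \<open>Adding the radical to a maximal positive subspace keeps the form nonnegative and creates
  no null vectors outside the radical. The enlarged dimension makes the later counts sharp.\<close>

lemma nonneg_subspace:
  obtains P where "subspace P" "P \<subseteq> S" "dim P = n_plus (\<lambda>v. b v v) S + dim (rad b S)"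
    "\<And>x. x \<in> P \<Longrightarrow> b x x \<ge> 0" "\<And>x. x \<in> P \<Longrightarrow> b x x = 0 \<Longrightarrow> x \<in> rad b S"
proof -
  obtain P where P: "subspace P" "P \<subseteq> S" "dim P = n_plus (\<lambda>v. b v v) S"
    "\<And>u. u \<in> P \<Longrightarrow> u \<noteq> 0 \<Longrightarrow> b u u > 0"
    using n_plus_witness[OF S] by blast
  let ?R = "rad b S"
  define A where "A = {x + y |x y. x \<in> P \<and> y \<in> ?R}"
  have RS: "?R \<subseteq> S" by (auto simp: rad_def)
  have A: "subspace A" unfolding A_def by (rule subspace_sums[OF P(1) subspace_rad])
  have AS: "A \<subseteq> S" unfolding A_def using P RS by (auto intro!: subspace_add[OF S])
  have "P \<inter> ?R \<subseteq> {0}" using P(4) by (fastforce simp: rad_def)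
  then have "dim (P \<inter> ?R) = 0" by simp
  then have dA: "dim A = n_plus (\<lambda>v. b v v) S + dim ?R"
    using dim_sums_Int[OF P(1) subspace_rad] P(3) unfolding A_def by linarith
  have eq: "b (p + r) (p + r) = b p p" if "p \<in> P" "r \<in> ?R" for p r
  proof -
    have "b r p = 0" "b p r = 0" "b r r = 0"
      using that P(2) RS sym[of p r] by (auto simp: rad_def)
    then show ?thesis by (simp add: bilinear_ladd[OF bil] bilinear_radd[OF bil])
  qed
  have 1: "b x x \<ge> 0" if x: "x \<in> A" for x
  proof -
    obtain p r where pr: "p \<in> P" "r \<in> ?R" "x = p + r" using x unfolding A_def by blast
    show ?thesis
      using eq[OF pr(1,2)] P(4)[OF pr(1)] bilinear_lzero[OF bil] pr(3) by (cases "p = 0") auto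
  qed
  have 2: "x \<in> ?R" if x: "x \<in> A" "b x x = 0" for x
  proof -
    obtain p r where "p \<in> P" "r \<in> ?R" "x = p + r" using x(1) unfolding A_def by blast
    moreover from this have "p = 0" using x(2) eq P(4)[of p] by fastforce
    ultimately show ?thesis by simp
  qed
  show thesis using that[OF A AS dA 1 2] .
qed

text \<open>On the complement \<open>N\<close> of a maximal positive \<open>P\<close> every null
  vector is radical, so \<open>N\<close> splits into a negative definite part and the radical; this
  bounds \<open>n_minus\<close> from below. The upper bound holds because a negative definite
  subspace meets the enlarged nonnegative subspace only in 0.\<close>

lemma sylvester: "n_plus (\<lambda>v. b v v) S + n_minus (\<lambda>v. b v v) S + dim (rad b S) = dim S"
proof -
  obtain P N where P: "subspace P" "P \<subseteq> S" "dim P = n_plus (\<lambda>v. b v v) S"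
    "\<And>u. u \<in> P \<Longrightarrow> u \<noteq> 0 \<Longrightarrow> b u u > 0"
    and N: "subspace N" "N \<subseteq> S" "dim P + dim N = dim S" "\<And>x. x \<in> N \<Longrightarrow> b x x \<le> 0"
    and orth: "\<And>u x. u \<in> P \<Longrightarrow> x \<in> N \<Longrightarrow> b x u = 0" and dis: "P \<inter> N \<subseteq> {0}"
    using nonpos_complement by blast
  let ?R = "rad b S"
  have RS: "?R \<subseteq> S" by (auto simp: rad_def)
  have decomp: "{x + y |x y. x \<in> P \<and> y \<in> N} = S"
  proof (rule subspace_dim_equal)
    show "{x + y |x y. x \<in> P \<and> y \<in> N} \<subseteq> S" using P N S by (auto intro: subspace_add)
    have "dim (P \<inter> N) = 0" using dis by simp
    then show "dim S \<le> dim {x + y |x y. x \<in> P \<and> y \<in> N}"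
      using dim_sums_Int[OF P(1) N(1)] N(3) by linarith
  qed (use subspace_sums[OF P(1) N(1)] S in auto)
  have radN: "x \<in> ?R" if x: "x \<in> N" "b x x = 0" for x
  proof -
    have "x \<in> rad b N"
      using sym_form.semidef_rad[OF restrict[OF N(1,2)]] N(4) x by blast
    then have 1: "b x y = 0" if "y \<in> N" for y using that by (simp add: rad_def)
    have "b x y = 0" if y: "y \<in> S" for y
    proof -
      obtain p q where "p \<in> P" "q \<in> N" "y = p + q" using y decomp by blast
      then show ?thesis using 1 orth[OF _ x(1)] by (simp add: bilinear_radd[OF bil])
    qed
    then show ?thesis using x N(2) by (auto simp: rad_def)
  qed
  have RN: "?R \<subseteq> N"
  proof
    fix x assume x: "x \<in> ?R"
    obtain p q where pq: "p \<in> P" "q \<in> N" "x = p + q" using x RS decomp by blast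
    have "b x p = 0" using x pq(1) P(2) by (auto simp: rad_def)
    then have "b p p = 0" using pq orth by (simp add: bilinear_ladd[OF bil])
    then have "p = 0" using P(4)[OF pq(1)] by fastforce
    then show "x \<in> N" using pq by simp
  qed
  obtain M where M: "subspace M" "M \<subseteq> N" "M \<inter> ?R \<subseteq> {0}" "dim M + dim ?R = dim N"
    using subspace_complement_exists[OF subspace_rad N(1) RN] by blast
  have ge: "dim M \<le> n_minus (\<lambda>v. b v v) S"
    unfolding n_minus_def
  proof (rule n_plus_ge[OF M(1)])
    show "M \<subseteq> S" using M(2) N(2) by blast
    fix u assume u: "u \<in> M" "u \<noteq> 0"
    then have "b u u \<le> 0" using M N by blast
    moreover have "b u u \<noteq> 0" using radN[of u] u M by blast
    ultimately show "- b u u > 0" by simp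
  qed
  obtain M' where M': "subspace M'" "M' \<subseteq> S" "dim M' = n_minus (\<lambda>v. b v v) S"
      "\<And>u. u \<in> M' \<Longrightarrow> u \<noteq> 0 \<Longrightarrow> - b u u > 0"
    unfolding n_minus_def using n_plus_witness[OF S, of "\<lambda>v. - b v v"] by blast
  obtain Q where Q: "subspace Q" "Q \<subseteq> S" "dim Q = n_plus (\<lambda>v. b v v) S + dim ?R"
    "\<And>x. x \<in> Q \<Longrightarrow> b x x \<ge> 0" "\<And>x. x \<in> Q \<Longrightarrow> b x x = 0 \<Longrightarrow> x \<in> ?R"
    using nonneg_subspace by blast
  have "M' \<inter> Q \<subseteq> {0}" using M'(4) Q(4) by force
  then have "dim M' + dim Q \<le> dim S" by (rule dim_disjoint_le[OF M'(1) Q(1) S M'(2) Q(2)])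
  then show ?thesis using ge M(4) N(3) P(3) M'(3) Q(3) by linarith
qed

text \<open>\<open>F \<inter> G\<close> is isotropic and orthogonal to both pieces, so together with
  positive subspaces of \<open>F\<close> and \<open>G\<close> it spans a nonnegative subspace. That
  subspace avoids a maximal negative one, whose dimension is \<open>dim S\<close> minus the positive
  index by nondegeneracy.\<close>

lemma n_plus_orth_split_ge:
  assumes nondeg: "rad b S = {0}" and F: "subspace F" "F \<subseteq> S"
    and G: "G = {x\<in>S. \<forall>u\<in>F. b x u = 0}"
  shows "n_plus (\<lambda>v. b v v) F + n_plus (\<lambda>v. b v v) G + dim (F \<inter> G) \<le> n_plus (\<lambda>v. b v v) S"
proof -
  have sG: "subspace G" "G \<subseteq> S" unfolding G using subspace_orth by auto
  let ?Q = "\<lambda>v. b v v"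
  obtain P1 where P1: "subspace P1" "P1 \<subseteq> F" "dim P1 = n_plus ?Q F" "\<And>u. u \<in> P1 \<Longrightarrow> u \<noteq> 0 \<Longrightarrow> b u u > 0"
    using n_plus_witness[OF F(1)] by blast
  obtain P2 where P2: "subspace P2" "P2 \<subseteq> G" "dim P2 = n_plus ?Q G" "\<And>u. u \<in> P2 \<Longrightarrow> u \<noteq> 0 \<Longrightarrow> b u u > 0"
    using n_plus_witness[OF sG(1)] by blast
  obtain M where M: "subspace M" "M \<subseteq> S" "dim M = n_minus ?Q S" "\<And>u. u \<in> M \<Longrightarrow> u \<noteq> 0 \<Longrightarrow> - b u u > 0"
    unfolding n_minus_def using n_plus_witness[OF S, of "\<lambda>v. - b v v"] by blast
  let ?R = "F \<inter> G"
  have R: "subspace ?R" using F sG by (simp add: subspace_inter)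
  define A where "A = {x + y |x y. x \<in> P1 \<and> y \<in> ?R}"
  define B where "B = {x + y |x y. x \<in> A \<and> y \<in> P2}"
  have A: "subspace A" unfolding A_def by (rule subspace_sums[OF P1(1) R])
  have B: "subspace B" unfolding B_def by (rule subspace_sums[OF A P2(1)])
  have AF: "A \<subseteq> F" unfolding A_def using P1 F by (auto intro: subspace_add)
  have BS: "B \<subseteq> S" unfolding B_def using AF F sG P2 S by (auto intro!: subspace_add[OF S])
  have FG: "b x y = 0" "b y x = 0" if "x \<in> F" "y \<in> G" for x y
    using that F sym[of x y] unfolding G by auto
  have "P1 \<inter> ?R \<subseteq> {0}" using FG P1(4) by fastforce
  then have "dim (P1 \<inter> ?R) = 0" by simp
  then have dA: "dim A = dim P1 + dim ?R" using dim_sums_Int[OF P1(1) R] unfolding A_def by linarith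
  have "A \<inter> P2 \<subseteq> {0}" using FG P2(2,4) AF by fastforce
  then have "dim (A \<inter> P2) = 0" by simp
  then have dB: "dim B = dim A + dim P2" using dim_sums_Int[OF A P2(1)] unfolding B_def by linarith
  have "M \<inter> B \<subseteq> {0}"
  proof
    fix x assume "x \<in> M \<inter> B"
    then obtain p r q where x: "x \<in> M" "p \<in> P1" "r \<in> F" "r \<in> G" "q \<in> P2" "x = p + r + q"
      unfolding B_def A_def by blast
    have "b x x = b p p + b q q"
      unfolding x(6) using FG x P1(2) P2(2) FG(1)[OF x(3,4)]
      by (simp add: bilinear_ladd[OF bil] bilinear_radd[OF bil] subset_iff)
    moreover have "b p p \<ge> 0" "b q q \<ge> 0"
      using P1(4)[OF x(2)] P2(4)[OF x(5)] bilinear_lzero[OF bil] by (metis less_eq_real_def)+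
    ultimately have "x = 0" using M(4)[OF x(1)] by fastforce
    then show "x \<in> {0}" by simp
  qed
  then have "dim M + dim B \<le> dim S" by (rule dim_disjoint_le[OF M(1) B S M(2) BS])
  moreover have "n_plus ?Q S + n_minus ?Q S = dim S" using sylvester nondeg by simp
  ultimately show ?thesis using dA dB M(3) P1(3) P2(3) by linarith
qed

end

lemma (in sym_form) nonpos_subspace:
  obtains N where "subspace N" "N \<subseteq> S" "n_plus (\<lambda>v. b v v) S + dim N = dim S"
    "\<And>x. x \<in> N \<Longrightarrow> b x x \<le> 0"
proof -
  obtain P N where "subspace P" "P \<subseteq> S" "dim P = n_plus (\<lambda>v. b v v) S"
    "\<And>u. u \<in> P \<Longrightarrow> u \<noteq> 0 \<Longrightarrow> b u u > 0"
    and N: "subspace N" "N \<subseteq> S" "dim P + dim N = dim S" "\<And>x. x \<in> N \<Longrightarrow> b x x \<le> 0"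
    and "\<And>u x. u \<in> P \<Longrightarrow> x \<in> N \<Longrightarrow> b x u = 0" "P \<inter> N \<subseteq> {0}"
    using nonpos_complement by blast
  then show ?thesis using that[OF N(1,2) _ N(4)] by simp
qed

text \<open>A positive subspace for the sum contains no nonzero vector at which both forms are
  nonpositive; the two nonpositive subspaces have the two indices as codimensions.\<close>

lemma n_plus_subadd:
  fixes b c :: "'a::euclidean_space \<Rightarrow> 'a \<Rightarrow> real"
  assumes b: "sym_form b S" and c: "sym_form c S"
  shows "n_plus (\<lambda>v. b v v + c v v) S \<le> n_plus (\<lambda>v. b v v) S + n_plus (\<lambda>v. c v v) S"
proof -
  have S: "subspace S" using b by (simp add: sym_form_def)
  obtain P where P: "subspace P" "P \<subseteq> S" "dim P = n_plus (\<lambda>v. b v v + c v v) S"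
    "\<And>u. u \<in> P \<Longrightarrow> u \<noteq> 0 \<Longrightarrow> b u u + c u u > 0"
    using n_plus_witness[OF S, of "\<lambda>v. b v v + c v v"] by blast
  obtain N1 where 1: "subspace N1" "N1 \<subseteq> S"
    "n_plus (\<lambda>v. b v v) S + dim N1 = dim S" "\<And>x. x \<in> N1 \<Longrightarrow> b x x \<le> 0"
    using sym_form.nonpos_subspace[OF b] by blast
  obtain N2 where 2: "subspace N2" "N2 \<subseteq> S"
    "n_plus (\<lambda>v. c v v) S + dim N2 = dim S" "\<And>x. x \<in> N2 \<Longrightarrow> c x x \<le> 0"
    using sym_form.nonpos_subspace[OF c] by blast
  have "dim N1 + dim N2 \<le> dim S + dim (N1 \<inter> N2)"
    by (rule dim_Int_ge[OF 1(1) 2(1) S 1(2) 2(2)])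
  moreover have "P \<inter> (N1 \<inter> N2) \<subseteq> {0}" using P(4) 1(4) 2(4) by force
  then have "dim P + dim (N1 \<inter> N2) \<le> dim S"
    using 1(2) by (intro dim_disjoint_le[OF P(1) subspace_inter[OF 1(1) 2(1)] S P(2)]) auto
  ultimately show ?thesis using P(3) 1(3) 2(3) by linarith
qed

text \<open>On the intersection of the two enlarged nonnegative subspaces the sum vanishes only at
  vectors in both radicals, and a complement of those vectors is positive. The radical dimensions
  minus that of their intersection give the dimension of the span.\<close>

lemma n_plus_add_ge:
  fixes b c :: "'a::euclidean_space \<Rightarrow> 'a \<Rightarrow> real"
  assumes b: "sym_form b S" and c: "sym_form c S"
  shows "n_plus (\<lambda>v. b v v) S + n_plus (\<lambda>v. c v v) S + dim (span (rad b S \<union> rad c S))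
         \<le> n_plus (\<lambda>v. b v v + c v v) S + dim S"
proof -
  have S: "subspace S" using b by (simp add: sym_form_def)
  have Rb: "subspace (rad b S)" and Rc: "subspace (rad c S)"
    using b c by (auto intro: sym_form.subspace_rad)
  obtain P where P: "subspace P" "P \<subseteq> S" "dim P = n_plus (\<lambda>v. b v v) S + dim (rad b S)"
    "\<And>x. x \<in> P \<Longrightarrow> b x x \<ge> 0" "\<And>x. x \<in> P \<Longrightarrow> b x x = 0 \<Longrightarrow> x \<in> rad b S"
    using sym_form.nonneg_subspace[OF b] by blast
  obtain P' where P': "subspace P'" "P' \<subseteq> S" "dim P' = n_plus (\<lambda>v. c v v) S + dim (rad c S)"
    "\<And>x. x \<in> P' \<Longrightarrow> c x x \<ge> 0" "\<And>x. x \<in> P' \<Longrightarrow> c x x = 0 \<Longrightarrow> x \<in> rad c S"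
    using sym_form.nonneg_subspace[OF c] by blast
  define X where "X = P \<inter> P'"
  define R where "R = X \<inter> (rad b S \<inter> rad c S)"
  have X: "subspace X" unfolding X_def using P P' by (simp add: subspace_inter)
  have R: "subspace R" unfolding R_def using X Rb Rc by (simp add: subspace_inter)
  obtain N where N: "subspace N" "N \<subseteq> X" "N \<inter> R \<subseteq> {0}" "dim N + dim R = dim X"
    using subspace_complement_exists[OF R X] unfolding R_def by blast
  have "dim N \<le> n_plus (\<lambda>v. b v v + c v v) S"
  proof (rule n_plus_ge[OF N(1)])
    show "N \<subseteq> S" using N(2) P(2) unfolding X_def by blast
    fix u assume u: "u \<in> N" "u \<noteq> 0"
    then have nn: "b u u \<ge> 0" "c u u \<ge> 0" using N(2) P P' by (auto simp: X_def)
    have "\<not> (b u u = 0 \<and> c u u = 0)"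
      using u N P(5)[of u] P'(5)[of u] unfolding R_def X_def by blast
    then show "b u u + c u u > 0" using nn by linarith
  qed
  moreover have "dim P + dim P' \<le> dim S + dim X"
    unfolding X_def by (rule dim_Int_ge[OF P(1) P'(1) S P(2) P'(2)])
  moreover have "dim R \<le> dim (rad b S \<inter> rad c S)" unfolding R_def by (rule dim_subset) blast
  moreover have "dim (span (rad b S \<union> rad c S)) + dim (rad b S \<inter> rad c S) = dim (rad b S) + dim (rad c S)"
  proof -
    have e: "span (rad b S) = rad b S" "span (rad c S) = rad c S"
      using Rb Rc by (simp_all only: span_eq_iff)
    have "span (rad b S \<union> rad c S) = {x + y |x y. x \<in> rad b S \<and> y \<in> rad c S}"
      using span_Un[of "rad b S" "rad c S"] unfolding e .
    then show ?thesis using dim_sums_Int[OF Rb Rc] by (simp only:)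
  qed
  ultimately show ?thesis using P(3) P'(3) N(4) by linarith
qed

section \<open>Positive index along convergent forms\<close>

lemma eventually_posdef:
  fixes b :: "'s \<Rightarrow> 'a::euclidean_space \<Rightarrow> 'a \<Rightarrow> real"
  assumes bil: "eventually (\<lambda>s. bilinear (b s)) F" and U: "subspace U"
    and lim: "\<And>x y. x \<in> U \<Longrightarrow> y \<in> U \<Longrightarrow> ((\<lambda>s. b s x y) \<longlongrightarrow> g x y) F"
    and pos: "\<And>u. u \<in> U \<Longrightarrow> u \<noteq> 0 \<Longrightarrow> g u u > 0"
  shows "eventually (\<lambda>s. \<forall>u\<in>U. u \<noteq> 0 \<longrightarrow> b s u u > 0) F"
proof (cases "F = bot \<or> U = {0}")
  case False
  then have F: "F \<noteq> bot" and U0: "U \<noteq> {0}" by auto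
  obtain B where B: "B \<subseteq> U" "pairwise orthogonal B" "\<And>x. x \<in> B \<Longrightarrow> norm x = 1"
    "independent B" "card B = dim U" "span B = U"
    using orthonormal_basis_subspace[OF U] by blast
  have finB: "finite B" using B(4) by (rule independent_imp_finite)
  \<comment> \<open>\<open>E h\<close> is the quadratic form written with the finitely many entries
    \<open>h i j\<close>, so entrywise convergence controls it uniformly on the unit sphere.\<close>
  define E where "E h u = (\<Sum>i\<in>B. \<Sum>j\<in>B. (u \<bullet> i) * (u \<bullet> j) * h i j)" for h :: "'a \<Rightarrow> 'a \<Rightarrow> real" and u
  have exp: "(\<Sum>i\<in>B. (u \<bullet> i) *\<^sub>R i) = u" if "u \<in> U" for u
    using orthonormal_basis_expand[OF B(2,3) _ finB] that B(6) by blast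
  have bE: "h u u = E h u" if "bilinear h" "u \<in> U" for h u
  proof -
    have "h u u = h (\<Sum>i\<in>B. (u \<bullet> i) *\<^sub>R i) (\<Sum>i\<in>B. (u \<bullet> i) *\<^sub>R i)" using exp[OF that(2)] by simp
    also have "\<dots> = E h u"
      unfolding bilinear_sum[OF that(1)] E_def
      by (simp add: sum.cartesian_product[symmetric] bilinear_lmul[OF that(1)] bilinear_rmul[OF that(1)] mult_ac)
    finally show ?thesis .
  qed
  \<comment> \<open>The limit \<open>g\<close> inherits the coordinate formula from the forms
    \<open>b s\<close> by uniqueness of limits.\<close>
  have gE: "g u u = E g u" if u: "u \<in> U" for u
  proof (rule tendsto_unique[OF F])
    show "((\<lambda>s. b s u u) \<longlongrightarrow> g u u) F" using lim u by blast
    have "((\<lambda>s. E (b s) u) \<longlongrightarrow> E g u) F"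
      unfolding E_def using B(1) by (intro tendsto_intros lim) auto
    moreover have "eventually (\<lambda>s. E (b s) u = b s u u) F"
      using bil by eventually_elim (simp add: bE u)
    ultimately show "((\<lambda>s. b s u u) \<longlongrightarrow> E g u) F"
      by (rule Lim_transform_eventually)
  qed
  define K where "K = U \<inter> sphere 0 1"
  have K: "compact K" unfolding K_def using closed_subspace[OF U] by (simp add: closed_Int_compact)
  obtain u0 where u0: "u0 \<in> U" "u0 \<noteq> 0" using U0 subspace_0[OF U] by blast
  then have "u0 /\<^sub>R norm u0 \<in> K" unfolding K_def using subspace_scale[OF U] by auto
  then have "K \<noteq> {}" by blast
  moreover have "continuous_on K (E g)" unfolding E_def by (intro continuous_intros)
  ultimately obtain m where m: "m \<in> K" "\<And>u. u \<in> K \<Longrightarrow> E g m \<le> E g u"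
    using continuous_attains_inf[OF K] by blast
  have "m \<in> U" "m \<noteq> 0" using m(1) by (auto simp: K_def)
  then have c: "E g m > 0" using gE pos by metis
  \<comment> \<open>The error is a sum of \<open>(card B)\<^sup>2\<close> terms bounded by
    \<open>\<epsilon>\<close>, hence smaller than the minimum \<open>E g m\<close> on the
    sphere.\<close>
  define \<epsilon> where "\<epsilon> = E g m / (2 * (real (card B))\<^sup>2 + 1)"
  have d: "2 * (real (card B))\<^sup>2 + 1 > 0" by (simp add: add_nonneg_pos)
  have e: "\<epsilon> > 0" unfolding \<epsilon>_def using c d by simp
  have "eventually (\<lambda>s. \<forall>i\<in>B. \<forall>j\<in>B. \<bar>b s i j - g i j\<bar> < \<epsilon>) F"
  proof -
    have "eventually (\<lambda>s. \<bar>b s i j - g i j\<bar> < \<epsilon>) F" if "i \<in> B" "j \<in> B" for i j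
      using tendstoD[OF lim e, of i j] that B(1) by (auto simp: dist_real_def)
    then show ?thesis using finB by (simp add: eventually_ball_finite)
  qed
  then show ?thesis
    using bil
  proof eventually_elim
    case (elim s)
    show ?case
    proof (intro ballI impI)
      fix u assume u: "u \<in> U" "u \<noteq> 0"
      define v where "v = u /\<^sub>R norm u"
      have v: "v \<in> K" "v \<in> U" unfolding v_def K_def using u subspace_scale[OF U] by auto
      have nv: "norm v = 1" using v by (simp add: K_def)
      have vi: "\<bar>v \<bullet> i\<bar> \<le> 1" if "i \<in> B" for i
        using Cauchy_Schwarz_ineq2[of v i] nv B(3)[OF that] by simp
      have "\<bar>E (b s) v - E g v\<bar> = \<bar>\<Sum>i\<in>B. \<Sum>j\<in>B. (v \<bullet> i) * (v \<bullet> j) * (b s i j - g i j)\<bar>"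
        unfolding E_def by (simp add: sum_subtractf[symmetric] right_diff_distrib)
      also have "\<dots> \<le> (\<Sum>i\<in>B. \<Sum>j\<in>B. \<epsilon>)"
      proof (intro sum_abs[THEN order_trans] sum_mono)
        fix i j assume ij: "i \<in> B" "j \<in> B"
        have "\<bar>(v \<bullet> i) * (v \<bullet> j) * (b s i j - g i j)\<bar> = \<bar>v \<bullet> i\<bar> * \<bar>v \<bullet> j\<bar> * \<bar>b s i j - g i j\<bar>"
          by (simp add: abs_mult)
        also have "\<dots> \<le> 1 * 1 * \<epsilon>"
          using vi ij elim(1) by (intro mult_mono) (auto intro: less_imp_le)
        finally show "\<bar>(v \<bullet> i) * (v \<bullet> j) * (b s i j - g i j)\<bar> \<le> \<epsilon>" by simp
      qed
      also have "\<dots> = (real (card B))\<^sup>2 * \<epsilon>" by (simp add: power2_eq_square)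
      also have "\<dots> < E g m"
      proof -
        have "(real (card B))\<^sup>2 * \<epsilon> < (2 * (real (card B))\<^sup>2 + 1) * \<epsilon>"
          using e by (intro mult_strict_right_mono) (auto intro: add_nonneg_pos)
        also have "\<dots> = E g m" unfolding \<epsilon>_def using d by simp
        finally show ?thesis .
      qed
      finally have "E (b s) v > 0" using m(2)[OF v(1)] by linarith
      then have pv: "b s v v > 0" using bE elim v by metis
      have uv: "u = norm u *\<^sub>R v" using u by (simp add: v_def)
      have "b s u u = (norm u)\<^sup>2 * b s v v"
        by (subst (1 2) uv) (simp add: bilinear_lmul[OF elim(2)] bilinear_rmul[OF elim(2)] power2_eq_square)
      then show "b s u u > 0" using pv u by simp
    qed
  qed
qed (use pos in auto)

lemma eventually_n_plus_ge:
  fixes b :: "'s \<Rightarrow> 'a::euclidean_space \<Rightarrow> 'a \<Rightarrow> real"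
  assumes bil: "eventually (\<lambda>s. bilinear (b s)) F" and S: "subspace S"
    and lim: "\<And>x y. x \<in> S \<Longrightarrow> y \<in> S \<Longrightarrow> ((\<lambda>s. b s x y) \<longlongrightarrow> g x y) F"
  shows "eventually (\<lambda>s. n_plus (\<lambda>v. g v v) S \<le> n_plus (\<lambda>v. b s v v) S) F"
proof -
  obtain P where P: "subspace P" "P \<subseteq> S" "dim P = n_plus (\<lambda>v. g v v) S"
    "\<And>u. u \<in> P \<Longrightarrow> u \<noteq> 0 \<Longrightarrow> g u u > 0"
    using n_plus_witness[OF S, of "\<lambda>v. g v v"] by blast
  have "eventually (\<lambda>s. \<forall>u\<in>P. u \<noteq> 0 \<longrightarrow> b s u u > 0) F"
    using eventually_posdef[OF bil P(1)] lim P(2,4) by blast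
  then show ?thesis
    by eventually_elim (use n_plus_ge[OF P(1,2)] P(3) in auto)
qed

text \<open>Positive and negative index can only grow near the limit form, while their sum is fixed
  by the constant dimension of the radical.\<close>

lemma eventually_n_plus_eq:
  fixes b :: "'s \<Rightarrow> 'a::euclidean_space \<Rightarrow> 'a \<Rightarrow> real"
  assumes b: "eventually (\<lambda>s. sym_form (b s) S) F" and g: "sym_form g S"
    and lim: "\<And>x y. x \<in> S \<Longrightarrow> y \<in> S \<Longrightarrow> ((\<lambda>s. b s x y) \<longlongrightarrow> g x y) F"
    and rad: "eventually (\<lambda>s. dim (rad (b s) S) = dim (rad g S)) F"
  shows "eventually (\<lambda>s. n_plus (\<lambda>v. b s v v) S = n_plus (\<lambda>v. g v v) S) F"
proof -
  have S: "subspace S" using g by (simp add: sym_form_def)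
  have 1: "eventually (\<lambda>s. n_plus (\<lambda>v. g v v) S \<le> n_plus (\<lambda>v. b s v v) S) F"
    by (rule eventually_n_plus_ge[OF _ S lim])
       (use b in \<open>auto elim!: eventually_mono simp: sym_form_def\<close>)
  have 2: "eventually (\<lambda>s. n_plus (\<lambda>v. - g v v) S \<le> n_plus (\<lambda>v. - b s v v) S) F"
  proof (rule eventually_n_plus_ge[where b = "\<lambda>s x y. - b s x y" and g = "\<lambda>x y. - g x y", OF _ S])
    show "eventually (\<lambda>s. bilinear (\<lambda>x y. - b s x y)) F"
      using b by eventually_elim (rule sym_form.bil[OF sym_form.uminus])
  qed (intro tendsto_minus lim)
  show ?thesis using 1 2 b rad
  proof eventually_elim
    case (elim s)
    show ?case
      using elim(1,2,4) sym_form.sylvester[OF elim(3)] sym_form.sylvester[OF g]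
      unfolding n_minus_def by linarith
  qed
qed

text \<open>Rescaling the radical by \<open>1 / r\<close> makes the forms converge to the nondegenerate limit
  \<open>g0 \<oplus> g\<close> on the product of a positive subspace and the radical.\<close>

lemma eventually_n_plus_crossing_ge:
  fixes b :: "'s \<Rightarrow> 'a::euclidean_space \<Rightarrow> 'a \<Rightarrow> real"
  assumes b: "eventually (\<lambda>s. sym_form (b s) S) F" and g0: "sym_form g0 S"
    and N: "subspace N" "N \<subseteq> S"
    and r: "eventually (\<lambda>s. r s > 0) F"
    and lim0: "\<And>x y. x \<in> S \<Longrightarrow> y \<in> S \<Longrightarrow> ((\<lambda>s. b s x y) \<longlongrightarrow> g0 x y) F"
    and lim1: "\<And>x y. x \<in> S \<Longrightarrow> y \<in> N \<Longrightarrow> ((\<lambda>s. b s x y / r s) \<longlongrightarrow> 0) F"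
    and lim2: "\<And>x y. x \<in> N \<Longrightarrow> y \<in> N \<Longrightarrow> ((\<lambda>s. b s x y / (r s)\<^sup>2) \<longlongrightarrow> g x y) F"
  shows "eventually (\<lambda>s. n_plus (\<lambda>v. g0 v v) S + n_plus (\<lambda>v. g v v) N \<le> n_plus (\<lambda>v. b s v v) S) F"
proof (cases "F = bot")
  case nb: False
  have S: "subspace S" using g0 by (simp add: sym_form_def)
  obtain P where P: "subspace P" "P \<subseteq> S" "dim P = n_plus (\<lambda>v. g0 v v) S"
    "\<And>u. u \<in> P \<Longrightarrow> u \<noteq> 0 \<Longrightarrow> g0 u u > 0"
    using n_plus_witness[OF S, of "\<lambda>v. g0 v v"] by blast
  obtain M where M: "subspace M" "M \<subseteq> N" "dim M = n_plus (\<lambda>v. g v v) N"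
    "\<And>u. u \<in> M \<Longrightarrow> u \<noteq> 0 \<Longrightarrow> g u u > 0"
    using n_plus_witness[OF N(1), of "\<lambda>v. g v v"] by blast
  define T where "T s z = fst z + (1 / r s) *\<^sub>R snd z" for s and z :: "'a \<times> 'a"
  have T: "linear (T s)" for s
    unfolding T_def by (rule linearI) (auto simp: algebra_simps)
  have TS: "T s ` (P \<times> M) \<subseteq> S" for s
    unfolding T_def using P M N by (auto intro!: subspace_add[OF S] subspace_scale[OF S])
  have PM: "subspace (P \<times> M)" using P(1) M(1) by (rule subspace_Times)
  have "eventually (\<lambda>s. \<forall>z\<in>P \<times> M. z \<noteq> 0 \<longrightarrow> b s (T s z) (T s z) > 0) F"
  proof (rule eventually_posdef[where b = "\<lambda>s z z'. b s (T s z) (T s z')" and g = "\<lambda>z z'. g0 (fst z) (fst z') + g (snd z) (snd z')"])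
    show "subspace (P \<times> M)" by fact
    show "eventually (\<lambda>s. bilinear (\<lambda>z z'. b s (T s z) (T s z'))) F"
      using b
    proof eventually_elim
      case (elim s)
      then have "bilinear (b s)" by (simp add: sym_form_def)
      then show ?case
        unfolding bilinear_def using linear_compose[OF T[of s]] by (auto simp: o_def)
    qed
    fix z z' assume "z \<in> P \<times> M" "z' \<in> P \<times> M"
    then have z: "fst z \<in> S" "fst z' \<in> S" "snd z \<in> N" "snd z' \<in> N" "snd z \<in> S" "snd z' \<in> S"
      using P M N by auto
    have "((\<lambda>s. b s (fst z) (fst z') + b s (fst z) (snd z') / r s + b s (fst z') (snd z) / r s
       + b s (snd z) (snd z') / (r s)\<^sup>2) \<longlongrightarrow> g0 (fst z) (fst z') + 0 + 0 + g (snd z) (snd z')) F"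
      by (intro tendsto_add lim0 lim1 lim2 z)
    then show "((\<lambda>s. b s (T s z) (T s z')) \<longlongrightarrow> g0 (fst z) (fst z') + g (snd z) (snd z')) F"
    proof (rule Lim_transform_eventually[OF tendsto_eq_rhs])
      show "eventually (\<lambda>s. b s (fst z) (fst z') + b s (fst z) (snd z') / r s + b s (fst z') (snd z) / r s
       + b s (snd z) (snd z') / (r s)\<^sup>2 = b s (T s z) (T s z')) F"
        using b
      proof eventually_elim
        case (elim s)
        then interpret sym_form "b s" S .
        show ?case unfolding T_def
          using sym[OF z(2,5)]
          by (simp add: bilinear_ladd[OF bil] bilinear_radd[OF bil] bilinear_lmul[OF bil] bilinear_rmul[OF bil]
              power2_eq_square algebra_simps)
      qed
    qed simp
  next
    fix z assume z: "z \<in> P \<times> M" "z \<noteq> 0"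
    \<comment> \<open>\<open>g\<close> is known only as a limit on \<open>N\<close>, so even its
      value at 0 is read off from the forms \<open>b s\<close>.\<close>
    have "g 0 0 = 0"
    proof (rule tendsto_unique[OF nb])
      show "((\<lambda>s. b s 0 0 / (r s)\<^sup>2) \<longlongrightarrow> g 0 0) F" using lim2[of 0 0] subspace_0[OF N(1)] by simp
      have "eventually (\<lambda>s. 0 = b s 0 0 / (r s)\<^sup>2) F"
        using b by eventually_elim (simp add: bilinear_lzero[OF sym_form.bil])
      then show "((\<lambda>s. b s 0 0 / (r s)\<^sup>2) \<longlongrightarrow> 0) F" by (rule Lim_transform_eventually[OF tendsto_const])
    qed
    moreover have "g0 0 0 = 0" using bilinear_lzero[OF sym_form.bil[OF g0]] .
    moreover have "snd z \<noteq> 0 \<Longrightarrow> g (snd z) (snd z) > 0" "fst z \<noteq> 0 \<Longrightarrow> g0 (fst z) (fst z) > 0"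
      using M(4) P(4) z by auto
    ultimately show "g0 (fst z) (fst z) + g (snd z) (snd z) > 0"
      using z(2) by (cases "fst z = 0"; cases "snd z = 0") (auto simp: prod_eq_iff)
  qed
  then have "eventually (\<lambda>s. n_plus (\<lambda>v. g0 v v) S + n_plus (\<lambda>v. g v v) N \<le> n_plus (\<lambda>v. b s v v) S) F"
    using b
  proof eventually_elim
    case (elim s)
    then interpret sym_form "b s" S by blast
    have ne: "T s z \<noteq> 0" if "z \<in> P \<times> M" "z \<noteq> 0" for z
      using elim(1) that bilinear_lzero[OF bil] by (metis less_irrefl)
    have "inj_on (T s) (P \<times> M)"
      using ne by (intro linear_inj_on_iff_eq_0[OF T PM, THEN iffD2]) blast
    then have "dim (T s ` (P \<times> M)) = dim (P \<times> M)"
      using dim_image_eq[OF T] by (metis PM span_eq_iff)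
    moreover have "dim (T s ` (P \<times> M)) \<le> n_plus (\<lambda>v. b s v v) S"
    proof (rule n_plus_ge[OF linear_subspace_image[OF T PM] TS])
      fix u assume "u \<in> T s ` (P \<times> M)" "u \<noteq> 0"
      then obtain z where z: "z \<in> P \<times> M" "u = T s z" by blast
      then have "z \<noteq> 0" using linear_0[OF T, of s] \<open>u \<noteq> 0\<close> by metis
      then show "b s u u > 0" using elim(1)[rule_format, OF z(1)] z(2) by simp
    qed
    moreover have "dim (P \<times> M) = dim P + dim M" by (rule dim_Times[OF P(1) M(1)])
    ultimately show ?case using P(3) M(3) by linarith
  qed
  then show ?thesis .
qed auto

text \<open>The lower bounds for \<open>b s\<close> and for its negative add up to the full
  dimension: nondegeneracy of \<open>g\<close> accounts for all of \<open>N\<close>, Sylvester's law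
  for \<open>g0\<close> for the rest. Hence both are equalities.\<close>

lemma eventually_n_plus_crossing:
  fixes b :: "'s \<Rightarrow> 'a::euclidean_space \<Rightarrow> 'a \<Rightarrow> real"
  assumes b: "eventually (\<lambda>s. sym_form (b s) S) F" and g0: "sym_form g0 S"
    and N: "N = rad g0 S"
    and r: "eventually (\<lambda>s. r s > 0) F"
    and lim0: "\<And>x y. x \<in> S \<Longrightarrow> y \<in> S \<Longrightarrow> ((\<lambda>s. b s x y) \<longlongrightarrow> g0 x y) F"
    and lim1: "\<And>x y. x \<in> S \<Longrightarrow> y \<in> N \<Longrightarrow> ((\<lambda>s. b s x y / r s) \<longlongrightarrow> 0) F"
    and lim2: "\<And>x y. x \<in> N \<Longrightarrow> y \<in> N \<Longrightarrow> ((\<lambda>s. b s x y / (r s)\<^sup>2) \<longlongrightarrow> g x y) F"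
    and nondeg: "n_plus (\<lambda>v. g v v) N + n_minus (\<lambda>v. g v v) N = dim N"
  shows "eventually (\<lambda>s. n_plus (\<lambda>v. b s v v) S = n_plus (\<lambda>v. g0 v v) S + n_plus (\<lambda>v. g v v) N) F"
proof -
  have N': "subspace N" "N \<subseteq> S" unfolding N using sym_form.subspace_rad[OF g0] by (auto simp: rad_def)
  have 1: "eventually (\<lambda>s. n_plus (\<lambda>v. g0 v v) S + n_plus (\<lambda>v. g v v) N \<le> n_plus (\<lambda>v. b s v v) S) F"
    by (rule eventually_n_plus_crossing_ge[OF b g0 N' r lim0 lim1 lim2])
  have 2: "eventually (\<lambda>s. n_plus (\<lambda>v. - g0 v v) S + n_plus (\<lambda>v. - g v v) N \<le> n_plus (\<lambda>v. - b s v v) S) F"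
  proof (rule eventually_n_plus_crossing_ge[where b = "\<lambda>s x y. - b s x y" and g = "\<lambda>x y. - g x y",
        OF _ sym_form.uminus[OF g0] N' r])
    show "eventually (\<lambda>s. sym_form (\<lambda>x y. - b s x y) S) F"
      using b by eventually_elim (rule sym_form.uminus)
    show "((\<lambda>s. - b s x y / r s) \<longlongrightarrow> 0) F" if "x \<in> S" "y \<in> N" for x y
      using tendsto_minus[OF lim1[OF that]] by simp
    show "((\<lambda>s. - b s x y / (r s)\<^sup>2) \<longlongrightarrow> - g x y) F" if "x \<in> N" "y \<in> N" for x y
      using tendsto_minus[OF lim2[OF that]] by simp
  qed (intro tendsto_minus lim0)
  show ?thesis using 1 2 b
  proof eventually_elim
    case (elim s)
    show ?case
      using elim(1,2) sym_form.sylvester[OF elim(3)] sym_form.sylvester[OF g0] nondeg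
      unfolding n_minus_def N by linarith
  qed
qed

declare split_paired_All [simp del] split_paired_Ex [simp del]

section \<open>Lagrangian subspaces and slopes\<close>

lemma bilinear_omega0: "bilinear omega0"
  by (simp add: bilinear_def linear_iff omega0_def inner_add_left inner_add_right algebra_simps)

lemma bounded_bilinear_omega0: "bounded_bilinear omega0"
  using bilinear_omega0 by (simp add: bilinear_conv_bounded_bilinear)

lemmas omega0_simps = bilinear_ladd[OF bilinear_omega0] bilinear_radd[OF bilinear_omega0]
  bilinear_lmul[OF bilinear_omega0] bilinear_rmul[OF bilinear_omega0]
  bilinear_lsub[OF bilinear_omega0] bilinear_rsub[OF bilinear_omega0]
  bilinear_lneg[OF bilinear_omega0] bilinear_rneg[OF bilinear_omega0]
  bilinear_lzero[OF bilinear_omega0] bilinear_rzero[OF bilinear_omega0]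

lemma omega0_swap: "omega0 y x = - omega0 x y"
  by (simp add: omega0_def inner_commute)

lemma J0_J0 [simp]: "J0 (J0 x) = - x"
  by (simp add: J0_def prod_eq_iff)

lemma linear_J0: "linear J0"
  by (rule linearI) (auto simp: J0_def)

lemma inner_J0 [simp]: "inner (J0 x) (J0 y) = inner x y"
  by (simp add: J0_def inner_prod_def)

lemma omega0_conv_inner: "omega0 x y = inner (J0 x) y"
  by (simp add: omega0_def J0_def inner_prod_def)

lemma omega0_J0_right [simp]: "omega0 x (J0 y) = inner x y"
  by (simp add: omega0_conv_inner)

lemma omega0_J0_left [simp]: "omega0 (J0 x) y = - inner x y"
  by (simp add: omega0_conv_inner)

definition transv :: "'n::finite sympl set \<Rightarrow> 'n sympl set \<Rightarrow> bool" where
  "transv A B \<longleftrightarrow> lagrangian A \<and> lagrangian B \<and> A \<inter> B = {0}"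

lemma transv_sym: "transv A B \<Longrightarrow> transv B A"
  by (auto simp: transv_def)

lemma lagrangian_subspace: "lagrangian L \<Longrightarrow> subspace L"
  by (simp add: lagrangian_def)

lemma lagrangian_dim: "lagrangian (L :: 'n::finite sympl set) \<Longrightarrow> dim L = CARD('n)"
  by (simp add: lagrangian_def)

lemma lagrangian_omega0: "lagrangian L \<Longrightarrow> x \<in> L \<Longrightarrow> y \<in> L \<Longrightarrow> omega0 x y = 0"
  by (simp add: lagrangian_def)

lemma transvD:
  assumes "transv A B"
  shows "lagrangian A" "lagrangian B" "subspace A" "subspace B"
  using assms lagrangian_subspace unfolding transv_def by blast+

lemma transv_0: "transv A B \<Longrightarrow> x \<in> A \<Longrightarrow> x \<in> B \<Longrightarrow> x = 0"
  unfolding transv_def by blast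

text \<open>\<open>J0\<close> maps \<open>L\<close> to a subspace meeting the symplectic orthogonal
  of \<open>L\<close> only in 0, since \<open>omega0 (J0 y) y\<close> is minus the squared norm of
  \<open>y\<close>. The dimension count then leaves no room beyond \<open>L\<close>.\<close>

lemma lagrangian_maximal:
  fixes L :: "'n::finite sympl set"
  assumes L: "lagrangian L" and x: "\<And>y. y \<in> L \<Longrightarrow> omega0 x y = 0"
  shows "x \<in> L"
proof -
  define X where "X = {x. \<forall>y\<in>L. omega0 x y = 0}"
  have X: "subspace X" by (auto simp: X_def subspace_def omega0_simps)
  have JL: "subspace (J0 ` L)" using linear_subspace_image[OF linear_J0 lagrangian_subspace[OF L]] .
  have "inj J0" by (rule injI) (metis J0_J0 neg_equal_iff_equal)
  then have dJ: "dim (J0 ` L) = CARD('n)"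
    using dim_image_eq[OF linear_J0, of L] lagrangian_dim[OF L] by (metis inj_on_subset top_greatest)
  have "X \<inter> J0 ` L \<subseteq> {0}"
  proof
    fix z assume "z \<in> X \<inter> J0 ` L"
    then obtain y where "z = J0 y" "y \<in> L" "omega0 z y = 0" unfolding X_def by blast
    then show "z \<in> {0}" using linear_0[OF linear_J0] by simp
  qed
  then have "dim X + dim (J0 ` L) \<le> dim (UNIV :: 'n sympl set)"
    by (intro dim_disjoint_le[OF X JL subspace_UNIV subset_UNIV subset_UNIV])
  moreover have "dim (UNIV :: 'n sympl set) = CARD('n) + CARD('n)" by simp
  ultimately have "dim X \<le> dim L" using dJ lagrangian_dim[OF L] by linarith
  moreover have "L \<subseteq> X" using lagrangian_omega0[OF L] unfolding X_def by blast
  ultimately have "L = X" using subspace_dim_equal[OF lagrangian_subspace[OF L] X] by blast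
  then show ?thesis using x unfolding X_def by blast
qed

lemma lagrangianI_image:
  fixes L :: "'n::finite sympl set"
  assumes L: "lagrangian L" and f: "linear f" and inj: "\<And>x. x \<in> L \<Longrightarrow> f x = 0 \<Longrightarrow> x = 0"
    and om: "\<And>x y. x \<in> L \<Longrightarrow> y \<in> L \<Longrightarrow> omega0 (f x) (f y) = 0"
  shows "lagrangian (f ` L :: 'n sympl set)"
proof -
  have sL: "subspace L" using L by (rule lagrangian_subspace)
  have "inj_on f L" using inj by (intro linear_inj_on_iff_eq_0[OF f sL, THEN iffD2]) blast
  then have "dim (f ` L) = dim L" using dim_image_eq[OF f] by (metis sL span_eq_iff)
  then show ?thesis unfolding lagrangian_def
    using om linear_subspace_image[OF f sL] lagrangian_dim[OF L] by auto
qed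

lemma transv_decomp:
  fixes x :: "'n::finite sympl"
  assumes "transv A W"
  obtains a w where "a \<in> A" "w \<in> W" "x = a + w"
proof -
  have A: "lagrangian A" and W: "lagrangian W" and AW: "A \<inter> W = {0}" using assms by (auto simp: transv_def)
  have "dim (A \<inter> W) = 0" using AW by simp
  moreover have "DIM('n sympl) = CARD('n) + CARD('n)" by simp
  ultimately have "dim {a + w |a w. a \<in> A \<and> w \<in> W} = DIM('n sympl)"
    using dim_sums_Int[OF lagrangian_subspace[OF A] lagrangian_subspace[OF W]]
      lagrangian_dim[OF A] lagrangian_dim[OF W] by linarith
  then have "{a + w |a w. a \<in> A \<and> w \<in> W} = UNIV"
    by (intro subspace_dim_equal[OF subspace_sums[OF lagrangian_subspace[OF A] lagrangian_subspace[OF W]]])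
       (simp_all only: subspace_UNIV subset_UNIV dim_UNIV order.refl)
  then show ?thesis using that by blast
qed

text \<open>For \<open>W\<close> transversal to \<open>l\<close>, the linear map \<open>slope W l\<close> with values in \<open>W\<close> writes \<open>l\<close> as a graph
  \<open>{a + slope W l a | a \<in> A}\<close> over any Lagrangian \<open>A\<close> transversal to \<open>W\<close>.\<close>

definition slope :: "'n::finite sympl set \<Rightarrow> 'n sympl set \<Rightarrow> 'n sympl \<Rightarrow> 'n sympl" where
  "slope W l x = (THE w. w \<in> W \<and> x + w \<in> l)"

lemma slope_eqI:
  assumes "transv W l" "w \<in> W" "x + w \<in> l"
  shows "slope W l x = w"
  unfolding slope_def
proof (rule the_equality)
  fix w' assume w': "w' \<in> W \<and> x + w' \<in> l"
  have "subspace W" "subspace l" using assms(1) by (simp_all add: transv_def lagrangian_subspace)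
  then have "w' - w \<in> W" "(x + w') - (x + w) \<in> l" using assms w' subspace_diff by blast+
  then have "w' - w = 0" using transv_0[OF assms(1), of "w' - w"] by (simp only: add_diff_cancel_left)
  then show "w' = w" by simp
qed (use assms in auto)

lemma slope_mem:
  assumes "transv W l"
  shows slope_in: "slope W l x \<in> W" and slope_add_in: "x + slope W l x \<in> l"
proof -
  obtain a w where aw: "a \<in> l" "w \<in> W" "x = a + w" using transv_decomp[OF transv_sym[OF assms]] by blast
  have "- w \<in> W" using aw(2) assms by (auto simp: transv_def intro: subspace_neg lagrangian_subspace)
  moreover have "x + - w \<in> l" using aw by simp
  ultimately have "slope W l x = - w" by (rule slope_eqI[OF assms])
  then show "slope W l x \<in> W" "x + slope W l x \<in> l" using \<open>- w \<in> W\<close> \<open>x + - w \<in> l\<close> by auto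
qed

lemma slope_linear:
  assumes "transv W l"
  shows "linear (slope W l)"
proof (rule linearI)
  have s: "subspace W" "subspace l" using assms by (simp_all add: transv_def lagrangian_subspace)
  fix x y :: "'a sympl" and c :: real
  show "slope W l (x + y) = slope W l x + slope W l y"
  proof (rule slope_eqI[OF assms])
    have "x + y + (slope W l x + slope W l y) = (x + slope W l x) + (y + slope W l y)" by simp
    also have "\<dots> \<in> l" by (rule subspace_add[OF s(2) slope_add_in[OF assms] slope_add_in[OF assms]])
    finally show "x + y + (slope W l x + slope W l y) \<in> l" .
  qed (rule subspace_add[OF s(1) slope_in[OF assms] slope_in[OF assms]])
  show "slope W l (c *\<^sub>R x) = c *\<^sub>R slope W l x"
    using subspace_scale[OF s(1) slope_in[OF assms]] subspace_scale[OF s(2) slope_add_in[OF assms]]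
    by (intro slope_eqI[OF assms]) (simp_all add: scaleR_add_right[symmetric])
qed

lemma slope_eq_0_iff:
  assumes "transv W l"
  shows "slope W l x = 0 \<longleftrightarrow> x \<in> l"
  using slope_add_in[OF assms, of x] slope_eqI[OF assms subspace_0[OF transvD(3)[OF assms]], of x]
  by (metis add.right_neutral)

lemma slope_self:
  assumes "transv W l" "x \<in> W"
  shows "slope W l x = - x"
  by (rule slope_eqI[OF assms(1) subspace_neg[OF transvD(3)[OF assms(1)] assms(2)]])
     (simp add: subspace_0[OF transvD(4)[OF assms(1)]])

text \<open>On a base Lagrangian this is the coordinate of \<open>l\<close> in the affine chart of
  Lagrangians transversal to \<open>W\<close>. Being defined on the whole space, it can be
  restricted to any base.\<close>

definition sform :: "'n::finite sympl set \<Rightarrow> 'n sympl set \<Rightarrow> 'n sympl \<Rightarrow> 'n sympl \<Rightarrow> real" where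
  "sform W l x y = omega0 x (slope W l y)"

lemma bilinear_omega0_comp:
  assumes "linear f" "linear g"
  shows "bilinear (\<lambda>x y. omega0 (f x) (g y))"
  by (simp add: bilinear_def linear_iff omega0_simps linear_add[OF assms(1)] linear_add[OF assms(2)]
      linear_scale[OF assms(1)] linear_scale[OF assms(2)])

text \<open>Isotropy of \<open>B\<close> kills the pairing of two graph points, isotropy of
  \<open>A\<close> and \<open>W\<close> the pure terms; the remaining mixed terms are the
  claim.\<close>

lemma sform_sym:
  assumes "transv W B" "lagrangian A" "x \<in> A" "y \<in> A"
  shows "sform W B x y = sform W B y x"
proof -
  let ?s = "slope W B"
  have "omega0 (x + ?s x) (y + ?s y) = 0"
    using slope_add_in[OF assms(1)] assms(1) lagrangian_omega0 unfolding transv_def by blast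
  moreover have "omega0 x y = 0" "omega0 (?s x) (?s y) = 0"
    using slope_in[OF assms(1)] assms lagrangian_omega0 unfolding transv_def by blast+
  ultimately show ?thesis using omega0_swap[of y "?s x"] by (simp add: omega0_simps sform_def)
qed

lemma sym_form_sform:
  assumes "transv W B" "lagrangian A"
  shows "sym_form (sform W B) A"
proof unfold_locales
  show "bilinear (sform W B)"
    unfolding sform_def[abs_def] using bilinear_omega0_comp[OF linear_ident slope_linear[OF assms(1)]] .
qed (use assms sform_sym lagrangian_subspace in auto)

text \<open>For \<open>x\<close> in the radical, \<open>slope W B x\<close> is symplectically
  orthogonal to \<open>A\<close>, so it lies in \<open>A\<close> by maximality and in
  \<open>W\<close> by construction, and vanishes.\<close>

lemma rad_sform:
  assumes "transv W A" "transv W B"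
  shows "rad (sform W B) A = A \<inter> B"
proof -
  have A: "lagrangian A" and AW: "W \<inter> A = {0}" using assms by (auto simp: transv_def)
  have "x \<in> B" if x: "x \<in> A" "\<And>y. y \<in> A \<Longrightarrow> sform W B x y = 0" for x
  proof -
    have "omega0 (slope W B x) y = 0" if "y \<in> A" for y
      using x(2)[OF that] sform_sym[OF assms(2) A x(1) that] omega0_swap[of "slope W B x" y]
      by (simp add: sform_def)
    then have "slope W B x \<in> A" by (rule lagrangian_maximal[OF A])
    then have "slope W B x = 0" using slope_in[OF assms(2), of x] AW by blast
    then show ?thesis using slope_eq_0_iff[OF assms(2)] by blast
  qed
  moreover have "sform W B x y = 0" if "x \<in> A" "x \<in> B" "y \<in> A" for x y
    using sform_sym[OF assms(2) A that(1,3)] slope_eq_0_iff[OF assms(2), of x] that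
    by (simp add: sform_def omega0_simps)
  ultimately show ?thesis by (auto simp: rad_def)
qed

section \<open>Positive indices of slope forms\<close>

definition hind :: "'n::finite sympl set \<Rightarrow> 'n sympl set \<Rightarrow> 'n sympl set \<Rightarrow> nat" where
  "hind W A B = n_plus (\<lambda>v. sform W B v v) A"

lemma sylvester_sform:
  fixes A :: "'n::finite sympl set"
  assumes "transv W A" "transv W B"
  shows "hind W A B + n_plus (\<lambda>v. - sform W B v v) A + dim (A \<inter> B) = CARD('n)"
proof -
  have A: "lagrangian A" using assms by (simp add: transv_def)
  show ?thesis
    using sym_form.sylvester[OF sym_form_sform[OF assms(2) A]] rad_sform[OF assms] lagrangian_dim[OF A]
    by (simp add: hind_def n_minus_def)
qed

text \<open>The projection \<open>f\<close> of \<open>B\<close> onto \<open>A\<close> along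
  \<open>W\<close> pulls the form of \<open>C\<close> over \<open>A\<close> back to a difference of
  forms over \<open>B\<close>, because slopes into the same isotropic \<open>W\<close> subtract.
  Indices with different bases thus become comparable on one space.\<close>

lemma hind_change_base:
  assumes "transv W A" "transv W B" "transv W C"
  shows "hind W A C = n_plus (\<lambda>z. sform W C z z - sform W A z z) B"
proof -
  define f where "f z = z + slope W A z" for z
  have A: "lagrangian A" "subspace A" and B: "lagrangian B" "subspace B" and W: "subspace W" "lagrangian W"
    using assms transvD by blast+
  have f: "linear f" unfolding f_def by (intro linear_compose_add linear_ident slope_linear[OF assms(1)])
  have inj: "z = 0" if "z \<in> B" "f z = 0" for z
  proof -
    have "z = - slope W A z" using that(2) by (simp add: f_def add_eq_0_iff2)
    then have "z \<in> W" using subspace_neg[OF W(1) slope_in[OF assms(1)], of z] by simp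
    then show ?thesis using that(1) transv_0[OF assms(2)] by blast
  qed
  have fA: "f z \<in> A" for z unfolding f_def by (rule slope_add_in[OF assms(1)])
  have img: "f ` B = A"
  proof
    show "A \<subseteq> f ` B"
    proof
      fix a assume a: "a \<in> A"
      have "f (a + slope W B a) = a"
      proof -
        have "slope W A (a + slope W B a) = - slope W B a"
          using subspace_neg[OF W(1) slope_in[OF assms(2)]] a by (intro slope_eqI[OF assms(1)]) simp_all
        then show ?thesis by (simp add: f_def)
      qed
      then show "a \<in> f ` B" using slope_add_in[OF assms(2), of a] by (metis imageI)
    qed
  qed (use fA in auto)
  have eq: "sform W C (f z) (f z) = sform W C z z - sform W A z z" if "z \<in> B" for z
  proof -
    have "slope W C (f z) = slope W C z - slope W A z"
      using subspace_diff[OF W(1) slope_in[OF assms(3)] slope_in[OF assms(1)]] slope_add_in[OF assms(3), of z]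
      by (intro slope_eqI[OF assms(3)]) (simp_all add: f_def)
    moreover have "omega0 (slope W A z) (slope W C z) = 0" "omega0 (slope W A z) (slope W A z) = 0"
      using slope_in[OF assms(1)] slope_in[OF assms(3)] lagrangian_omega0[OF W(2)] by blast+
    ultimately show ?thesis by (simp add: sform_def f_def omega0_simps)
  qed
  have "n_plus (\<lambda>v. sform W C v v) (f ` B) = n_plus (\<lambda>z. sform W C z z - sform W A z z) B"
    by (rule n_plus_image[OF f B(2)]) (fact inj, fact eq)
  then show ?thesis unfolding hind_def img .
qed

text \<open>Seen from \<open>B\<close>, the form of \<open>A\<close> becomes the negative of the
  form of \<open>B\<close> seen from \<open>A\<close>, so Sylvester's law counts all three
  terms.\<close>

lemma hind_swap:
  fixes A :: "'n::finite sympl set"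
  assumes "transv W A" "transv W B"
  shows "hind W A B + hind W B A + dim (A \<inter> B) = CARD('n)"
proof -
  have z: "sform W A v v = 0" if "v \<in> A" for v
    using slope_eq_0_iff[OF assms(1), of v] that by (simp add: sform_def omega0_simps)
  have "hind W B A = n_plus (\<lambda>v. - sform W B v v) A"
    unfolding hind_change_base[OF assms(2,1,1)] by (rule n_plus_cong) (simp add: z)
  then show ?thesis using sylvester_sform[OF assms] by simp
qed

text \<open>Witnesses for two parameters are orthogonal: isotropy of \<open>A\<close> and
  \<open>B\<close> reduces the pairing to \<open>s - t\<close> times their inner product. Only
  finitely many nonzero vectors can be pairwise orthogonal.\<close>

lemma finite_nontransversal:
  fixes A B :: "'n::finite sympl set"
  assumes A: "lagrangian A" and B: "lagrangian B"
  shows "finite {t. \<exists>a\<in>A. a \<noteq> 0 \<and> t *\<^sub>R a + J0 a \<in> B}" (is "finite ?T")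
proof -
  define f where "f t = (SOME a. a \<in> A \<and> a \<noteq> 0 \<and> t *\<^sub>R a + J0 a \<in> B)" for t
  have f: "f t \<in> A" "f t \<noteq> 0" "t *\<^sub>R f t + J0 (f t) \<in> B" if "t \<in> ?T" for t
    using someI_ex[of "\<lambda>a. a \<in> A \<and> a \<noteq> 0 \<and> t *\<^sub>R a + J0 a \<in> B"] that unfolding f_def by blast+
  have orth: "inner (f s) (f t) = 0" if "s \<in> ?T" "t \<in> ?T" "s \<noteq> t" for s t
  proof -
    have "omega0 (s *\<^sub>R f s + J0 (f s)) (t *\<^sub>R f t + J0 (f t)) = 0"
      by (rule lagrangian_omega0[OF B f(3)[OF that(1)] f(3)[OF that(2)]])
    moreover have "omega0 (f s) (f t) = 0" by (rule lagrangian_omega0[OF A f(1)[OF that(1)] f(1)[OF that(2)]])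
    moreover have "omega0 (J0 (f s)) (J0 (f t)) = omega0 (f s) (f t)"
      by (simp add: omega0_def J0_def inner_commute)
    ultimately have "(s - t) * inner (f s) (f t) = 0"
      by (simp add: omega0_simps algebra_simps)
    then show ?thesis using that(3) by simp
  qed
  have inj: "inj_on f ?T"
  proof (rule inj_onI, rule ccontr)
    fix s t assume st: "s \<in> ?T" "t \<in> ?T" "f s = f t" "s \<noteq> t"
    show False using orth[OF st(1,2,4)] f(2)[OF st(2)] st(3) by simp
  qed
  have "pairwise orthogonal (f ` ?T)"
    unfolding pairwise_def orthogonal_def using orth by blast
  moreover have "0 \<notin> f ` ?T" using f(2) by force
  ultimately have "independent (f ` ?T)" by (rule pairwise_orthogonal_independent)
  then have "finite (f ` ?T)" by (rule independent_imp_finite)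
  then show ?thesis using inj by (rule finite_imageD)
qed

text \<open>Each member of \<open>BB\<close> excludes finitely many graphs
  \<open>t *\<^sub>R a + J0 a\<close> over one fixed \<open>A\<close>, so some \<open>t\<close>
  avoids all of them. The result is a common chart in which finitely many Lagrangians can be
  compared.\<close>

lemma exists_transv:
  fixes BB :: "'n::finite sympl set set"
  assumes fin: "finite BB" and ne: "BB \<noteq> {}" and lag: "\<And>B. B \<in> BB \<Longrightarrow> lagrangian B"
  obtains W where "\<And>B. B \<in> BB \<Longrightarrow> transv W B"
proof -
  obtain A where A: "A \<in> BB" "lagrangian A" using ne lag by blast
  have "finite (\<Union>B\<in>BB. {t. \<exists>a\<in>A. a \<noteq> 0 \<and> t *\<^sub>R a + J0 a \<in> B})"
    using fin finite_nontransversal[OF A(2)] lag by blast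
  then obtain t where t: "t \<notin> (\<Union>B\<in>BB. {t. \<exists>a\<in>A. a \<noteq> 0 \<and> t *\<^sub>R a + J0 a \<in> B})"
    using ex_new_if_finite[OF infinite_UNIV_char_0] by blast
  define f where "f a = t *\<^sub>R a + J0 a" for a :: "'n sympl"
  have f: "linear f" unfolding f_def using linear_J0
    by (intro linear_compose_add) (auto intro: linearI simp: algebra_simps)
  have "lagrangian (f ` A)"
  proof (rule lagrangianI_image[OF A(2) f])
    fix x assume "f x = 0"
    then have "omega0 x (f x) = 0" by (simp add: omega0_simps)
    then show "x = 0" using omega0_swap[of x x] by (simp add: f_def omega0_simps)
  next
    fix x y assume "x \<in> A" "y \<in> A"
    then have "omega0 x y = 0" using lagrangian_omega0[OF A(2)] by blast
    then show "omega0 (f x) (f y) = 0"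
      by (simp add: f_def omega0_simps inner_left_distrib omega0_conv_inner[of x y])
  qed
  moreover have "f ` A \<inter> B = {0}" if B: "B \<in> BB" for B
  proof -
    have "0 \<in> f ` A \<inter> B"
      using subspace_0 lagrangian_subspace lag[OF B] \<open>lagrangian (f ` A)\<close> by blast
    moreover have "z = 0" if z: "z \<in> f ` A" "z \<in> B" for z
    proof -
      obtain a where a: "a \<in> A" "z = f a" using z(1) by blast
      then have "a = 0" using t B z(2) unfolding f_def by blast
      then show ?thesis using a linear_0[OF f] by simp
    qed
    ultimately show ?thesis by blast
  qed
  ultimately show ?thesis using that[of "f ` A"] lag by (simp add: transv_def)
qed

text \<open>The form \<open>S[v] + 2\<omega>(v, w) - K[w]\<close> on \<open>A \<oplus> W\<close>, where \<open>B\<close> is the graph of \<open>S : A \<rightarrow> W\<close> and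
  \<open>W'\<close> the graph of \<open>K : W \<rightarrow> A\<close>. Its orthogonal complement of \<open>A\<close> is the graph of \<open>- S\<close>, on which it
  is minus the form defining \<open>hind W' A B\<close>.\<close>

definition quad_form ::
  "'n::finite sympl set \<Rightarrow> 'n sympl set \<Rightarrow> 'n sympl set \<Rightarrow> 'n sympl set \<Rightarrow> 'n sympl \<Rightarrow> 'n sympl \<Rightarrow> real" where
  "quad_form A W B W' z z' =
     omega0 (slope A W z) (slope W B (slope A W z')) + omega0 (slope A W z) (slope W A z')
     + omega0 (slope A W z') (slope W A z) - omega0 (slope W A z) (slope A W' (slope W A z'))"

lemma quad_form_swap: "quad_form W A W' B z z' = - quad_form A W B W' z z'"
  unfolding quad_form_def
  using omega0_swap[of "slope W A z" "slope A W z'"] omega0_swap[of "slope W A z'" "slope A W z"] by simp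

text \<open>The form is split by \<open>A\<close> and its orthogonal complement \<open>G\<close>. On
  \<open>A\<close> it is the slope form of \<open>B\<close> along \<open>W\<close>, on
  \<open>G\<close> minus the slope form of \<open>B\<close> along \<open>W'\<close>, and
  \<open>A \<inter> G = A \<inter> B\<close>; Sylvester's law for the second form turns its negative
  index plus the intersection into \<open>CARD('n)\<close> minus \<open>hind W' A B\<close>.\<close>

lemma quad_form_index:
  fixes A :: "'n::finite sympl set"
  assumes tA: "transv W A" and tB: "transv W B" and tA': "transv W' A" and tB': "transv W' B"
  shows "sym_form (quad_form A W B W') UNIV" "rad (quad_form A W B W') UNIV = {0}"
    "hind W A B + CARD('n) \<le> n_plus (\<lambda>z. quad_form A W B W' z z) UNIV + hind W' A B"
proof -
  let ?M = "quad_form A W B W'"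
  define S where "S = slope W B"
  define K where "K = slope A W'"
  have tAW: "transv A W" and tAW': "transv A W'" using tA tA' transv_sym by blast+
  note A = transvD(2,4)[OF tA] and W = transvD(1,3)[OF tA]
  have linS: "linear S" and linK: "linear K"
    unfolding S_def K_def using slope_linear[OF tB] slope_linear[OF tAW'] by blast+
  have SW: "S x \<in> W" "x + S x \<in> B" for x
    unfolding S_def using slope_mem[OF tB] by blast+
  have KA: "K x \<in> A" "x + K x \<in> W'" for x
    unfolding K_def using slope_mem[OF tAW'] by blast+
  have Ssym: "omega0 v (S v') = omega0 v' (S v)" if "v \<in> A" "v' \<in> A" for v v'
    using sform_sym[OF tB A(1) that] by (simp add: sform_def S_def)
  have Ksym: "omega0 w (K w') = omega0 w' (K w)" if "w \<in> W" "w' \<in> W" for w w'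
    using sform_sym[OF tAW' W(1) that] by (simp add: sform_def K_def)
  have AA: "omega0 x y = 0" if "x \<in> A" "y \<in> A" for x y using lagrangian_omega0[OF A(1) that] .
  have WW: "omega0 x y = 0" if "x \<in> W" "y \<in> W" for x y using lagrangian_omega0[OF W(1) that] .
  \<comment> \<open>The slopes are minus the components; the two signs cancel in every term of the
    form.\<close>
  have sl: "slope A W (v + w) = - v" "slope W A (v + w) = - w" if "v \<in> A" "w \<in> W" for v w
  proof -
    show "slope A W (v + w) = - v"
      using slope_self[OF tAW that(1)] slope_eq_0_iff[OF tAW, of w] that(2)
      by (simp add: linear_add[OF slope_linear[OF tAW]])
    show "slope W A (v + w) = - w"
      using slope_self[OF tA that(2)] slope_eq_0_iff[OF tA, of v] that(1)
      by (simp add: linear_add[OF slope_linear[OF tA]])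
  qed
  have M: "?M (v + w) (v' + w') = omega0 v (S v') + omega0 v w' + omega0 v' w - omega0 w (K w')"
    if "v \<in> A" "w \<in> W" "v' \<in> A" "w' \<in> W" for v w v' w'
    using that by (simp add: quad_form_def sl omega0_simps S_def[symmetric] K_def[symmetric]
        linear_neg[OF linS] linear_neg[OF linK])
  have dec: "\<exists>v\<in>A. \<exists>w\<in>W. z = v + w" for z
    using transv_decomp[OF tAW] by metis
  have A0: "0 \<in> A" and W0: "0 \<in> W" using subspace_0 A W by blast+
  show sf: "sym_form ?M UNIV"
  proof unfold_locales
    note l1 = slope_linear[OF tAW] and l2 = slope_linear[OF tA]
    show "bilinear ?M"
      unfolding bilinear_def linear_iff quad_form_def S_def[symmetric] K_def[symmetric]
      by (simp add: omega0_simps linear_add[OF l1] linear_add[OF l2] linear_add[OF linS] linear_add[OF linK]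
          linear_scale[OF l1] linear_scale[OF l2] linear_scale[OF linS] linear_scale[OF linK] algebra_simps)
    fix z z' :: "'n sympl"
    obtain v w where 1: "v \<in> A" "w \<in> W" "z = v + w" using dec by blast
    obtain v' w' where 2: "v' \<in> A" "w' \<in> W" "z' = v' + w'" using dec by blast
    show "?M z z' = ?M z' z"
      using M[OF 1(1,2) 2(1,2)] M[OF 2(1,2) 1(1,2)] Ssym[OF 1(1) 2(1)] Ksym[OF 1(2) 2(2)] 1(3) 2(3) by simp
  qed simp
  have bil: "bilinear ?M" using sf by (rule sym_form.bil)
  have orthA: "w = - S v" if vw: "v \<in> A" "w \<in> W" and o: "\<And>u. u \<in> A \<Longrightarrow> ?M (v + w) u = 0" for v w
  proof -
    have "S v + w \<in> A"
    proof (rule lagrangian_maximal[OF A(1)])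
      fix u assume u: "u \<in> A"
      have "omega0 u (S v) + omega0 u w = 0"
        using o[OF u] M[OF vw u W0] Ssym[OF vw(1) u] linear_0[OF linK] by (simp add: omega0_simps)
      then show "omega0 (S v + w) u = 0"
        using omega0_swap[of "S v + w" u] by (simp add: omega0_simps)
    qed
    moreover have "S v + w \<in> W" using SW vw W by (intro subspace_add)
    ultimately have "S v + w = 0" using transv_0[OF tA] by blast
    then show ?thesis by (simp add: add_eq_0_iff)
  qed
  \<comment> \<open>Orthogonality to \<open>A\<close> gives \<open>w = - S v\<close>, to
    \<open>W\<close> gives \<open>K w = - v\<close>. Then \<open>v - w\<close> lies in
    \<open>B\<close> and in \<open>W'\<close>, so \<open>v = w\<close>, which lies in
    \<open>A\<close> and in \<open>W\<close>.\<close>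
  show nd: "rad ?M UNIV = {0}"
  proof -
    have "z = 0" if z: "\<And>u. ?M z u = 0" for z
    proof -
      obtain v w where vw: "v \<in> A" "w \<in> W" "z = v + w" using dec by blast
      have w: "w = - S v" using orthA[OF vw(1,2)] z vw(3) by blast
      have "v + K w \<in> W"
      proof (rule lagrangian_maximal[OF W(1)])
        fix u assume u: "u \<in> W"
        have "omega0 v u - omega0 u (K w) = 0"
          using z[of "0 + u"] M[OF vw(1,2) A0 u] Ksym[OF vw(2) u] linear_0[OF linS] vw(3)
          by (simp add: omega0_simps)
        then show "omega0 (v + K w) u = 0"
          using omega0_swap[of "K w" u] by (simp add: omega0_simps)
      qed
      moreover have "v + K w \<in> A" using KA vw A by (intro subspace_add)
      ultimately have "v + K w = 0" using transv_0[OF tA] by blast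
      then have v: "K w = - v" by (simp add: add_eq_0_iff)
      have "v - w \<in> B" using SW(2)[of v] w by simp
      moreover have "w - v \<in> W'" using KA(2)[of w] v by simp
      then have "v - w \<in> W'" using subspace_neg[OF transvD(3)[OF tB']] by (metis minus_diff_eq)
      ultimately have "v - w = 0" using transv_0[OF tB'] by blast
      then have "v = w" by simp
      then have "v = 0" using vw transv_0[OF tA] by blast
      then show ?thesis using vw \<open>v = w\<close> by simp
    qed
    then show ?thesis unfolding rad_def using bilinear_lzero[OF bil] by blast
  qed
  define G where "G = {x\<in>UNIV. \<forall>u\<in>A. ?M x u = 0}"
  define f where "f v = v - S v" for v
  \<comment> \<open>\<open>g v\<close> is the component in \<open>A\<close> along \<open>W'\<close>
    of the point \<open>v + S v\<close> of \<open>B\<close>, so the slope of \<open>B\<close> along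
    \<open>W'\<close> at \<open>g v\<close> is \<open>S v + K (S v)\<close>.\<close>
  define g where "g v = v - K (S v)" for v
  have linf: "linear f" unfolding f_def by (intro linear_compose_sub linear_ident linS)
  have ling: "linear g" unfolding g_def
    using linear_compose[OF linS linK] by (intro linear_compose_sub linear_ident) (simp add: o_def)
  have negS: "- S v \<in> W" for v using SW(1) W by (intro subspace_neg)
  have fG: "f ` A = G"
  proof
    show "f ` A \<subseteq> G"
    proof (rule image_subsetI)
      fix v assume v: "v \<in> A"
      have "?M (f v) u = 0" if u: "u \<in> A" for u
        using M[OF v negS[of v] u W0] Ssym[OF v u] linear_0[OF linK]
        by (simp add: f_def omega0_simps)
      then show "f v \<in> G" by (simp add: G_def)
    qed
    show "G \<subseteq> f ` A"
    proof
      fix z assume z: "z \<in> G"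
      obtain v w where vw: "v \<in> A" "w \<in> W" "z = v + w" using dec by blast
      have "w = - S v" using z vw(3) by (intro orthA[OF vw(1,2)]) (simp add: G_def)
      then show "z \<in> f ` A" using vw by (simp add: f_def)
    qed
  qed
  have "n_plus (\<lambda>z. ?M z z) A + n_plus (\<lambda>z. ?M z z) G + dim (A \<inter> G) \<le> n_plus (\<lambda>z. ?M z z) UNIV"
    by (rule sym_form.n_plus_orth_split_ge[OF sf nd A(2) subset_UNIV G_def])
  moreover have "n_plus (\<lambda>z. ?M z z) A = hind W A B"
    unfolding hind_def
  proof (rule n_plus_cong)
    fix v assume v: "v \<in> A"
    show "?M v v = sform W B v v"
      using M[OF v W0 v W0] linear_0[OF linK] by (simp add: omega0_simps sform_def S_def)
  qed
  moreover have "A \<inter> G = A \<inter> B"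
  proof -
    have "v \<in> B \<longleftrightarrow> v \<in> G" if v: "v \<in> A" for v
    proof
      assume "v \<in> B"
      then have "f v = v" using slope_eq_0_iff[OF tB] by (simp add: f_def S_def)
      then show "v \<in> G" using fG v by (metis imageI)
    next
      assume "v \<in> G"
      then have "0 = - S v" using v W0 by (intro orthA) (simp_all add: G_def)
      then show "v \<in> B" using slope_eq_0_iff[OF tB] by (simp add: S_def)
    qed
    then show ?thesis by blast
  qed
  moreover have "n_plus (\<lambda>z. ?M z z) G = n_plus (\<lambda>v. - sform W' B v v) A"
  proof -
    have gA: "g v \<in> A" if "v \<in> A" for v unfolding g_def using that KA A by (intro subspace_diff)
    have injg: "v = 0" if v: "v \<in> A" "g v = 0" for v
    proof -
      have "v = K (S v)" using v(2) by (simp add: g_def)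
      then have "v + S v \<in> W'" using KA(2)[of "S v"] by (simp add: add.commute)
      then have "v + S v = 0" using SW(2) transv_0[OF tB'] by blast
      then have "v = - S v" by (simp add: add_eq_0_iff2)
      then have "v \<in> W" using negS by metis
      then show ?thesis using v(1) transv_0[OF tA] by blast
    qed
    have "lagrangian (g ` A)"
      by (rule lagrangianI_image[OF A(1) ling]) (use injg gA AA in blast)+
    then have gimg: "g ` A = A"
      using gA lagrangian_dim[OF A(1)]
      by (intro subspace_dim_equal) (auto simp: lagrangian_subspace lagrangian_dim A)
    have eq: "?M (f v) (f v) = - sform W' B (g v) (g v)" if v: "v \<in> A" for v
    proof -
      have "slope W' B (g v) = S v + K (S v)"
        using KA(2)[of "S v"] SW(2)[of v] by (intro slope_eqI[OF tB']) (simp_all add: g_def)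
      then have "sform W' B (g v) (g v) = omega0 v (S v) - omega0 (K (S v)) (S v)"
        using AA[OF v KA(1)] AA[OF KA(1) KA(1)] by (simp add: sform_def g_def omega0_simps)
      moreover have "?M (f v) (f v) = - omega0 v (S v) - omega0 (S v) (K (S v))"
        using M[OF v negS[of v] v negS[of v]] by (simp add: f_def omega0_simps linear_neg[OF linK])
      ultimately show ?thesis using omega0_swap[of "K (S v)" "S v"] by simp
    qed
    have injf: "v = 0" if v: "v \<in> A" "f v = 0" for v
      using v SW(1)[of v] transv_0[OF tA, of v] by (simp add: f_def)
    have "n_plus (\<lambda>z. ?M z z) (f ` A) = n_plus (\<lambda>v. ?M (f v) (f v)) A"
      by (rule n_plus_image[OF linf A(2)]) (use injf in blast)+
    also have "\<dots> = n_plus (\<lambda>v. - sform W' B v v) (g ` A)"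
      by (rule n_plus_image[OF ling A(2), symmetric]) (use injg eq in auto)
    finally show ?thesis using fG gimg by simp
  qed
  ultimately show "hind W A B + CARD('n) \<le> n_plus (\<lambda>z. ?M z z) UNIV + hind W' A B"
    using sylvester_sform[OF tA' tB'] by simp
qed

text \<open>The estimate is used for the form and, with the pairs \<open>A, B\<close> and
  \<open>W, W'\<close> exchanged, for its negative. By nondegeneracy the two positive indices add up
  to twice \<open>CARD('n)\<close>, which cancels the dimension terms.\<close>

lemma hind_exchange_le:
  fixes A :: "'n::finite sympl set"
  assumes tA: "transv W A" and tB: "transv W B" and tA': "transv W' A" and tB': "transv W' B"
  shows "hind W A B + hind A W W' \<le> hind W' A B + hind B W W'"
proof -
  note 1 = quad_form_index[OF tA tB tA' tB']
    and 2 = quad_form_index[OF transv_sym[OF tA] transv_sym[OF tA'] transv_sym[OF tB] transv_sym[OF tB']]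
  have "n_plus (\<lambda>z. quad_form A W B W' z z) UNIV + n_plus (\<lambda>z. quad_form W A W' B z z) UNIV
      = dim (UNIV :: 'n sympl set)"
    using sym_form.sylvester[OF 1(1)] 1(2) by (simp add: n_minus_def quad_form_swap[of W A W' B])
  moreover have "dim (UNIV :: 'n sympl set) = CARD('n) + CARD('n)" by simp
  ultimately show ?thesis using 1(3) 2(3) by linarith
qed

text \<open>Interchanging \<open>W\<close> and \<open>W'\<close> turns the inequality into its converse.\<close>

lemma hind_exchange:
  assumes tA: "transv W A" and tB: "transv W B" and tA': "transv W' A" and tB': "transv W' B"
  shows "hind W A B + hind A W W' = hind W' A B + hind B W W'"
  using hind_exchange_le[OF tA tB tA' tB'] hind_exchange_le[OF tA' tB' tA tB]
    hind_swap[OF transv_sym[OF tA] transv_sym[OF tA']] hind_swap[OF transv_sym[OF tB] transv_sym[OF tB']]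
  by linarith

section \<open>Continuity of orthogonal projections and slopes\<close>

lemma closest_point_subspace:
  fixes S :: "'a::euclidean_space set"
  assumes S: "subspace S"
  shows closest_point_subspace_in: "closest_point S x \<in> S"
    and closest_point_subspace_orth: "y \<in> S \<Longrightarrow> inner (x - closest_point S x) y = 0"
proof -
  have cl: "closed S" "convex S" "S \<noteq> {}"
    using S closed_subspace subspace_imp_convex subspace_0 by blast+
  show P: "closest_point S x \<in> S" by (rule closest_point_in_set[OF cl(1,3)])
  assume y: "y \<in> S"
  have "inner (x - closest_point S x) (closest_point S x + y - closest_point S x) \<le> 0"
    by (rule closest_point_dot[OF cl(2,1)]) (rule subspace_add[OF S P y])
  moreover have "inner (x - closest_point S x) (closest_point S x - y - closest_point S x) \<le> 0"
    by (rule closest_point_dot[OF cl(2,1)]) (rule subspace_diff[OF S P y])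
  ultimately show "inner (x - closest_point S x) y = 0" by simp
qed

lemma closest_point_subspace_eqI:
  fixes S :: "'a::euclidean_space set"
  assumes S: "subspace S" and z: "z \<in> S" "\<And>y. y \<in> S \<Longrightarrow> inner (x - z) y = 0"
  shows "closest_point S x = z"
proof -
  let ?d = "z - closest_point S x"
  have d: "?d \<in> S" by (rule subspace_diff[OF S z(1) closest_point_subspace_in[OF S]])
  have "inner ?d ?d = inner (x - closest_point S x) ?d - inner (x - z) ?d"
    by (simp add: inner_diff_left)
  then have "inner ?d ?d = 0" using z(2)[OF d] closest_point_subspace_orth[OF S d] by simp
  then show ?thesis by simp
qed

lemma closest_point_subspace_id:
  fixes S :: "'a::euclidean_space set"
  shows "subspace S \<Longrightarrow> x \<in> S \<Longrightarrow> closest_point S x = x"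
  by (rule closest_point_subspace_eqI) simp_all

lemma closest_point_subspace_linear:
  fixes S :: "'a::euclidean_space set"
  assumes S: "subspace S"
  shows "linear (closest_point S)"
proof (rule linearI)
  note i = closest_point_subspace_in[OF S] and o = closest_point_subspace_orth[OF S]
  fix x y :: 'a and c :: real
  show "closest_point S (x + y) = closest_point S x + closest_point S y"
  proof (rule closest_point_subspace_eqI[OF S])
    fix u assume u: "u \<in> S"
    show "inner (x + y - (closest_point S x + closest_point S y)) u = 0"
      using o[OF u, of x] o[OF u, of y] by (simp add: inner_diff_left inner_add_left)
  qed (rule subspace_add[OF S i i])
  show "closest_point S (c *\<^sub>R x) = c *\<^sub>R closest_point S x"
  proof (rule closest_point_subspace_eqI[OF S])
    fix u assume u: "u \<in> S"
    show "inner (c *\<^sub>R x - c *\<^sub>R closest_point S x) u = 0"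
      using o[OF u, of x] by (simp add: inner_diff_left)
  qed (rule subspace_scale[OF S i])
qed

section \<open>Convergence of Lagrangians and of their slopes\<close>

lemma linear_tendsto_uniform:
  fixes f :: "'p \<Rightarrow> 'a::euclidean_space \<Rightarrow> 'b::real_normed_vector"
  assumes lin: "eventually (\<lambda>p. linear (f p)) F" and g: "linear g"
    and lim: "\<And>x. ((\<lambda>p. f p x) \<longlongrightarrow> g x) F" and e: "e > 0"
  shows "eventually (\<lambda>p. \<forall>x. norm (f p x - g x) \<le> e * norm x) F"
proof -
  have "((\<lambda>p. \<Sum>i\<in>Basis. norm (f p i - g i)) \<longlongrightarrow> (\<Sum>i\<in>(Basis::'a set). norm (g i - g i))) F"
    by (intro tendsto_intros lim)
  then have "((\<lambda>p. \<Sum>i\<in>(Basis::'a set). norm (f p i - g i)) \<longlongrightarrow> 0) F" by simp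
  then have "eventually (\<lambda>p. (\<Sum>i\<in>Basis. norm (f p i - g i)) < e) F"
    using e by (rule order_tendstoD(2))
  then show ?thesis using lin
  proof eventually_elim
    case (elim p)
    show ?case
    proof
      fix x :: 'a
      let ?h = "\<lambda>x. f p x - g x"
      have h: "linear ?h" using elim(2) g by (rule linear_compose_sub)
      have "?h x = ?h (\<Sum>i\<in>Basis. inner x i *\<^sub>R i)" by (simp add: euclidean_representation)
      also have "\<dots> = (\<Sum>i\<in>Basis. inner x i *\<^sub>R ?h i)"
        using linear_sum[OF h, of "\<lambda>i. inner x i *\<^sub>R i" Basis] linear_scale[OF h] by simp
      also have "norm \<dots> \<le> (\<Sum>i\<in>Basis. norm x * norm (?h i))"
        by (intro sum_norm_le) (simp add: mult_right_mono Basis_le_norm)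
      also have "\<dots> = norm x * (\<Sum>i\<in>Basis. norm (?h i))" by (simp add: sum_distrib_left)
      also have "\<dots> \<le> norm x * e" using elim(1) by (intro mult_left_mono) simp_all
      finally show "norm (f p x - g x) \<le> e * norm x" by (simp add: mult.commute)
    qed
  qed
qed

text \<open>An arbitrary filter covers paths and two-parameter homotopies alike.\<close>

definition lag_tendsto :: "('p \<Rightarrow> 'n::finite sympl set) \<Rightarrow> 'n sympl set \<Rightarrow> 'p filter \<Rightarrow> bool" where
  "lag_tendsto H l F \<longleftrightarrow> lagrangian l \<and> eventually (\<lambda>p. lagrangian (H p)) F \<and>
     (\<forall>x. ((\<lambda>p. closest_point (H p) x) \<longlongrightarrow> closest_point l x) F)"

text \<open>Transversality makes \<open>u - closest_point l u\<close> bounded below on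
  \<open>W\<close> by \<open>e * norm u\<close>, and half of this survives for nearby Lagrangians.
  The difference of the slopes lies in \<open>W\<close> and corrects the deviation of
  \<open>x + slope W l x\<close> from \<open>H p\<close>. At crossings the explicit rate is needed,
  not only convergence.\<close>

lemma slope_bound:
  assumes H: "lag_tendsto H l F" and W: "transv W l"
  shows "\<exists>C. eventually (\<lambda>p. transv W (H p) \<and> (\<forall>x. norm (slope W (H p) x - slope W l x)
    \<le> C * norm ((x + slope W l x) - closest_point (H p) (x + slope W l x)))) F"
proof -
  have l: "subspace l" and sW: "subspace W" "lagrangian W" using transvD[OF W] by blast+
  let ?f = "\<lambda>u. u - closest_point l u"
  have linP: "linear (closest_point l)" by (rule closest_point_subspace_linear[OF l])
  have linf: "linear ?f" by (intro linear_compose_sub linear_ident linP)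
  have "\<exists>e>0. \<forall>x\<in>W. norm (?f x) \<ge> e * norm x"
  proof (rule injective_imp_isometric[OF closed_subspace[OF sW(1)] sW(1)])
    show "bounded_linear ?f" using linf by (simp add: linear_conv_bounded_linear)
    show "\<forall>x\<in>W. ?f x = 0 \<longrightarrow> x = 0"
    proof (intro ballI impI)
      fix x assume x: "x \<in> W" "?f x = 0"
      then have "x = closest_point l x" by simp
      then have "x \<in> l" using closest_point_subspace_in[OF l, of x] by metis
      then show "x = 0" using transv_0[OF W x(1)] by blast
    qed
  qed
  then obtain e where e: "e > 0" "\<And>x. x \<in> W \<Longrightarrow> norm (?f x) \<ge> e * norm x" by blast
  have evl: "eventually (\<lambda>p. lagrangian (H p)) F" using H by (simp add: lag_tendsto_def)
  have "eventually (\<lambda>p. \<forall>x. norm (closest_point (H p) x - closest_point l x) \<le> (e/2) * norm x) F"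
  proof (rule linear_tendsto_uniform[OF _ linP])
    show "eventually (\<lambda>p. linear (closest_point (H p))) F"
      using evl by eventually_elim (rule closest_point_subspace_linear[OF lagrangian_subspace])
  qed (use H e in \<open>simp_all add: lag_tendsto_def\<close>)
  then have "eventually (\<lambda>p. transv W (H p) \<and> (\<forall>x. norm (slope W (H p) x - slope W l x)
    \<le> (2/e) * norm ((x + slope W l x) - closest_point (H p) (x + slope W l x)))) F"
    using evl
  proof eventually_elim
    case (elim p)
    have Hp: "subspace (H p)" using elim(2) by (rule lagrangian_subspace)
    have linPp: "linear (closest_point (H p))" by (rule closest_point_subspace_linear[OF Hp])
    have low: "(e/2) * norm u \<le> norm (u - closest_point (H p) u)" if u: "u \<in> W" for u
    proof -
      have "e * norm u \<le> norm (u - closest_point l u)" using e(2)[OF u] .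
      also have "\<dots> \<le> norm (u - closest_point (H p) u) + norm (closest_point (H p) u - closest_point l u)"
        by (metis diff_add_cancel add_diff_eq norm_triangle_ineq)
      also have "\<dots> \<le> norm (u - closest_point (H p) u) + (e/2) * norm u" using elim(1) by simp
      finally show ?thesis by (simp add: field_simps)
    qed
    have t: "transv W (H p)"
    proof -
      have "u = 0" if u: "u \<in> W" "u \<in> H p" for u
      proof -
        have "(e/2) * norm u \<le> 0" using low[OF u(1)] closest_point_subspace_id[OF Hp u(2)] by simp
        then show ?thesis using e(1) by (simp add: mult_le_0_iff)
      qed
      then show ?thesis using sW elim(2) subspace_0[OF sW(1)] subspace_0[OF Hp] unfolding transv_def by blast
    qed
    have "norm (slope W (H p) x - slope W l x)
      \<le> (2/e) * norm ((x + slope W l x) - closest_point (H p) (x + slope W l x))" for x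
    proof -
      define u where "u = slope W (H p) x - slope W l x"
      define y where "y = x + slope W l x"
      have u: "u \<in> W" unfolding u_def by (rule subspace_diff[OF sW(1) slope_in[OF t] slope_in[OF W]])
      have "y + u \<in> H p" using slope_add_in[OF t, of x] by (simp add: u_def y_def)
      then have "closest_point (H p) y + closest_point (H p) u = y + u"
        using closest_point_subspace_id[OF Hp] linear_add[OF linPp] by metis
      then have "u - closest_point (H p) u = - (y - closest_point (H p) y)" by (simp add: algebra_simps)
      then have "(e/2) * norm u \<le> norm (y - closest_point (H p) y)" using low[OF u] by (metis norm_minus_cancel)
      then show ?thesis using e(1) unfolding u_def[symmetric] y_def[symmetric] by (simp add: field_simps)
    qed
    then show ?case using t by blast
  qed
  then show ?thesis by blast
qed

lemma eventually_transv:
  assumes "lag_tendsto H l F" "transv W l"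
  shows "eventually (\<lambda>p. transv W (H p)) F"
  using slope_bound[OF assms] by (auto elim: eventually_mono)

lemma slope_tendsto:
  assumes H: "lag_tendsto H l F" and W: "transv W l"
  shows "((\<lambda>p. slope W (H p) x) \<longlongrightarrow> slope W l x) F"
proof -
  let ?y = "x + slope W l x"
  obtain C where C: "eventually (\<lambda>p. transv W (H p) \<and> (\<forall>x. norm (slope W (H p) x - slope W l x)
    \<le> C * norm ((x + slope W l x) - closest_point (H p) (x + slope W l x)))) F"
    using slope_bound[OF assms] by blast
  have "((\<lambda>p. C * norm (?y - closest_point (H p) ?y)) \<longlongrightarrow> C * norm (?y - closest_point l ?y)) F"
    using H by (intro tendsto_intros) (simp add: lag_tendsto_def)
  moreover have "closest_point l ?y = ?y"
    by (rule closest_point_subspace_id[OF transvD(4)[OF W] slope_add_in[OF W]])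
  ultimately have "((\<lambda>p. C * norm (?y - closest_point (H p) ?y)) \<longlongrightarrow> 0) F" by simp
  then have "((\<lambda>p. slope W (H p) x - slope W l x) \<longlongrightarrow> 0) F"
    by (rule Lim_null_comparison[rotated]) (use C in \<open>auto elim: eventually_mono\<close>)
  then show ?thesis by (rule LIM_zero_cancel)
qed

lemma sform_tendsto:
  assumes "lag_tendsto H l F" "transv W l"
  shows "((\<lambda>p. sform W (H p) x y) \<longlongrightarrow> sform W l x y) F"
  unfolding sform_def
  by (intro bounded_bilinear.tendsto[OF bounded_bilinear_omega0] tendsto_const slope_tendsto[OF assms])

text \<open>This trades chart for target: a slope form taken along a moving \<open>B\<close> becomes
  one along the fixed \<open>W'\<close>, which depends continuously on \<open>B\<close>. The extra
  term \<open>omega0 w w'\<close> vanishes on \<open>W\<close>.\<close>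

lemma sform_reverse:
  assumes "transv W' B" "transv W B" "w \<in> W" "w' \<in> W"
  shows "sform B W' w w' = - sform W' B w w'"
proof -
  have s: "subspace B" "subspace W'" using transvD[OF assms(1)] by blast+
  have "- (w' + slope W' B w') \<in> B"
    by (rule subspace_neg[OF s(1) slope_add_in[OF assms(1)]])
  moreover have "w' + - (w' + slope W' B w') \<in> W'"
    using subspace_neg[OF s(2) slope_in[OF assms(1)], of w'] by simp
  ultimately have "slope B W' w' = - (w' + slope W' B w')"
    by (rule slope_eqI[OF transv_sym[OF assms(1)]])
  moreover have "omega0 w w' = 0" by (rule lagrangian_omega0[OF transvD(1)[OF assms(2)] assms(3,4)])
  ultimately show ?thesis by (simp add: sform_def omega0_simps)
qed

text \<open>After the reversal the forms live on the fixed space \<open>W\<close> and, near the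
  limit, always have the radical \<open>W \<inter> W'\<close>; a constant radical excludes a jump of
  the index.\<close>

lemma hind_base_locally_constant:
  assumes H: "lag_tendsto H l F" and W: "transv W l" and W': "transv W' l"
  shows "eventually (\<lambda>p. hind (H p) W W' = hind l W W') F"
proof -
  have sW: "lagrangian W" using transvD[OF W] by blast
  have eq: "hind B W W' = n_plus (\<lambda>w. - sform W' B w w) W"
    and rd: "rad (\<lambda>x y. - sform W' B x y) W = W \<inter> W'"
    if "transv W' B" "transv W B" for B
  proof -
    show "hind B W W' = n_plus (\<lambda>w. - sform W' B w w) W"
      unfolding hind_def by (rule n_plus_cong) (rule sform_reverse[OF that])
    have "rad (\<lambda>x y. - sform W' B x y) W = rad (sform B W') W"
      unfolding rad_def using sform_reverse[OF that] by auto
    then show "rad (\<lambda>x y. - sform W' B x y) W = W \<inter> W'"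
      using rad_sform[OF transv_sym[OF that(2)] transv_sym[OF that(1)]] by simp
  qed
  have ev: "eventually (\<lambda>p. transv W (H p)) F" "eventually (\<lambda>p. transv W' (H p)) F"
    using eventually_transv H W W' by blast+
  have "eventually (\<lambda>p. n_plus (\<lambda>v. - sform W' (H p) v v) W = n_plus (\<lambda>v. - sform W' l v v) W) F"
  proof (rule eventually_n_plus_eq[where b = "\<lambda>p x y. - sform W' (H p) x y" and g = "\<lambda>x y. - sform W' l x y"])
    show "eventually (\<lambda>p. sym_form (\<lambda>x y. - sform W' (H p) x y) W) F"
      using ev(2) by eventually_elim (rule sym_form.uminus[OF sym_form_sform[OF _ sW]])
    show "sym_form (\<lambda>x y. - sform W' l x y) W" by (rule sym_form.uminus[OF sym_form_sform[OF W' sW]])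
    show "eventually (\<lambda>p. dim (rad (\<lambda>x y. - sform W' (H p) x y) W) = dim (rad (\<lambda>x y. - sform W' l x y) W)) F"
      using ev by eventually_elim (simp add: rd W W')
  qed (intro tendsto_minus sform_tendsto[OF H W'])
  then show ?thesis using ev by eventually_elim (simp add: eq W W')
qed

lemma hind_diff_locally_constant:
  assumes H: "lag_tendsto H l F" and W: "transv W l" "transv W L0" and W': "transv W' l" "transv W' L0"
  shows "eventually (\<lambda>p. int (hind W L0 (H p)) - int (hind W' L0 (H p))
       = int (hind W L0 l) - int (hind W' L0 l)) F"
  using hind_base_locally_constant[OF H W(1) W'(1)] eventually_transv[OF H W(1)] eventually_transv[OF H W'(1)]
proof eventually_elim
  case (elim p)
  then show ?case
    using hind_exchange[OF W(2) elim(2) W'(2) elim(3)] hind_exchange[OF W(2,1) W'(2,1)] by linarith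
qed

section \<open>Index primitives and the Maslov index\<close>

definition lag_family :: "('p::topological_space \<Rightarrow> 'n::finite sympl set) \<Rightarrow> 'p set \<Rightarrow> bool" where
  "lag_family H S \<longleftrightarrow> (\<forall>p\<in>S. lagrangian (H p)) \<and> (\<forall>x. continuous_on S (\<lambda>p. closest_point (H p) x))"

lemma lag_family_subset: "lag_family H S \<Longrightarrow> T \<subseteq> S \<Longrightarrow> lag_family H T"
  unfolding lag_family_def using continuous_on_subset by blast

lemma lag_path_family: "lag_path l a b \<longleftrightarrow> lag_family l {a..b}"
  by (simp add: lag_path_def lag_family_def)

lemma lag_family_tendsto:
  assumes "lag_family H S" "p \<in> S"
  shows "lag_tendsto H (H p) (at p within S)"
  unfolding lag_tendsto_def
proof (intro conjI allI)
  show "lagrangian (H p)" using assms by (simp add: lag_family_def)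
  show "eventually (\<lambda>p. lagrangian (H p)) (at p within S)"
    using assms(1) by (auto simp: lag_family_def eventually_at_filter)
  show "((\<lambda>p. closest_point (H p) x) \<longlongrightarrow> closest_point (H p) x) (at p within S)" for x
    using assms by (auto simp: lag_family_def continuous_on_def)
qed

lemma lag_family_compose:
  assumes "lag_family H S" "continuous_on R g" "g ` R \<subseteq> S"
  shows "lag_family (\<lambda>r. H (g r)) R"
  unfolding lag_family_def
proof (intro conjI allI ballI)
  show "lagrangian (H (g r))" if "r \<in> R" for r using that assms by (auto simp: lag_family_def)
  have "continuous_on S (\<lambda>p. closest_point (H p) x)" for x using assms(1) by (simp add: lag_family_def)
  then show "continuous_on R (\<lambda>r. closest_point (H (g r)) x)" for x
    using continuous_on_compose2[OF _ assms(2,3)] by blast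
qed

text \<open>A primitive is an integer function that changes locally like the positive index of the slope
  form in every chart; its increment along a path is the Maslov index.\<close>

definition primitive ::
  "'n::finite sympl set \<Rightarrow> ('p::topological_space \<Rightarrow> 'n sympl set) \<Rightarrow> 'p set \<Rightarrow> ('p \<Rightarrow> int) \<Rightarrow> bool" where
  "primitive L0 H S F \<longleftrightarrow> (\<forall>p\<in>S. \<forall>W. transv W L0 \<longrightarrow> transv W (H p) \<longrightarrow>
     eventually (\<lambda>q. F q - int (hind W L0 (H q)) = F p - int (hind W L0 (H p))) (at p within S))"

text \<open>One chart at each point suffices, since passing to another chart changes the index by a
  locally constant amount.\<close>

lemma primitiveI:
  assumes H: "lag_family H S"
    and W: "\<And>p. p \<in> S \<Longrightarrow> \<exists>W. transv W L0 \<and> transv W (H p) \<and>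
      eventually (\<lambda>q. F q - int (hind W L0 (H q)) = F p - int (hind W L0 (H p))) (at p within S)"
  shows "primitive L0 H S F"
  unfolding primitive_def
proof (intro ballI allI impI)
  fix p W' assume p: "p \<in> S" and W': "transv W' L0" "transv W' (H p)"
  obtain W where W: "transv W L0" "transv W (H p)"
    and ev: "eventually (\<lambda>q. F q - int (hind W L0 (H q)) = F p - int (hind W L0 (H p))) (at p within S)"
    using W[OF p] by blast
  from ev hind_diff_locally_constant[OF lag_family_tendsto[OF H p] W(2,1) W'(2,1)]
  show "eventually (\<lambda>q. F q - int (hind W' L0 (H q)) = F p - int (hind W' L0 (H p))) (at p within S)"
    by eventually_elim linarith
qed

lemma primitive_subset:
  assumes "primitive L0 H S F" "T \<subseteq> S"
  shows "primitive L0 H T F"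
  unfolding primitive_def
proof (intro ballI allI impI)
  fix p W assume p: "p \<in> T" and W: "transv W L0" "transv W (H p)"
  have "eventually (\<lambda>q. F q - int (hind W L0 (H q)) = F p - int (hind W L0 (H p))) (at p within S)"
    using assms p W unfolding primitive_def by blast
  then show "eventually (\<lambda>q. F q - int (hind W L0 (H q)) = F p - int (hind W L0 (H p))) (at p within T)"
    by (rule filter_leD[OF at_le[OF assms(2)]])
qed

lemma primitive_compose:
  assumes F: "primitive L0 H S F" and g: "continuous_on R g" "g ` R \<subseteq> S"
  shows "primitive L0 (\<lambda>r. H (g r)) R (\<lambda>r. F (g r))"
  unfolding primitive_def
proof (intro ballI allI impI)
  fix r W assume r: "r \<in> R" and W: "transv W L0" "transv W (H (g r))"
  let ?P = "\<lambda>p q. F q - int (hind W L0 (H q)) = F p - int (hind W L0 (H p))"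
  have "eventually (?P (g r)) (at (g r) within S)"
    using F W r g(2) unfolding primitive_def by blast
  then obtain U where U: "open U" "g r \<in> U" "\<And>y. y \<in> U \<Longrightarrow> y \<noteq> g r \<Longrightarrow> y \<in> S \<Longrightarrow> ?P (g r) y"
    unfolding eventually_at_topological by blast
  obtain V where V: "open V" "r \<in> V" "\<And>q. q \<in> R \<Longrightarrow> q \<in> V \<Longrightarrow> g q \<in> U"
    using g(1)[unfolded continuous_on_topological, rule_format, OF r U(1,2)] by blast
  \<comment> \<open>Where \<open>g q = g r\<close> the punctured neighbourhood gives nothing, but
    the two sides coincide.\<close>
  have "?P (g r) (g q)" if "q \<in> R" "q \<in> V" for q
    using U(3)[OF V(3)[OF that]] g(2) that(1) by (cases "g q = g r") auto
  then show "eventually (\<lambda>q. ?P (g r) (g q)) (at r within R)"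
    unfolding eventually_at_topological using V(1,2) by blast
qed

lemma exists_transv2:
  assumes "lagrangian A" "lagrangian B"
  obtains W where "transv W A" "transv W B"
proof -
  obtain W where "\<And>X. X \<in> {A, B} \<Longrightarrow> transv W X"
    by (rule exists_transv[of "{A, B}"]) (use assms in auto)
  then show ?thesis using that by blast
qed

text \<open>In a common chart the index terms cancel, so the difference is locally constant. This
  makes the increment of a primitive well defined.\<close>

lemma primitive_diff_constant:
  assumes S: "connected S" and H: "lag_family H S" and L0: "lagrangian L0"
    and F: "primitive L0 H S F" "primitive L0 H S F'" and pq: "p \<in> S" "q \<in> S"
  shows "F p - F' p = F q - F' q"
proof (rule connected_local_const[OF S pq], intro ballI)
  fix a assume a: "a \<in> S"
  then obtain W where W: "transv W L0" "transv W (H a)"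
    using exists_transv2[OF L0] H unfolding lag_family_def by blast
  have "eventually (\<lambda>q. F q - int (hind W L0 (H q)) = F a - int (hind W L0 (H a))) (at a within S)"
    "eventually (\<lambda>q. F' q - int (hind W L0 (H q)) = F' a - int (hind W L0 (H a))) (at a within S)"
    using F W a unfolding primitive_def by blast+
  then show "eventually (\<lambda>b. F a - F' a = F b - F' b) (at a within S)"
    by eventually_elim linarith
qed

lemma at_within_closed_notin: "closed S \<Longrightarrow> p \<notin> S \<Longrightarrow> at p within S = bot"
  unfolding trivial_limit_within closed_limpt by blast

text \<open>On the connected overlap the two primitives differ by a constant, which is added to one
  of them. Closedness ensures that a point outside a piece is not approached from within it.\<close>

lemma primitive_glue:
  assumes cl: "closed S1" "closed S2" and con: "connected (S1 \<inter> S2)"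
    and H: "lag_family H (S1 \<union> S2)" and L0: "lagrangian L0"
    and F: "primitive L0 H S1 F1" "primitive L0 H S2 F2"
  shows "\<exists>F. primitive L0 H (S1 \<union> S2) F"
proof -
  obtain c where c: "\<And>p. p \<in> S1 \<inter> S2 \<Longrightarrow> F1 p = F2 p + c"
  proof (cases "S1 \<inter> S2 = {}")
    case False
    then obtain p where p: "p \<in> S1 \<inter> S2" by blast
    have sub: "S1 \<inter> S2 \<subseteq> S1 \<union> S2" by blast
    have "F1 q = F2 q + (F1 p - F2 p)" if "q \<in> S1 \<inter> S2" for q
      using primitive_diff_constant[OF con lag_family_subset[OF H sub] L0 primitive_subset[OF F(1) Int_lower1]
          primitive_subset[OF F(2) Int_lower2] p that] by linarith
    then show ?thesis using that by blast
  qed (use that in blast)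
  define F where "F p = (if p \<in> S1 then F1 p else F2 p + c)" for p
  have F1: "F p = F1 p" if "p \<in> S1" for p using that by (simp add: F_def)
  have F2: "F p = F2 p + c" if "p \<in> S2" for p using that c[of p] by (simp add: F_def)
  have "primitive L0 H (S1 \<union> S2) F"
    unfolding primitive_def
  proof (intro ballI allI impI)
    fix p W assume p: "p \<in> S1 \<union> S2" and W: "transv W L0" "transv W (H p)"
    let ?P = "\<lambda>F q. F q - int (hind W L0 (H q)) = F p - int (hind W L0 (H p))"
    have "eventually (?P F) (at p within S1)"
    proof (cases "p \<in> S1")
      case True
      have "eventually (?P F1) (at p within S1)" using F(1) True W unfolding primitive_def by blast
      moreover have "eventually (\<lambda>q. q \<in> S1) (at p within S1)" by (simp add: eventually_at_filter)
      ultimately show ?thesis by eventually_elim (simp add: F1 True)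
    qed (simp add: at_within_closed_notin[OF cl(1)])
    moreover have "eventually (?P F) (at p within S2)"
    proof (cases "p \<in> S2")
      case True
      have "eventually (?P F2) (at p within S2)" using F(2) True W unfolding primitive_def by blast
      moreover have "eventually (\<lambda>q. q \<in> S2) (at p within S2)" by (simp add: eventually_at_filter)
      ultimately show ?thesis by eventually_elim (simp add: F2 True)
    qed (simp add: at_within_closed_notin[OF cl(2)])
    ultimately show "eventually (?P F) (at p within S1 \<union> S2)"
      by (simp add: at_within_union eventually_sup)
  qed
  then show ?thesis by blast
qed

lemma primitive_exists_local:
  fixes H :: "'p::metric_space \<Rightarrow> 'n::finite sympl set"
  assumes H: "lag_family H S" and L0: "lagrangian L0" and p: "p \<in> S"
  shows "\<exists>e>0. \<exists>F. primitive L0 H (S \<inter> ball p e) F"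
proof -
  obtain W where W: "transv W L0" "transv W (H p)"
    using exists_transv2[OF L0] H p unfolding lag_family_def by blast
  obtain e where e: "e > 0" "\<And>q. q \<in> S \<Longrightarrow> q \<noteq> p \<Longrightarrow> dist q p < e \<Longrightarrow> transv W (H q)"
    using eventually_transv[OF lag_family_tendsto[OF H p] W(2)] unfolding eventually_at by blast
  have t: "transv W (H q)" if "q \<in> S \<inter> ball p e" for q
    using that e(2)[of q] W(2) by (cases "q = p") (auto simp: dist_commute)
  have "primitive L0 H (S \<inter> ball p e) (\<lambda>q. int (hind W L0 (H q)))"
    by (rule primitiveI[OF lag_family_subset[OF H Int_lower1]]) (use W t in auto)
  then show ?thesis using e(1) by blast
qed

lemma connected_Icc_Int: "connected ({a..b} \<inter> {c..d::real})"
  by (simp add: convex_connected convex_Int)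

text \<open>Bisection in the second parameter: primitives on small boxes are glued along segments,
  the half-width \<open>\<delta>\<close> dropping to the smaller of the two at each gluing.\<close>

lemma primitive_exists_strip:
  fixes H :: "real \<times> real \<Rightarrow> 'n::finite sympl set"
  assumes H: "lag_family H ({c..d} \<times> {a..b})" and L0: "lagrangian L0" and ab: "a \<le> b" and s: "s \<in> {c..d}"
  shows "\<exists>\<delta>>0. \<exists>F. primitive L0 H (({c..d} \<inter> {s-\<delta>..s+\<delta>}) \<times> {a..b}) F"
proof -
  define B where "B \<delta> u v = ({c..d} \<inter> {s-\<delta>..s+\<delta>}) \<times> ({a..b} \<inter> {u..v})" for \<delta> u v
  have BS: "B \<delta> u v \<subseteq> {c..d} \<times> {a..b}" for \<delta> u v by (auto simp: B_def)
  have clB: "closed (B \<delta> u v)" for \<delta> u v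
    unfolding B_def by (intro closed_Times closed_Int closed_atLeastAtMost)
  have "\<exists>\<delta>>0. \<exists>F. primitive L0 H (B \<delta> a b) F"
  proof (induction rule: Bolzano[OF ab])
    case (1 u v w)
    then obtain \<delta>1 F1 \<delta>2 F2 where d: "\<delta>1 > 0" "primitive L0 H (B \<delta>1 u v) F1" "\<delta>2 > 0" "primitive L0 H (B \<delta>2 v w) F2"
      by blast
    define \<delta> where "\<delta> = min \<delta>1 \<delta>2"
    have "B \<delta> u v \<subseteq> B \<delta>1 u v" "B \<delta> v w \<subseteq> B \<delta>2 v w" by (auto simp: B_def \<delta>_def)
    then have F: "primitive L0 H (B \<delta> u v) F1" "primitive L0 H (B \<delta> v w) F2"
      using d primitive_subset by blast+
    have un: "B \<delta> u v \<union> B \<delta> v w = B \<delta> u w" using 1 by (auto simp: B_def)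
    have "B \<delta> u v \<inter> B \<delta> v w = ({c..d} \<inter> {s-\<delta>..s+\<delta>}) \<times> ({a..b} \<inter> {v..v})" using 1 by (auto simp: B_def)
    then have con: "connected (B \<delta> u v \<inter> B \<delta> v w)" by (simp only: connected_Times connected_Icc_Int)
    have "\<exists>F. primitive L0 H (B \<delta> u v \<union> B \<delta> v w) F"
      by (rule primitive_glue[OF clB clB con _ L0 F]) (rule lag_family_subset[OF H], use BS in blast)
    then show ?case using d un unfolding \<delta>_def by (metis min_less_iff_conj)
  next
    case (2 x)
    then have p: "(s, x) \<in> {c..d} \<times> {a..b}" using s by simp
    obtain e F where e: "e > 0" "primitive L0 H ({c..d} \<times> {a..b} \<inter> ball (s, x) e) F"
      using primitive_exists_local[OF H L0 p] by blast
    have "\<exists>\<delta>>0. \<exists>F. primitive L0 H (B \<delta> u v) F" if uv: "u \<le> x" "x \<le> v" "v - u < e / 3" for u v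
    proof -
      have "B (e/3) u v \<subseteq> {c..d} \<times> {a..b} \<inter> ball (s, x) e"
      proof (rule subsetI)
        fix q assume q: "q \<in> B (e/3) u v"
        then have "fst q \<in> {s-e/3..s+e/3}" "snd q \<in> {u..v}" unfolding B_def mem_Times_iff by blast+
        then have "\<bar>fst q - s\<bar> \<le> e/3" "\<bar>snd q - x\<bar> < e/3"
          using uv unfolding atLeastAtMost_iff abs_le_iff abs_less_iff by linarith+
        moreover have "dist (s, x) q \<le> \<bar>fst q - s\<bar> + \<bar>snd q - x\<bar>"
          using sqrt_sum_squares_le_sum_abs[of "fst q - s" "snd q - x"]
          by (simp add: dist_prod_def dist_real_def power2_commute)
        ultimately show "q \<in> {c..d} \<times> {a..b} \<inter> ball (s, x) e"
          using q BS[of "e/3" u v] e(1) unfolding Int_iff mem_ball by fastforce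
      qed
      then have "primitive L0 H (B (e/3) u v) F" by (rule primitive_subset[OF e(2)])
      then show ?thesis using e(1) by (intro exI[of _ "e/3"]) auto
    qed
    then show ?case using e(1) by (intro exI[of _ "e/3"]) auto
  qed
  then show ?thesis by (simp add: B_def)
qed

text \<open>Strips are glued by bisection in the first parameter. Two parameters are treated because
  homotopy invariance needs a primitive on a whole rectangle.\<close>

lemma primitive_exists_rectangle:
  fixes H :: "real \<times> real \<Rightarrow> 'n::finite sympl set"
  assumes H: "lag_family H ({c..d} \<times> {a..b})" and L0: "lagrangian L0" and ab: "a \<le> b" and cd: "c \<le> d"
  shows "\<exists>F. primitive L0 H ({c..d} \<times> {a..b}) F"
proof -
  define B where "B u v = ({c..d} \<inter> {u..v}) \<times> {a..b}" for u v
  have BS: "B u v \<subseteq> {c..d} \<times> {a..b}" for u v by (auto simp: B_def)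
  have clB: "closed (B u v)" for u v
    unfolding B_def by (intro closed_Times closed_Int closed_atLeastAtMost)
  have "\<exists>F. primitive L0 H (B c d) F"
  proof (induction rule: Bolzano[OF cd])
    case (1 u v w)
    then obtain F1 F2 where F: "primitive L0 H (B u v) F1" "primitive L0 H (B v w) F2" by blast
    have un: "B u v \<union> B v w = B u w" using 1 by (auto simp: B_def)
    have "B u v \<inter> B v w = ({c..d} \<inter> {v..v}) \<times> ({a..b} \<inter> {a..b})" using 1 by (auto simp: B_def)
    then have con: "connected (B u v \<inter> B v w)" by (simp only: connected_Times connected_Icc_Int)
    have "\<exists>F. primitive L0 H (B u v \<union> B v w) F"
      by (rule primitive_glue[OF clB clB con _ L0 F]) (rule lag_family_subset[OF H], use BS in blast)
    then show ?case using un by simp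
  next
    case (2 x)
    obtain \<delta> F where d: "\<delta> > 0" "primitive L0 H (({c..d} \<inter> {x-\<delta>..x+\<delta>}) \<times> {a..b}) F"
      using primitive_exists_strip[OF H L0 ab, of x] 2 by auto
    have "\<exists>F. primitive L0 H (B u v) F" if "u \<le> x" "x \<le> v" "v - u < \<delta>" for u v
    proof -
      have "B u v \<subseteq> ({c..d} \<inter> {x-\<delta>..x+\<delta>}) \<times> {a..b}" using that by (auto simp: B_def)
      then show ?thesis using primitive_subset[OF d(2)] by blast
    qed
    then show ?case using d(1) by blast
  qed
  then show ?thesis by (simp add: B_def)
qed

lemma primitive_exists_path:
  assumes l: "lag_path l a b" and L0: "lagrangian L0" and ab: "a \<le> b"
  shows "\<exists>F. primitive L0 l {a..b} F"
proof -
  have "lag_family (\<lambda>p. l (snd p)) ({0..0::real} \<times> {a..b})"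
    using l unfolding lag_path_family by (rule lag_family_compose) (auto intro: continuous_intros)
  from primitive_exists_rectangle[OF this L0 ab]
  obtain F where "primitive L0 (\<lambda>p. l (snd p)) ({0..0::real} \<times> {a..b}) F" by auto
  then have "primitive L0 (\<lambda>t. l (snd (0::real, t))) {a..b} (\<lambda>t. F (0, t))"
    by (rule primitive_compose) (auto intro: continuous_intros)
  then show ?thesis unfolding snd_conv by blast
qed

section \<open>The Maslov index as the increment of a primitive\<close>

definition maslov :: "'n::finite sympl set \<Rightarrow> (real \<Rightarrow> 'n sympl set) \<Rightarrow> real \<Rightarrow> real \<Rightarrow> int" where
  "maslov L0 l a b = (if lagrangian L0 \<and> a < b \<and> lag_path l a b
     then (THE m. \<exists>F. primitive L0 l {a..b} F \<and> m = F b - F a) else 0)"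

lemma maslov_eq:
  assumes "lagrangian L0" "a < b" "lag_path l a b" "primitive L0 l {a..b} F"
  shows "maslov L0 l a b = F b - F a"
proof -
  have "F' b - F' a = F b - F a" if "primitive L0 l {a..b} F'" for F'
    using primitive_diff_constant[OF connected_Icc _ assms(1) that assms(4), of b a] assms(2,3)
    by (simp add: lag_path_family)
  then have "(THE m. \<exists>F. primitive L0 l {a..b} F \<and> m = F b - F a) = F b - F a"
    using assms(4) by (intro the_equality) blast+
  then show ?thesis using assms by (simp add: maslov_def)
qed

lemma maslov_concat:
  assumes L0: "lagrangian L0" and ac: "a < c" "c < b" and l: "lag_path l a b"
  shows "maslov L0 l a b = maslov L0 l a c + maslov L0 l c b"
proof -
  obtain F where F: "primitive L0 l {a..b} F" using primitive_exists_path[OF l L0] ac by auto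
  have sub: "{a..c} \<subseteq> {a..b}" "{c..b} \<subseteq> {a..b}" using ac by auto
  have l': "lag_path l a c" "lag_path l c b"
    using l lag_family_subset sub unfolding lag_path_family by blast+
  show ?thesis
    using maslov_eq[OF L0 _ l F] maslov_eq[OF L0 _ l'(1) primitive_subset[OF F sub(1)]]
      maslov_eq[OF L0 _ l'(2) primitive_subset[OF F sub(2)]] ac by simp
qed

text \<open>A primitive of the homotopy gives the index of each row as a difference of its end
  values; the sides \<open>t = a\<close> and \<open>t = b\<close> are constant paths, along which a
  primitive does not change.\<close>

lemma maslov_homotopy:
  assumes L0: "lagrangian L0" and ab: "a < b" and H: "lag_homotopy H a b"
    and fixed: "\<And>s. s \<in> {0..1} \<Longrightarrow> H s a = H 0 a \<and> H s b = H 0 b"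
  shows "maslov L0 (H 0) a b = maslov L0 (H 1) a b"
proof -
  define h where "h p = H (fst p) (snd p)" for p
  have h: "lag_family h ({0..1} \<times> {a..b})"
    using H unfolding lag_homotopy_def lag_family_def h_def by (simp add: case_prod_beta')
  obtain F where F: "primitive L0 h ({0..1} \<times> {a..b}) F"
    using primitive_exists_rectangle[OF h L0] ab by auto
  have row: "maslov L0 (H s) a b = F (s, b) - F (s, a)" if s: "s \<in> {0..1}" for s
  proof -
    have c: "continuous_on {a..b} (\<lambda>t. (s, t))" "(\<lambda>t. (s, t)) ` {a..b} \<subseteq> {0..1} \<times> {a..b}"
      using s by (auto intro: continuous_intros)
    show ?thesis
      using maslov_eq[OF L0 ab, of "H s" "\<lambda>t. F (s, t)"] primitive_compose[OF F c] lag_family_compose[OF h c]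
      by (simp add: lag_path_family h_def)
  qed
  have col: "F (0, t) = F (1, t)" if t: "t \<in> {a..b}" and const: "\<And>s. s \<in> {0..1} \<Longrightarrow> H s t = H 0 t" for t
  proof -
    have c: "continuous_on {0..1} (\<lambda>s. (s, t))" "(\<lambda>s. (s, t)) ` {0..1} \<subseteq> {0..1} \<times> {a..b}"
      using t by (auto intro: continuous_intros)
    have p: "primitive L0 (\<lambda>s. H s t) {0..1} (\<lambda>s. F (s, t))" and fam: "lag_family (\<lambda>s. H s t) {0..1::real}"
      using primitive_compose[OF F c] lag_family_compose[OF h c] by (simp_all add: h_def)
    have z: "primitive L0 (\<lambda>s. H s t) {0..1} (\<lambda>_. 0)"
      unfolding primitive_def
    proof (intro ballI allI impI)
      fix s W assume s: "s \<in> {0..1::real}"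
      have "eventually (\<lambda>q. q \<in> {0..1::real}) (at s within {0..1})" by (simp add: eventually_at_filter)
      then show "eventually (\<lambda>q. 0 - int (hind W L0 (H q t)) = 0 - int (hind W L0 (H s t))) (at s within {0..1})"
        by eventually_elim (use const s in metis)
    qed
    show ?thesis
      using primitive_diff_constant[OF connected_Icc fam L0 p z, of 0 1] by simp
  qed
  have "F (0, a) = F (1, a)" by (rule col) (use ab fixed in \<open>simp, blast\<close>)
  moreover have "F (0, b) = F (1, b)" by (rule col) (use ab fixed in \<open>simp, blast\<close>)
  ultimately show ?thesis using row[of 0] row[of 1] by simp
qed

section \<open>The crossing formula\<close>

lemma has_vector_derivative_quotient:
  "(f has_vector_derivative D) (at x within S) \<longleftrightarrow> ((\<lambda>s. (f s - f x) /\<^sub>R (s - x)) \<longlongrightarrow> D) (at x within S)"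
proof -
  have "((\<lambda>s. (f s - f x) /\<^sub>R (s - x)) \<longlongrightarrow> D) (at x within S) \<longleftrightarrow>
      ((\<lambda>s. norm ((f s - f x) /\<^sub>R (s - x) - D)) \<longlongrightarrow> 0) (at x within S)"
    by (simp add: LIM_zero_iff tendsto_norm_zero_iff)
  also have "\<dots> \<longleftrightarrow> ((\<lambda>s. norm ((f s - f x) - (s - x) *\<^sub>R D) / norm (s - x)) \<longlongrightarrow> 0) (at x within S)"
  proof (rule tendsto_cong)
    have "norm ((f s - f x) /\<^sub>R (s - x) - D) = norm ((f s - f x) - (s - x) *\<^sub>R D) / norm (s - x)" if "s \<noteq> x" for s
    proof -
      have "(f s - f x) /\<^sub>R (s - x) - D = ((f s - f x) - (s - x) *\<^sub>R D) /\<^sub>R (s - x)"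
        using that by (simp add: scaleR_diff_right)
      then show ?thesis by (simp add: divide_inverse mult.commute)
    qed
    then show "eventually (\<lambda>s. norm ((f s - f x) /\<^sub>R (s - x) - D) = norm ((f s - f x) - (s - x) *\<^sub>R D) / norm (s - x))
        (at x within S)"
      by (simp add: eventually_at_filter)
  qed
  also have "\<dots> \<longleftrightarrow> (f has_vector_derivative D) (at x within S)"
    by (simp add: has_vector_derivative_def has_derivative_iff_norm bounded_linear_scaleR_left)
  finally show ?thesis by simp
qed

lemma n_plus_zero: "n_plus (Q :: 'a::euclidean_space \<Rightarrow> real) {0} = 0"
proof -
  obtain U where U: "U \<subseteq> {0::'a}" "dim U = n_plus Q {0}"
    by (rule n_plus_witness[OF subspace_single_0, of Q])
  have "dim U = 0" using U(1) by (simp only: dim_eq_0)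
  then show ?thesis using U(2) by (simp only:)
qed

locale crossing =
  fixes l :: "real \<Rightarrow> 'n::finite sympl set" and a b t0 :: real and D :: "'n sympl \<Rightarrow> 'n sympl"
  assumes path: "lag_path l a b" and ab: "a < b" and t0: "t0 \<in> {a..b}"
    and D: "\<And>x. ((\<lambda>s. closest_point (l s) x) has_vector_derivative D x) (at t0 within {a..b})"
begin

abbreviation "T0 \<equiv> at t0 within {a..b}"

lemma tendsto: "lag_tendsto l (l t0) T0"
  using lag_family_tendsto path t0 unfolding lag_path_family by blast

lemma lag: "lagrangian (l t0)"
  using path t0 by (simp add: lag_path_def)

lemma quotient_tendsto:
  assumes "v \<in> l t0"
  shows "((\<lambda>s. (closest_point (l s) v - v) /\<^sub>R (s - t0)) \<longlongrightarrow> D v) T0"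
  using D[of v] closest_point_subspace_id[OF lagrangian_subspace[OF lag] assms]
  unfolding has_vector_derivative_quotient by simp

text \<open>Comparing \<open>v\<close> with its projection to \<open>l s\<close>, isotropy of
  \<open>l s\<close> expresses the slope form through the difference quotient of the projection; the
  remaining term disappears because slopes of vectors of \<open>l t0\<close> tend to 0. The limit
  does not involve \<open>W\<close>.\<close>

lemma sform_quotient_tendsto:
  assumes W: "transv W (l t0)" and v: "v \<in> l t0" "v' \<in> l t0"
  shows "((\<lambda>s. sform W (l s) v v' / (s - t0)) \<longlongrightarrow> omega0 v' (D v)) T0"
proof -
  define q where "q s = (closest_point (l s) v - v) /\<^sub>R (s - t0)" for s
  note bb = bounded_bilinear.tendsto[OF bounded_bilinear_omega0]
  have z: "slope W (l t0) v' = 0" using slope_eq_0_iff[OF W] v by blast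
  have "((\<lambda>s. omega0 v' (q s) - omega0 (q s) (slope W (l s) v')) \<longlongrightarrow>
      omega0 v' (D v) - omega0 (D v) (slope W (l t0) v')) T0"
    unfolding q_def
    by (intro tendsto_diff bb tendsto_const quotient_tendsto[OF v(1)] slope_tendsto[OF tendsto W])
  then have lim: "((\<lambda>s. omega0 v' (q s) - omega0 (q s) (slope W (l s) v')) \<longlongrightarrow> omega0 v' (D v)) T0"
    by (simp add: z omega0_simps)
  have "eventually (\<lambda>s. lagrangian (l s)) T0" using tendsto by (simp add: lag_tendsto_def)
  with eventually_transv[OF tendsto W]
  have "eventually (\<lambda>s. omega0 v' (q s) - omega0 (q s) (slope W (l s) v') = sform W (l s) v v' / (s - t0)) T0"
  proof eventually_elim
    case (elim s)
    let ?P = "closest_point (l s) v" and ?w = "slope W (l s) v'"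
    have "omega0 ?P (v' + ?w) = 0"
      by (rule lagrangian_omega0[OF elim(2) closest_point_subspace_in[OF lagrangian_subspace[OF elim(2)]]
            slope_add_in[OF elim(1)]])
    moreover have "omega0 v' v = 0" by (rule lagrangian_omega0[OF lag v(2,1)])
    ultimately have eq: "omega0 v ?w = omega0 v' (?P - v) - omega0 (?P - v) ?w"
      using omega0_swap[of v' ?P] by (simp add: omega0_simps)
    show ?case
      unfolding sform_def q_def eq bilinear_lmul[OF bilinear_omega0] bilinear_rmul[OF bilinear_omega0]
      by (simp add: divide_inverse algebra_simps)
  qed
  with lim show ?thesis by (rule Lim_transform_eventually)
qed

text \<open>For \<open>v\<close> in \<open>l t0\<close> the slope is of first order in
  \<open>s - t0\<close> by \<open>slope_bound\<close>, hence small against the square root. The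
  square root is the scale whose square matches the first-order crossing form.\<close>

lemma sform_sqrt_tendsto:
  assumes W: "transv W (l t0)" and v: "v \<in> l t0"
  shows "((\<lambda>s. sform W (l s) x v / sqrt \<bar>s - t0\<bar>) \<longlongrightarrow> 0) T0"
proof -
  obtain C where C: "eventually (\<lambda>p. transv W (l p) \<and> (\<forall>x. norm (slope W (l p) x - slope W (l t0) x)
    \<le> C * norm ((x + slope W (l t0) x) - closest_point (l p) (x + slope W (l t0) x)))) T0"
    using slope_bound[OF tendsto W] by blast
  have z: "slope W (l t0) v = 0" using slope_eq_0_iff[OF W] v by blast
  define q where "q s = (closest_point (l s) v - v) /\<^sub>R (s - t0)" for s
  have "((\<lambda>s. C * (norm (q s) * sqrt \<bar>s - t0\<bar>)) \<longlongrightarrow> C * (norm (D v) * sqrt \<bar>t0 - t0\<bar>)) T0"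
    unfolding q_def by (intro tendsto_intros quotient_tendsto[OF v])
  then have lim: "((\<lambda>s. C * (norm (q s) * sqrt \<bar>s - t0\<bar>)) \<longlongrightarrow> 0) T0" by simp
  have "((\<lambda>s. slope W (l s) v /\<^sub>R sqrt \<bar>s - t0\<bar>) \<longlongrightarrow> 0) T0"
  proof (rule Lim_null_comparison[OF _ lim])
    have "eventually (\<lambda>s. s \<noteq> t0) T0" by (simp add: eventually_at_filter)
    with C show "eventually (\<lambda>s. norm (slope W (l s) v /\<^sub>R sqrt \<bar>s - t0\<bar>) \<le> C * (norm (q s) * sqrt \<bar>s - t0\<bar>)) T0"
    proof eventually_elim
      case (elim s)
      let ?r = "sqrt \<bar>s - t0\<bar>"
      have r: "?r > 0" using elim(2) by simp
      have rr: "\<bar>s - t0\<bar> = ?r * ?r" by simp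
      have "norm (slope W (l s) v) \<le> C * norm (v - closest_point (l s) v)"
        using elim(1) z by (metis add.right_neutral diff_zero)
      also have "norm (v - closest_point (l s) v) = norm (q s) * \<bar>s - t0\<bar>"
        using elim(2) by (simp add: q_def norm_minus_commute)
      finally have "norm (slope W (l s) v) \<le> C * (norm (q s) * ?r) * ?r"
        by (subst (asm) rr) (simp add: algebra_simps)
      then show ?case using r by (simp add: divide_inverse[symmetric] field_simps)
    qed
  qed
  from bounded_bilinear.tendsto[OF bounded_bilinear_omega0 tendsto_const this, of x]
  show ?thesis by (simp add: sform_def omega0_simps divide_inverse mult.commute)
qed

lemma sform_has_derivative:
  assumes W: "transv W (l t0)" and v: "v \<in> l t0"
  shows "((\<lambda>t. omega0 v (slope W (l t) v)) has_real_derivative omega0 v (D v)) T0"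
proof -
  have "slope W (l t0) v = 0" using slope_eq_0_iff[OF W] v by blast
  then show ?thesis
    using sform_quotient_tendsto[OF W v v]
    by (simp add: has_field_derivative_iff sform_def omega0_simps)
qed

lemma derivative_unique:
  fixes f :: "real \<Rightarrow> real"
  assumes "(f has_real_derivative d) T0" "(f has_real_derivative d') T0"
  shows "d = d'"
  using vector_derivative_unique_within_closed_interval[of a b t0 f d d'] ab t0 assms
  by (simp add: has_real_derivative_iff_has_vector_derivative)

text \<open>The derivative is the same for every transversal, so the arbitrary choice in
  \<open>transversal_lag\<close> is harmless.\<close>

lemma crossing_form_eq:
  assumes v: "v \<in> l t0"
  shows "crossing_form l a b t0 v = omega0 v (D v)"
proof -
  define W where "W = transversal_lag (l t0)"
  obtain W' where "transv W' (l t0)" using exists_transv2[OF lag lag] by blast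
  then have "lagrangian W \<and> W \<inter> l t0 = {0}"
    unfolding W_def transversal_lag_def transv_def by (intro someI_ex[of "\<lambda>W. lagrangian W \<and> W \<inter> l t0 = {0}"]) blast
  then have W: "transv W (l t0)" using lag by (simp add: transv_def)
  show ?thesis
    unfolding crossing_form_def Let_def W_def[symmetric] slope_def[symmetric]
    using sform_has_derivative[OF W v] derivative_unique by (intro the_equality) blast+
qed

text \<open>\<open>G\<close> is a one-sided approach and \<open>\<sigma>\<close> its direction. On
  the radical \<open>L0 \<inter> l t0\<close> the slope form divided by
  \<open>\<bar>s - t0\<bar>\<close> tends to \<open>\<sigma>\<close> times the crossing form, so
  leaving \<open>t0\<close> adds the positive index of that limit; for \<open>\<sigma> = -1\<close>
  this is \<open>n_minus\<close>.\<close>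

lemma primitive_jump:
  assumes L0: "lagrangian L0" and F: "primitive L0 l {a..b} F"
    and nondeg: "nondeg_form (crossing_form l a b t0) (l t0 \<inter> L0)"
    and G: "G \<le> T0" and sg: "eventually (\<lambda>s. \<bar>s - t0\<bar> = \<sigma> * (s - t0)) G" and \<sigma>: "\<sigma> = 1 \<or> \<sigma> = -1"
  shows "eventually (\<lambda>s. F s = F t0 + int (n_plus (\<lambda>v. \<sigma> * crossing_form l a b t0 v) (l t0 \<inter> L0))) G"
proof -
  obtain W where W: "transv W L0" "transv W (l t0)" using exists_transv2[OF L0 lag] by blast
  define N where "N = L0 \<inter> l t0"
  have NI: "l t0 \<inter> L0 = N" by (simp add: N_def Int_commute)
  have ne: "eventually (\<lambda>s. s \<noteq> t0) G" by (rule filter_leD[OF G]) (simp add: eventually_at_filter)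
  define g where "g x y = \<sigma> * omega0 y (D x)" for x y
  have gc: "g v v = \<sigma> * crossing_form l a b t0 v" if "v \<in> N" for v
    using crossing_form_eq[of v] that by (simp add: g_def N_def)
  have "eventually (\<lambda>s. n_plus (\<lambda>v. sform W (l s) v v) L0
      = n_plus (\<lambda>v. sform W (l t0) v v) L0 + n_plus (\<lambda>v. g v v) N) G"
  proof (rule eventually_n_plus_crossing[where b = "\<lambda>s. sform W (l s)" and ?g0.0 = "sform W (l t0)" and g = g
        and N = N and S = L0 and r = "\<lambda>s. sqrt \<bar>s - t0\<bar>"])
    show "eventually (\<lambda>s. sym_form (sform W (l s)) L0) G"
      using filter_leD[OF G eventually_transv[OF tendsto W(2)]]
      by eventually_elim (rule sym_form_sform[OF _ L0])
    show "sym_form (sform W (l t0)) L0" by (rule sym_form_sform[OF W(2) L0])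
    show "N = rad (sform W (l t0)) L0" unfolding rad_sform[OF W] N_def ..
    show "eventually (\<lambda>s. sqrt \<bar>s - t0\<bar> > 0) G" using ne by eventually_elim simp
    show "((\<lambda>s. sform W (l s) x y) \<longlongrightarrow> sform W (l t0) x y) G" for x y
      by (rule tendsto_mono[OF G sform_tendsto[OF tendsto W(2)]])
    show "((\<lambda>s. sform W (l s) x y / sqrt \<bar>s - t0\<bar>) \<longlongrightarrow> 0) G" if "y \<in> N" for x y
      by (rule tendsto_mono[OF G sform_sqrt_tendsto[OF W(2)]]) (use that in \<open>simp add: N_def\<close>)
    show "((\<lambda>s. sform W (l s) x y / (sqrt \<bar>s - t0\<bar>)\<^sup>2) \<longlongrightarrow> g x y) G" if xy: "x \<in> N" "y \<in> N" for x y
    proof -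
      have "((\<lambda>s. \<sigma> * (sform W (l s) x y / (s - t0))) \<longlongrightarrow> g x y) G"
        unfolding g_def using xy
        by (intro tendsto_mult tendsto_const tendsto_mono[OF G sform_quotient_tendsto[OF W(2)]]) (simp_all add: N_def)
      moreover have "eventually (\<lambda>s. \<sigma> * (sform W (l s) x y / (s - t0)) = sform W (l s) x y / (sqrt \<bar>s - t0\<bar>)\<^sup>2) G"
        using sg
      proof eventually_elim
        case (elim s)
        have "\<sigma> * (sform W (l s) x y / (s - t0)) = sform W (l s) x y / (\<sigma> * (s - t0))"
          using \<sigma> by (elim disjE) (simp_all add: minus_divide_right)
        then show ?case unfolding elim[symmetric] by simp
      qed
      ultimately show ?thesis by (rule Lim_transform_eventually)
    qed
    have 1: "n_plus (\<lambda>v. g v v) N = n_plus (\<lambda>v. \<sigma> * crossing_form l a b t0 v) N"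
      by (rule n_plus_cong) (rule gc)
    have 2: "n_minus (\<lambda>v. g v v) N = n_minus (\<lambda>v. \<sigma> * crossing_form l a b t0 v) N"
      by (rule n_minus_cong) (rule gc)
    show "n_plus (\<lambda>v. g v v) N + n_minus (\<lambda>v. g v v) N = dim N"
      unfolding 1 2 using nondeg \<sigma> unfolding NI nondeg_form_def n_minus_def by auto
  qed
  moreover have "n_plus (\<lambda>v. g v v) N = n_plus (\<lambda>v. \<sigma> * crossing_form l a b t0 v) (l t0 \<inter> L0)"
    unfolding NI by (rule n_plus_cong) (rule gc)
  moreover have "eventually (\<lambda>q. F q - int (hind W L0 (l q)) = F t0 - int (hind W L0 (l t0))) T0"
    using F W t0 unfolding primitive_def by blast
  ultimately show ?thesis
    using filter_leD[OF G, of "\<lambda>q. F q - int (hind W L0 (l q)) = F t0 - int (hind W L0 (l t0))"]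
    unfolding hind_def by (auto elim: eventually_elim2)
qed

end

lemma lag_path_C1_crossing:
  assumes "lag_path_C1 l a b" "a < b" "t0 \<in> {a..b}"
  obtains D where "crossing l a b t0 D"
proof -
  have "\<forall>x. \<exists>D. ((\<lambda>s. closest_point (l s) x) has_vector_derivative D) (at t0 within {a..b})"
    using assms unfolding lag_path_C1_def by blast
  then obtain D where "\<And>x. ((\<lambda>s. closest_point (l s) x) has_vector_derivative D x) (at t0 within {a..b})"
    by metis
  then have "crossing l a b t0 D" using assms unfolding crossing_def lag_path_C1_def by blast
  then show ?thesis using that by blast
qed

text \<open>Next to every \<open>t\<close> the primitive exceeds \<open>F t\<close> by
  \<open>n_plus\<close> on the right and by \<open>n_minus\<close> on the left. Bisection extends
  the formula from short intervals: at a division point the two endpoint terms combine to the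
  signature.\<close>

lemma maslov_crossing_sum:
  assumes L0: "lagrangian L0" and ab: "a < b" and reg: "regular_path L0 l a b"
  shows "maslov L0 l a b = crossing_sum L0 l a b"
proof -
  have C1: "lag_path_C1 l a b" and fin: "finite (crossings L0 l a b)"
    and nd: "\<And>t. t \<in> crossings L0 l a b \<Longrightarrow> nondeg_form (crossing_form l a b t) (l t \<inter> L0)"
    using reg by (auto simp: regular_path_def)
  have path: "lag_path l a b" using C1 by (simp add: lag_path_C1_def)
  define C where "C = crossings L0 l a b"
  define g where "g t = int (n_plus (crossing_form l a b t) (l t \<inter> L0))" for t
  define m where "m t = int (n_minus (crossing_form l a b t) (l t \<inter> L0))" for t
  obtain F where F: "primitive L0 l {a..b} F" using primitive_exists_path[OF path L0] ab by auto
  have nC: "l t \<inter> L0 = {0}" if "t \<in> {a..b}" "t \<notin> C" for t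
    using that by (simp add: C_def crossings_def)
  have gm0: "g t = 0" "m t = 0" if "t \<in> {a..b}" "t \<notin> C" for t
    using nC[OF that] by (simp_all add: g_def m_def n_minus_def n_plus_zero)
  \<comment> \<open>Away from crossings the intersection is \<open>{0}\<close>, where every form
    counts as nondegenerate, so the jump formula holds at all \<open>t\<close>.\<close>
  have nd': "nondeg_form (crossing_form l a b t) (l t \<inter> L0)" if "t \<in> {a..b}" for t
    using nd[of t] nC[OF that] by (cases "t \<in> C") (auto simp: C_def nondeg_form_def n_minus_def n_plus_zero)
  have right: "eventually (\<lambda>s. F s = F t + g t) (at t within {t<..b})"
    and left: "eventually (\<lambda>s. F s = F t + m t) (at t within {a..<t})" if t: "t \<in> {a..b}" for t
  proof -
    obtain D where "crossing l a b t D" using lag_path_C1_crossing[OF C1 ab t] .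
    then interpret crossing l a b t D .
    have "at t within {t<..b} \<le> at t within {a..b}" by (rule at_le) (use t in auto)
    moreover have "eventually (\<lambda>s. \<bar>s - t\<bar> = 1 * (s - t)) (at t within {t<..b})"
      by (simp add: eventually_at_filter)
    ultimately show "eventually (\<lambda>s. F s = F t + g t) (at t within {t<..b})"
      using primitive_jump[OF L0 F nd'[OF t], of "at t within {t<..b}" 1] by (simp add: g_def)
    have "at t within {a..<t} \<le> at t within {a..b}" by (rule at_le) (use t in auto)
    moreover have "eventually (\<lambda>s. \<bar>s - t\<bar> = (-1) * (s - t)) (at t within {a..<t})"
      by (simp add: eventually_at_filter)
    ultimately show "eventually (\<lambda>s. F s = F t + m t) (at t within {a..<t})"
      using primitive_jump[OF L0 F nd'[OF t], of "at t within {a..<t}" "-1"] by (simp add: m_def n_minus_def)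
  qed
  define Z where "Z u v = g u + (\<Sum>t\<in>C \<inter> {u<..<v}. g t - m t) - m v" for u v
  have finC: "finite C" using fin by (simp add: C_def)
  \<comment> \<open>For \<open>u = v\<close> the formula would read \<open>0 = g u - m u\<close>,
    which may fail at a crossing; hence the guard \<open>u < v\<close>.\<close>
  define P where "P u v \<longleftrightarrow> (a \<le> u \<longrightarrow> v \<le> b \<longrightarrow> u < v \<longrightarrow> F v - F u = Z u v)" for u v
  have "P a b"
  proof (induction rule: Bolzano[OF less_imp_le[OF ab]])
    case (1 u v w)
    show ?case
      unfolding P_def
    proof (intro impI)
      assume h: "a \<le> u" "w \<le> b" "u < w"
      show "F w - F u = Z u w"
      proof (cases "u = v \<or> v = w")
        case False
        then have uv: "u < v" "v < w" using 1 by auto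
        have "C \<inter> {u<..<w} = (C \<inter> {u<..<v}) \<union> (C \<inter> {v<..<w}) \<union> (C \<inter> {v})" using uv by auto
        then have "(\<Sum>t\<in>C \<inter> {u<..<w}. g t - m t) = (\<Sum>t\<in>C \<inter> {u<..<v}. g t - m t)
            + (\<Sum>t\<in>C \<inter> {v<..<w}. g t - m t) + (\<Sum>t\<in>C \<inter> {v}. g t - m t)"
          using finC by (simp only:) (subst sum.union_disjoint; auto)+
        moreover have "(\<Sum>t\<in>C \<inter> {v}. g t - m t) = g v - m v"
          using gm0[of v] uv h by (cases "v \<in> C") auto
        ultimately show ?thesis using 1 uv h by (simp add: Z_def P_def)
      qed (use 1 h in \<open>auto simp: P_def\<close>)
    qed
  next
    case (2 x)
    then have x: "x \<in> {a..b}" by simp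
    obtain d1 where d1: "d1 > 0" "\<And>s. s \<in> {x<..b} \<Longrightarrow> dist s x < d1 \<Longrightarrow> F s = F x + g x"
      using right[OF x] unfolding eventually_at by auto
    obtain d2 where d2: "d2 > 0" "\<And>s. s \<in> {a..<x} \<Longrightarrow> dist s x < d2 \<Longrightarrow> F s = F x + m x"
      using left[OF x] unfolding eventually_at by auto
    \<comment> \<open>This keeps all crossings other than \<open>x\<close> out of a short interval
      around \<open>x\<close>.\<close>
    obtain d3 where d3: "d3 > 0" "\<And>s. s \<in> C \<Longrightarrow> s \<noteq> x \<Longrightarrow> d3 \<le> dist x s"
      using finite_set_avoid[OF finC, of x] by blast
    define d where "d = min d1 (min d2 d3)"
    have "F v - F u = Z u v" if uv: "u \<le> x" "x \<le> v" "v - u < d" "a \<le> u" "v \<le> b" "u < v" for u v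
    proof -
      have notC: "s \<notin> C" if "s \<in> {u..v}" "s \<noteq> x" for s
        using d3(2)[of s] that uv by (auto simp: d_def dist_real_def)
      have Fv: "F v = F x + g x" if "x < v" using d1(2)[of v] that uv by (simp add: d_def dist_real_def)
      have Fu: "F u = F x + m x" if "u < x" using d2(2)[of u] that uv by (simp add: d_def dist_real_def)
      have gu: "g u = 0" if "u < x" using gm0(1)[of u] notC[of u] that uv by simp
      have mv: "m v = 0" if "x < v" using gm0(2)[of v] notC[of v] that uv by simp
      consider "u = x" "x < v" | "u < x" "x = v" | "u < x" "x < v" using uv by linarith
      then show ?thesis
      proof cases
        case 1
        then have "C \<inter> {u<..<v} = {}" using notC by fastforce
        then show ?thesis using 1 Fv mv by (simp add: Z_def)
      next
        case 2
        then have "C \<inter> {u<..<v} = {}" using notC by fastforce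
        then show ?thesis using 2 Fu gu by (simp add: Z_def)
      next
        case 3
        have "s \<in> C \<inter> {u<..<v} \<longleftrightarrow> s \<in> C \<inter> {x}" for s using notC[of s] 3 by force
        then have "C \<inter> {u<..<v} = C \<inter> {x}" by blast
        moreover have "(\<Sum>t\<in>C \<inter> {x}. g t - m t) = g x - m x"
          using gm0[OF x] by (cases "x \<in> C") auto
        ultimately show ?thesis using 3 Fu gu Fv mv by (simp add: Z_def)
      qed
    qed
    then show ?case using d1(1) d2(1) d3(1) by (intro exI[of _ d]) (auto simp: d_def P_def)
  qed
  then have "F b - F a = Z a b" using ab by (simp add: P_def)
  moreover have "Z a b = crossing_sum L0 l a b"
    unfolding Z_def crossing_sum_def g_def m_def C_def sgn_form_def ..
  ultimately show ?thesis using maslov_eq[OF L0 ab path F] by simp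
qed

lemma clm_axioms_maslov: "clm_axioms maslov"
  unfolding clm_axioms_def
proof (intro conjI allI impI)
  fix L0 :: "'n::finite sympl set" and l :: "real \<Rightarrow> 'n sympl set" and H and a b c :: real
  show "maslov L0 l a b = 0" if "\<not> (lagrangian L0 \<and> a < b \<and> lag_path l a b)"
    unfolding maslov_def using that by (rule if_not_P)
  show "maslov L0 l a b = crossing_sum L0 l a b" if "lagrangian L0 \<and> a < b \<and> regular_path L0 l a b"
    using that by (elim conjE) (rule maslov_crossing_sum)
  show "maslov L0 (H 0) a b = maslov L0 (H 1) a b"
    if "lagrangian L0 \<and> a < b \<and> lag_homotopy H a b \<and> (\<forall>s\<in>{0..1}. H s a = H 0 a \<and> H s b = H 0 b)"
    using that by (elim conjE) (rule maslov_homotopy, assumption+, rule bspec)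
  show "maslov L0 l a b = maslov L0 l a c + maslov L0 l c b"
    if "lagrangian L0 \<and> a < c \<and> c < b \<and> lag_path l a b"
    using that by (elim conjE) (rule maslov_concat)
qed

section \<open>Smoothness of projections onto moving Lagrangians\<close>

lemma linear_tendsto:
  fixes g :: "'a::euclidean_space \<Rightarrow> 'b::real_normed_vector"
  assumes "linear g" "(u \<longlongrightarrow> u0) F"
  shows "((\<lambda>p. g (u p)) \<longlongrightarrow> g u0) F"
  by (rule bounded_linear.tendsto[OF linear_conv_bounded_linear[THEN iffD1, OF assms(1)] assms(2)])

lemma linear_tendsto_apply:
  fixes f :: "'p \<Rightarrow> 'a::euclidean_space \<Rightarrow> 'b::euclidean_space"
  assumes lin: "eventually (\<lambda>p. linear (f p)) F" and g: "linear g"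
    and lim: "\<And>x. ((\<lambda>p. f p x) \<longlongrightarrow> g x) F" and u: "(u \<longlongrightarrow> u0) F"
  shows "((\<lambda>p. f p (u p)) \<longlongrightarrow> g u0) F"
proof -
  have z: "((\<lambda>p. f p (u p) - g (u p)) \<longlongrightarrow> 0) F"
  proof (rule Lim_null_comparison)
    show "((\<lambda>p. norm (f p (u p) - g (u p))) \<longlongrightarrow> 0) F"
    proof (rule tendstoI)
      fix e :: real assume e: "e > 0"
      define K where "K = norm u0 + 1"
      have K: "K > 0" unfolding K_def by (simp add: add_nonneg_pos)
      have "eventually (\<lambda>p. norm (u p) < K) F"
        using order_tendstoD(2)[OF tendsto_norm[OF u]] unfolding K_def by simp
      moreover have "eventually (\<lambda>p. \<forall>x. norm (f p x - g x) \<le> (e / (2 * K)) * norm x) F"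
        by (rule linear_tendsto_uniform[OF lin g lim]) (use e K in simp)
      ultimately show "eventually (\<lambda>p. dist (norm (f p (u p) - g (u p))) 0 < e) F"
      proof eventually_elim
        case (elim p)
        have "norm (f p (u p) - g (u p)) \<le> (e / (2 * K)) * norm (u p)" using elim(2) by blast
        also have "\<dots> \<le> (e / (2 * K)) * K" using elim(1) e K by (intro mult_left_mono) auto
        also have "\<dots> < e" using e K by simp
        finally show ?case by simp
      qed
    qed
  qed simp
  from tendsto_add[OF z linear_tendsto[OF g u]] show ?thesis by simp
qed

text \<open>\<open>N0\<close> is bounded below and half of that bound holds for \<open>N p\<close>
  near the limit, so the distance of the solutions from \<open>y0\<close> is controlled by the
  residual of \<open>y0\<close>.\<close>

lemma linear_solution_tendsto:
  fixes N :: "'p \<Rightarrow> 'a::euclidean_space \<Rightarrow> 'b::euclidean_space"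
  assumes lin: "eventually (\<lambda>p. linear (N p)) F" and N0: "linear N0" and inj: "\<And>z. N0 z = 0 \<Longrightarrow> z = 0"
    and lim: "\<And>z. ((\<lambda>p. N p z) \<longlongrightarrow> N0 z) F"
    and x: "(x \<longlongrightarrow> N0 y0) F" and sol: "eventually (\<lambda>p. N p (y p) = x p) F"
  shows "(y \<longlongrightarrow> y0) F"
proof -
  have "\<exists>e>0. \<forall>z\<in>UNIV. norm (N0 z) \<ge> e * norm z"
    by (rule injective_imp_isometric) (use N0 inj in \<open>simp_all add: linear_conv_bounded_linear\<close>)
  then obtain e where e: "e > 0" "\<And>z. norm (N0 z) \<ge> e * norm z" by blast
  have "eventually (\<lambda>p. \<forall>z. norm (N p z - N0 z) \<le> (e/2) * norm z) F"
    by (rule linear_tendsto_uniform[OF lin N0 lim]) (use e in simp)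
  then have bound: "eventually (\<lambda>p. norm (y p - y0) \<le> (2/e) * norm (x p - N p y0)) F"
    using sol lin
  proof eventually_elim
    case (elim p)
    let ?z = "y p - y0"
    have "e * norm ?z \<le> norm (N0 ?z)" using e(2) .
    also have "\<dots> \<le> norm (N p ?z) + norm (N p ?z - N0 ?z)"
      using norm_triangle_sub[of "N0 ?z" "N p ?z"] by (simp add: norm_minus_commute)
    also have "\<dots> \<le> norm (N p ?z) + (e/2) * norm ?z" using elim(1) by simp
    finally have "(e/2) * norm ?z \<le> norm (x p - N p y0)"
      using linear_diff[OF elim(3), of "y p" y0] elim(2) by (simp add: field_simps)
    then show ?case using e(1) by (simp add: field_simps)
  qed
  have "((\<lambda>p. (2/e) * norm (x p - N p y0)) \<longlongrightarrow> (2/e) * norm (N0 y0 - N0 y0)) F"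
    by (intro tendsto_intros x lim)
  then have "((\<lambda>p. (2/e) * norm (x p - N p y0)) \<longlongrightarrow> 0) F" by simp
  from Lim_null_comparison[OF bound this] show ?thesis by (rule LIM_zero_cancel)
qed

text \<open>The image of a Lagrangian under \<open>J0\<close> is its Euclidean orthogonal
  complement; the second summand is the projection onto it.\<close>

lemma lagrangian_decomp:
  assumes A: "lagrangian A"
  shows "z = closest_point A z + J0 (closest_point A (- J0 z))"
proof -
  note sA = lagrangian_subspace[OF A]
  let ?P = "closest_point A"
  have linP: "linear ?P" by (rule closest_point_subspace_linear[OF sA])
  define u where "u = z - ?P z"
  have "J0 u \<in> A"
    by (rule lagrangian_maximal[OF A]) (use closest_point_subspace_orth[OF sA, of _ z] in \<open>simp add: u_def\<close>)
  then have u: "- J0 u \<in> A" by (rule subspace_neg[OF sA])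
  have "?P (J0 (?P z)) = 0"
  proof (rule closest_point_subspace_eqI[OF sA subspace_0[OF sA]])
    fix y assume "y \<in> A"
    then have "omega0 (?P z) y = 0" by (rule lagrangian_omega0[OF A closest_point_subspace_in[OF sA]])
    then show "inner (J0 (?P z) - 0) y = 0" by (simp add: omega0_conv_inner)
  qed
  moreover have "- J0 z = - J0 (?P z) + - J0 u"
    by (simp add: u_def linear_diff[OF linear_J0])
  ultimately have "?P (- J0 z) = - J0 u"
    using closest_point_subspace_id[OF sA u] by (simp add: linear_diff[OF linP] linear_neg[OF linP])
  then show ?thesis by (simp add: linear_neg[OF linear_J0] u_def)
qed

text \<open>If \<open>M\<close> maps \<open>A\<close> onto the Lagrangian \<open>l\<close>, then \<open>a + J0 b \<mapsto> M a + J0 (M b)\<close> (\<open>a, b \<in> A\<close>) is invertible and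
  conjugates the projection onto \<open>A\<close> with the projection onto \<open>l\<close>.\<close>

definition frame :: "'n::finite sympl set \<Rightarrow> ('n sympl \<Rightarrow> 'n sympl) \<Rightarrow> 'n sympl \<Rightarrow> 'n sympl" where
  "frame A M z = M (closest_point A z) + J0 (M (closest_point A (- J0 z)))"

lemma linear_frame:
  assumes "lagrangian A" "linear M"
  shows "linear (frame A M)"
proof -
  have P: "linear (closest_point A)" by (rule closest_point_subspace_linear[OF lagrangian_subspace[OF assms(1)]])
  show ?thesis
    unfolding frame_def[abs_def]
    by (rule linearI) (simp_all add: linear_add[OF P] linear_add[OF assms(2)] linear_add[OF linear_J0]
        linear_diff[OF P] linear_diff[OF assms(2)] linear_diff[OF linear_J0]
        linear_neg[OF P] linear_neg[OF assms(2)] linear_neg[OF linear_J0]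
        linear_scale[OF P] linear_scale[OF assms(2)] linear_scale[OF linear_J0] algebra_simps)
qed

text \<open>The image is isotropic, so \<open>M v\<close> and \<open>J0 (M w)\<close> are orthogonal
  and a vanishing sum forces both to vanish.\<close>

lemma frame_inj:
  assumes A: "lagrangian A" and M: "linear M" and lag: "lagrangian (M ` A)"
    and inj: "\<And>v. v \<in> A \<Longrightarrow> M v = 0 \<Longrightarrow> v = 0" and z: "frame A M z = 0"
  shows "z = 0"
proof -
  define v where "v = closest_point A z"
  define w where "w = closest_point A (- J0 z)"
  have vw: "v \<in> A" "w \<in> A"
    unfolding v_def w_def by (rule closest_point_subspace_in[OF lagrangian_subspace[OF A]])+
  have e: "M v + J0 (M w) = 0" using z by (simp add: frame_def v_def w_def)
  have om: "omega0 (M w) (M v) = 0" by (rule lagrangian_omega0[OF lag]) (use vw in blast)+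
  have "inner (M v + J0 (M w)) (M v) = 0" "inner (M v + J0 (M w)) (J0 (M w)) = 0" using e by simp_all
  then have "M v = 0" "M w = 0"
    using om by (simp_all add: inner_add_left inner_add_right omega0_conv_inner inner_commute)
  then have "v = 0" "w = 0" using inj vw by blast+
  then show ?thesis using lagrangian_decomp[OF A, of z] linear_0[OF linear_J0]
    by (simp add: v_def w_def)
qed

lemma closest_point_frame:
  assumes A: "lagrangian A" and M: "linear M" and lag: "lagrangian (M ` A)"
  shows "closest_point (M ` A) (frame A M z) = M (closest_point A z)"
proof (rule closest_point_subspace_eqI[OF lagrangian_subspace[OF lag]])
  note i = closest_point_subspace_in[OF lagrangian_subspace[OF A]]
  show "M (closest_point A z) \<in> M ` A" using i by blast
  fix y assume y: "y \<in> M ` A"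
  have "omega0 (M (closest_point A (- J0 z))) y = 0"
    by (rule lagrangian_omega0[OF lag _ y]) (use i in blast)
  then show "inner (frame A M z - M (closest_point A z)) y = 0"
    by (simp add: frame_def omega0_conv_inner)
qed

lemma frame_solution:
  fixes A :: "'n::finite sympl set"
  assumes A: "lagrangian A" and M: "linear M" and lag: "lagrangian (M ` A)"
    and inj: "\<And>v. v \<in> A \<Longrightarrow> M v = 0 \<Longrightarrow> v = 0"
  obtains z where "frame A M z = x"
proof -
  have l: "linear (frame A M)" by (rule linear_frame[OF A M])
  have "inj (frame A M)"
    using frame_inj[OF A M lag inj] by (simp add: linear_injective_0[OF l])
  then have "surj (frame A M)" using linear_injective_imp_surjective[OF l] by blast
  then show ?thesis using that by (metis surjD)
qed

text \<open>Continuity of Lagrangians is measured by projections, while charts and flows supply them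
  as images of a fixed \<open>A\<close>. This setting turns pointwise continuity of the maps into
  continuity of the projections.\<close>

locale lag_frame =
  fixes A :: "'n::finite sympl set" and M :: "'p::topological_space \<Rightarrow> 'n sympl \<Rightarrow> 'n sympl" and S :: "'p set"
  assumes A: "lagrangian A" and M: "\<And>p. p \<in> S \<Longrightarrow> linear (M p)" and lag: "\<And>p. p \<in> S \<Longrightarrow> lagrangian (M p ` A)"
    and inj: "\<And>p v. p \<in> S \<Longrightarrow> v \<in> A \<Longrightarrow> M p v = 0 \<Longrightarrow> v = 0"
    and cont: "\<And>z. continuous_on S (\<lambda>p. M p z)"
begin

definition sol where "sol x p = (SOME z. frame A (M p) z = x)"

lemma sol: "p \<in> S \<Longrightarrow> frame A (M p) (sol x p) = x"
  unfolding sol_def by (rule someI_ex, rule frame_solution[OF A M lag inj]) blast+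

lemma proj: "p \<in> S \<Longrightarrow> closest_point (M p ` A) x = M p (closest_point A (sol x p))"
  using closest_point_frame[OF A M lag, of p "sol x p"] sol by simp

lemma linP: "linear (closest_point A)"
  by (rule closest_point_subspace_linear[OF lagrangian_subspace[OF A]])

lemma P_tendsto: "(u \<longlongrightarrow> u0) F \<Longrightarrow> ((\<lambda>p. closest_point A (u p)) \<longlongrightarrow> closest_point A u0) F"
  by (rule linear_tendsto[OF linP])

lemma J0_tendsto: "(u \<longlongrightarrow> u0) F \<Longrightarrow> ((\<lambda>p. J0 (u p)) \<longlongrightarrow> J0 u0) F"
  by (rule linear_tendsto[OF linear_J0])

lemma in_S: "eventually (\<lambda>p. p \<in> S) (at p within S)"
  by (simp add: eventually_at_filter)

lemma M_lin: "eventually (\<lambda>p. linear (M p)) (at p within S)"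
  using in_S by eventually_elim (rule M)

lemma M_tendsto: "p \<in> S \<Longrightarrow> ((\<lambda>q. M q z) \<longlongrightarrow> M p z) (at p within S)"
  using cont by (simp add: continuous_on_def)

lemma M_apply: "p \<in> S \<Longrightarrow> (u \<longlongrightarrow> u0) (at p within S) \<Longrightarrow> ((\<lambda>q. M q (u q)) \<longlongrightarrow> M p u0) (at p within S)"
  by (rule linear_tendsto_apply[OF M_lin M M_tendsto])

lemma sol_tendsto:
  assumes p: "p \<in> S" and y: "eventually (\<lambda>q. frame A (M q) (y q) = x q) (at p within S)"
    and x: "(x \<longlongrightarrow> frame A (M p) y0) (at p within S)"
  shows "(y \<longlongrightarrow> y0) (at p within S)"
proof (rule linear_solution_tendsto[where N = "\<lambda>q. frame A (M q)" and ?N0.0 = "frame A (M p)" and x = x])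
  show "eventually (\<lambda>q. linear (frame A (M q))) (at p within S)"
    using M_lin by eventually_elim (rule linear_frame[OF A])
  show "linear (frame A (M p))" by (rule linear_frame[OF A M[OF p]])
  show "z = 0" if "frame A (M p) z = 0" for z
    by (rule frame_inj[OF A M[OF p] lag[OF p] inj[OF p] that])
  show "((\<lambda>q. frame A (M q) z) \<longlongrightarrow> frame A (M p) z) (at p within S)" for z
    unfolding frame_def by (intro tendsto_add J0_tendsto M_tendsto[OF p])
qed (fact x, fact y)

lemma sol_continuous: "p \<in> S \<Longrightarrow> (sol x \<longlongrightarrow> sol x p) (at p within S)"
proof (rule sol_tendsto[where x = "\<lambda>_. x"])
  show "eventually (\<lambda>q. frame A (M q) (sol x q) = x) (at p within S)"
    using in_S by eventually_elim (rule sol)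
qed (simp_all add: sol)

lemma family: "lag_family (\<lambda>p. M p ` A) S"
  unfolding lag_family_def
proof (intro conjI ballI allI lag)
  fix x
  have "continuous_on S (\<lambda>p. M p (closest_point A (sol x p)))"
    unfolding continuous_on_def by (intro ballI M_apply P_tendsto sol_continuous)
  then show "continuous_on S (\<lambda>p. closest_point (M p ` A) x)"
    by (rule continuous_on_eq) (simp add: proj)
qed

end

text \<open>Affine dependence on time with velocity \<open>d\<close>, as for straight segments in a
  chart.\<close>

locale lag_frame_C1 = lag_frame A M "{a..b}"
  for A :: "'n::finite sympl set" and M :: "real \<Rightarrow> 'n sympl \<Rightarrow> 'n sympl" and a b :: real +
  fixes d :: "'n sympl \<Rightarrow> 'n sympl"
  assumes d: "linear d" and deriv: "\<And>s t z. s \<in> {a..b} \<Longrightarrow> t \<in> {a..b} \<Longrightarrow> M s z - M t z = (s - t) *\<^sub>R d z"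
begin

lemma linear_frame_d: "linear (frame A d)"
  by (rule linear_frame[OF A d])

lemma frame_diff:
  "s \<in> {a..b} \<Longrightarrow> t \<in> {a..b} \<Longrightarrow> frame A (M s) z - frame A (M t) z = (s - t) *\<^sub>R frame A d z"
  using deriv[of s t "closest_point A z"] deriv[of s t "closest_point A (- J0 z)"]
  by (simp add: frame_def add_diff_add linear_diff[OF linear_J0, symmetric] linear_scale[OF linear_J0] scaleR_add_right)

text \<open>The candidate derivative, found by differentiating
  \<open>frame A (M t) (sol x t) = x\<close>.\<close>

definition dsol where "dsol x t = sol (- frame A d (sol x t)) t"

lemma sol_deriv:
  assumes t: "t \<in> {a..b}"
  shows "((\<lambda>s. (sol x s - sol x t) /\<^sub>R (s - t)) \<longlongrightarrow> dsol x t) (at t within {a..b})"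
proof (rule sol_tendsto[OF t, where x = "\<lambda>_. - frame A d (sol x t)"])
  have "eventually (\<lambda>s. s \<noteq> t) (at t within {a..b})" by (simp add: eventually_at_filter)
  with in_S[of t] show "eventually (\<lambda>s. frame A (M s) ((sol x s - sol x t) /\<^sub>R (s - t)) = - frame A d (sol x t)) (at t within {a..b})"
  proof eventually_elim
    case (elim s)
    have l: "linear (frame A (M s))" by (rule linear_frame[OF A M[OF elim(1)]])
    have "frame A (M s) (sol x s - sol x t) = frame A (M t) (sol x t) - frame A (M s) (sol x t)"
      using sol[OF elim(1), of x] sol[OF t, of x] by (simp add: linear_diff[OF l])
    also have "\<dots> = - ((s - t) *\<^sub>R frame A d (sol x t))" using frame_diff[OF elim(1) t, of "sol x t"] by (metis minus_diff_eq)
    finally show ?case using elim(2) by (simp add: linear_scale[OF l])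
  qed
  show "((\<lambda>_. - frame A d (sol x t)) \<longlongrightarrow> frame A (M t) (dsol x t)) (at t within {a..b})"
    unfolding dsol_def sol[OF t] by simp
qed

lemma dsol_continuous:
  assumes t: "t \<in> {a..b}"
  shows "(dsol x \<longlongrightarrow> dsol x t) (at t within {a..b})"
proof (rule sol_tendsto[OF t, where x = "\<lambda>s. - frame A d (sol x s)"])
  show "eventually (\<lambda>s. frame A (M s) (dsol x s) = - frame A d (sol x s)) (at t within {a..b})"
    using in_S by eventually_elim (simp add: dsol_def sol)
  have "((\<lambda>s. - frame A d (sol x s)) \<longlongrightarrow> - frame A d (sol x t)) (at t within {a..b})"
    by (intro tendsto_minus linear_tendsto[OF linear_frame_d] sol_continuous[OF t])
  then show "((\<lambda>s. - frame A d (sol x s)) \<longlongrightarrow> frame A (M t) (dsol x t)) (at t within {a..b})"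
    using t by (simp add: dsol_def sol)
qed

lemma proj_deriv:
  assumes t: "t \<in> {a..b}"
  shows "((\<lambda>s. closest_point (M s ` A) x) has_vector_derivative
    (M t (closest_point A (dsol x t)) + d (closest_point A (sol x t)))) (at t within {a..b})"
  unfolding has_vector_derivative_quotient
proof (rule Lim_transform_eventually)
  let ?P = "closest_point A"
  show "((\<lambda>s. M s (?P ((sol x s - sol x t) /\<^sub>R (s - t))) + d (?P (sol x t))) \<longlongrightarrow>
      M t (?P (dsol x t)) + d (?P (sol x t))) (at t within {a..b})"
    by (intro tendsto_add tendsto_const M_apply[OF t] P_tendsto sol_deriv[OF t])
  have "eventually (\<lambda>s. s \<noteq> t) (at t within {a..b})" by (simp add: eventually_at_filter)
  with in_S[of t] show "eventually (\<lambda>s. M s (?P ((sol x s - sol x t) /\<^sub>R (s - t))) + d (?P (sol x t)) =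
      (closest_point (M s ` A) x - closest_point (M t ` A) x) /\<^sub>R (s - t)) (at t within {a..b})"
  proof eventually_elim
    case (elim s)
    note Ms = M[OF elim(1)]
    have "closest_point (M s ` A) x - closest_point (M t ` A) x
        = M s (?P (sol x s - sol x t)) + (M s (?P (sol x t)) - M t (?P (sol x t)))"
      by (simp add: proj[OF elim(1)] proj[OF t] linear_diff[OF linP] linear_diff[OF Ms])
    also have "\<dots> = M s (?P (sol x s - sol x t)) + (s - t) *\<^sub>R d (?P (sol x t))"
      by (simp only: deriv[OF elim(1) t])
    finally show ?case
      using elim(2) by (simp add: linear_scale[OF linP] linear_scale[OF Ms] scaleR_add_right)
  qed
qed

lemma path_C1:
  assumes l: "\<And>s. s \<in> {a..b} \<Longrightarrow> l s = M s ` A"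
  shows "lag_path_C1 l a b"
  unfolding lag_path_C1_def
proof (intro conjI allI)
  show "lag_path l a b"
    unfolding lag_path_family lag_family_def
  proof (intro conjI ballI allI)
    show "lagrangian (l s)" if "s \<in> {a..b}" for s using lag[OF that] l[OF that] by simp
    have "continuous_on {a..b} (\<lambda>s. closest_point (M s ` A) x)" for x
      using family unfolding lag_family_def by blast
    then show "continuous_on {a..b} (\<lambda>s. closest_point (l s) x)" for x
      by (rule continuous_on_eq) (simp add: l)
  qed
  fix x
  let ?D = "\<lambda>t. M t (closest_point A (dsol x t)) + d (closest_point A (sol x t))"
  have "((\<lambda>s. closest_point (l s) x) has_vector_derivative ?D t) (at t within {a..b})" if t: "t \<in> {a..b}" for t
    using proj_deriv[OF t, of x] by (rule has_vector_derivative_transform[OF t, rotated]) (simp add: l)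
  moreover have "continuous_on {a..b} ?D"
    unfolding continuous_on_def
    by (intro ballI tendsto_add M_apply P_tendsto dsol_continuous linear_tendsto[OF d] sol_continuous)
  ultimately show "\<exists>D. (\<forall>t\<in>{a..b}. ((\<lambda>s. closest_point (l s) x) has_vector_derivative D t) (at t within {a..b}))
      \<and> continuous_on {a..b} D" by (intro exI[of _ ?D] conjI ballI)
qed

end

section \<open>Graph charts and uniqueness of the Maslov index\<close>

definition graph_over :: "'n::finite sympl set \<Rightarrow> ('n sympl \<Rightarrow> 'n sympl) \<Rightarrow> 'n sympl set" where
  "graph_over A k = (\<lambda>v. v + k v) ` A"

text \<open>These maps are the coordinates of Lagrangians transversal to \<open>W\<close>; they are
  closed under linear combinations, which provides straight-line homotopies.\<close>

definition chart :: "'n::finite sympl set \<Rightarrow> 'n sympl set \<Rightarrow> ('n sympl \<Rightarrow> 'n sympl) \<Rightarrow> bool" where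
  "chart W A k \<longleftrightarrow> linear k \<and> (\<forall>v\<in>A. k v \<in> W) \<and> (\<forall>v\<in>A. \<forall>v'\<in>A. omega0 v (k v') = omega0 v' (k v))"

lemma chart_slope:
  assumes "transv W A" "transv W B"
  shows "chart W A (slope W B)"
  using slope_linear[OF assms(2)] slope_in[OF assms(2)] sform_sym[OF assms(2) transvD(2)[OF assms(1)]]
  unfolding chart_def sform_def by blast

lemma chart_combination:
  assumes W: "transv W A" and k: "chart W A k" "chart W A k'"
  shows "chart W A (\<lambda>v. c *\<^sub>R k v + c' *\<^sub>R k' v)"
  unfolding chart_def
proof (intro conjI ballI)
  have l: "linear k" "linear k'" and kW: "\<And>v. v \<in> A \<Longrightarrow> k v \<in> W" "\<And>v. v \<in> A \<Longrightarrow> k' v \<in> W"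
    using k unfolding chart_def by blast+
  show "linear (\<lambda>v. c *\<^sub>R k v + c' *\<^sub>R k' v)" using l by (intro linear_compose_add linear_compose_scale_right)
  note sW = transvD(3)[OF W]
  show "c *\<^sub>R k v + c' *\<^sub>R k' v \<in> W" if "v \<in> A" for v
    by (intro subspace_add[OF sW] subspace_scale[OF sW] kW that)
  show "omega0 v (c *\<^sub>R k v' + c' *\<^sub>R k' v') = omega0 v' (c *\<^sub>R k v + c' *\<^sub>R k' v)" if "v \<in> A" "v' \<in> A" for v v'
  proof -
    have "omega0 v (k v') = omega0 v' (k v)" "omega0 v (k' v') = omega0 v' (k' v)"
      using k that unfolding chart_def by blast+
    then show ?thesis by (simp add: omega0_simps)
  qed
qed

lemma chart_scale:
  assumes "transv W A" "chart W A k"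
  shows "chart W A (\<lambda>v. c *\<^sub>R k v)"
  using chart_combination[OF assms assms(2), of c 0] by simp

lemma chart_inj:
  assumes W: "transv W A" and k: "chart W A k" and v: "v \<in> A" "v + k v = 0"
  shows "v = 0"
proof -
  have "k v \<in> W" using k v(1) unfolding chart_def by blast
  moreover have "v = - k v" using v(2) by (simp add: add_eq_0_iff2)
  ultimately have "v \<in> W" using subspace_neg[OF transvD(3)[OF W]] by metis
  then show ?thesis using v(1) transv_0[OF W] by blast
qed

lemma linear_id_plus: "linear k \<Longrightarrow> linear (\<lambda>v. v + k v)"
  by (intro linear_compose_add linear_ident)

lemma chart_graph:
  assumes W: "transv W A" and k: "chart W A k"
  shows chart_graph_transv: "transv W (graph_over A k)"
    and chart_graph_slope: "v \<in> A \<Longrightarrow> slope W (graph_over A k) v = k v"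
proof -
  have l: "linear k" and kW: "\<And>v. v \<in> A \<Longrightarrow> k v \<in> W"
    and sym: "\<And>v v'. v \<in> A \<Longrightarrow> v' \<in> A \<Longrightarrow> omega0 v (k v') = omega0 v' (k v)"
    using k unfolding chart_def by blast+
  note A = transvD(2,4)[OF W] and lW = transvD(1,3)[OF W]
  have "lagrangian (graph_over A k)"
    unfolding graph_over_def
  proof (rule lagrangianI_image[OF A(1) linear_id_plus[OF l] chart_inj[OF W k]])
    fix x y assume xy: "x \<in> A" "y \<in> A"
    have "omega0 x y = 0" "omega0 (k x) (k y) = 0"
      using lagrangian_omega0[OF A(1) xy] lagrangian_omega0[OF lW(1) kW[OF xy(1)] kW[OF xy(2)]] .
    then show "omega0 (x + k x) (y + k y) = 0"
      using sym[OF xy] omega0_swap[of "k x" y] by (simp add: omega0_simps)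
  qed
  moreover have "z = 0" if z: "z \<in> W" "z \<in> graph_over A k" for z
  proof -
    obtain v where v: "v \<in> A" "z = v + k v" using z(2) unfolding graph_over_def by blast
    have "z - k v \<in> W" by (rule subspace_diff[OF lW(2) z(1) kW[OF v(1)]])
    then have "v \<in> W" using v(2) by simp
    then have "v = 0" using v(1) transv_0[OF W] by blast
    then show ?thesis using v(2) linear_0[OF l] by simp
  qed
  ultimately show t: "transv W (graph_over A k)"
    using lW subspace_0[OF lW(2)] subspace_0[OF lagrangian_subspace] unfolding transv_def by blast
  show "slope W (graph_over A k) v = k v" if "v \<in> A"
    by (rule slope_eqI[OF t kW[OF that]]) (use that in \<open>simp add: graph_over_def\<close>)
qed

lemma graph_slope:
  assumes W: "transv W A" and B: "transv W B"
  shows "graph_over A (slope W B) = B"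
proof (rule subspace_dim_equal)
  have l: "lagrangian (graph_over A (slope W B))"
    using chart_graph_transv[OF W chart_slope[OF W B]] by (rule transvD)
  show "subspace (graph_over A (slope W B))" using l by (rule lagrangian_subspace)
  show "subspace B" using transvD[OF B] by blast
  show "graph_over A (slope W B) \<subseteq> B" unfolding graph_over_def using slope_add_in[OF B] by blast
  show "dim (graph_over A (slope W B)) \<ge> dim B"
    using lagrangian_dim[OF l] lagrangian_dim[OF transvD(2)[OF B]] by simp
qed

lemma chart_lag_frame:
  assumes W: "transv W A" and k: "\<And>p. p \<in> S \<Longrightarrow> chart W A (k p)"
    and cont: "\<And>z. continuous_on S (\<lambda>p. k p z)"
  shows "lag_frame A (\<lambda>p v. v + k p v) S"
proof (rule lag_frame.intro)
  show "lagrangian A" using transvD[OF W] by blast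
  show "linear (\<lambda>v. v + k p v)" if "p \<in> S" for p
    using k[OF that] linear_id_plus unfolding chart_def by blast
  show "lagrangian ((\<lambda>v. v + k p v) ` A)" if "p \<in> S" for p
    using transvD(2)[OF chart_graph_transv[OF W k[OF that]]] unfolding graph_over_def .
  show "v = 0" if "p \<in> S" "v \<in> A" "v + k p v = 0" for p v
    using chart_inj[OF W k[OF that(1)] that(2,3)] .
  show "continuous_on S (\<lambda>p. z + k p z)" for z by (intro continuous_intros cont)
qed

lemma nondeg_form_definite:
  fixes Q :: "'a::euclidean_space \<Rightarrow> real"
  assumes S: "subspace S" and pos: "\<And>v. v \<in> S \<Longrightarrow> v \<noteq> 0 \<Longrightarrow> Q v > 0"
  shows "n_plus Q S = dim S" "n_plus (\<lambda>v. - Q v) S = 0"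
proof -
  obtain U where U: "subspace U" "U \<subseteq> S" "dim U = n_plus Q S" "\<And>u. u \<in> U \<Longrightarrow> u \<noteq> 0 \<Longrightarrow> Q u > 0"
    using n_plus_witness[OF S, of Q] by blast
  show "n_plus Q S = dim S"
    using n_plus_ge[of S S Q] S pos dim_subset[OF U(2)] U(3) by fastforce
  obtain V where V: "subspace V" "V \<subseteq> S" "dim V = n_plus (\<lambda>v. - Q v) S" "\<And>u. u \<in> V \<Longrightarrow> u \<noteq> 0 \<Longrightarrow> - Q u > 0"
    using n_plus_witness[OF S, of "\<lambda>v. - Q v"] by blast
  have "V \<subseteq> {0}" using V(2,4) pos by force
  then have "dim V = 0" by (simp only: dim_eq_0)
  then show "n_plus (\<lambda>v. - Q v) S = 0" using V(3) by simp
qed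

text \<open>Kernel vectors of \<open>k + t d\<close> at distinct times are orthogonal for the definite form of \<open>d\<close>, so
  there are at most \<open>n\<close> crossings.\<close>

lemma finite_affine_kernel_times:
  fixes A :: "'n::finite sympl set"
  assumes k: "chart W A k" and d: "chart W A d" and nz: "\<And>v. v \<in> A \<Longrightarrow> v \<noteq> 0 \<Longrightarrow> omega0 v (d v) \<noteq> 0"
  shows "finite {t. \<exists>v\<in>A. v \<noteq> 0 \<and> k v + (t - c) *\<^sub>R d v = 0}" (is "finite ?T")
proof (rule finite_if_finite_subsets_card_bdd[THEN conjunct1])
  fix T assume T: "T \<subseteq> ?T" "finite T"
  define f where "f t = (SOME v. v \<in> A \<and> v \<noteq> 0 \<and> k v + (t - c) *\<^sub>R d v = 0)" for t
  have f: "f t \<in> A" "f t \<noteq> 0" "k (f t) + (t - c) *\<^sub>R d (f t) = 0" if "t \<in> T" for t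
    using someI_ex[of "\<lambda>v. v \<in> A \<and> v \<noteq> 0 \<and> k v + (t - c) *\<^sub>R d v = 0"] that T(1) unfolding f_def by blast+
  have orth: "omega0 (f s) (d (f t)) = 0" if st: "s \<in> T" "t \<in> T" "s \<noteq> t" for s t
  proof -
    have eq: "omega0 (f s) (k (f t) + (t - c) *\<^sub>R d (f t)) = 0" "omega0 (f t) (k (f s) + (s - c) *\<^sub>R d (f s)) = 0"
      using f(3)[OF st(1)] f(3)[OF st(2)] by (simp_all add: omega0_simps)
    have sym: "omega0 (f s) (k (f t)) = omega0 (f t) (k (f s))" "omega0 (f s) (d (f t)) = omega0 (f t) (d (f s))"
      using k d f(1)[OF st(1)] f(1)[OF st(2)] unfolding chart_def by blast+
    have "(t - c) * omega0 (f s) (d (f t)) = (s - c) * omega0 (f s) (d (f t))"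
      using eq unfolding omega0_simps real_scaleR_def sym by linarith
    then show ?thesis using st(3) by simp
  qed
  have inj: "inj_on f T"
  proof (rule inj_onI, rule ccontr)
    fix s t assume st: "s \<in> T" "t \<in> T" "f s = f t" "s \<noteq> t"
    show False using orth[OF st(1,2,4)] nz[OF f(1,2)[OF st(2)]] st(3) by simp
  qed
  have ld: "linear d" using d by (simp add: chart_def)
  have "independent (f ` T)"
  proof (rule independent_if_scalars_zero)
    fix h x assume sum: "(\<Sum>v\<in>f ` T. h v *\<^sub>R v) = 0" and x: "x \<in> f ` T"
    obtain t where t: "t \<in> T" "x = f t" using x by blast
    \<comment> \<open>Pairing the linear relation with \<open>d x\<close> removes every term except
      the one at \<open>x\<close>.\<close>
    have lin: "linear (\<lambda>v. omega0 v (d x))" by (rule linearI) (simp_all add: omega0_simps)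
    have "0 = omega0 (\<Sum>v\<in>f ` T. h v *\<^sub>R v) (d x)" using sum by (simp add: omega0_simps)
    also have "\<dots> = (\<Sum>v\<in>f ` T. h v * omega0 v (d x))"
      by (simp add: linear_sum[OF lin] linear_scale[OF lin])
    also have "\<dots> = (\<Sum>v\<in>f ` T. if v = x then h x * omega0 x (d x) else 0)"
    proof (rule sum.cong[OF refl])
      fix v assume "v \<in> f ` T"
      then obtain s where s: "s \<in> T" "v = f s" by blast
      show "h v * omega0 v (d x) = (if v = x then h x * omega0 x (d x) else 0)"
        using orth[OF s(1) t(1)] s(2) t(2) by (cases "s = t") auto
    qed
    also have "\<dots> = h x * omega0 x (d x)" using T(2) x by simp
    finally show "h x = 0" using nz[OF f(1,2)[OF t(1)]] t(2) by simp
  qed (use T in simp)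
  then have "card (f ` T) \<le> DIM('n sympl)" by (rule independent_card_le_dim[of _ UNIV, unfolded dim_UNIV, rotated]) simp
  then show "card T \<le> DIM('n sympl)" using card_image[OF inj] by simp
qed

text \<open>The crossing form is \<open>omega0 v (d v)\<close> at every crossing, so definiteness of
  \<open>d\<close> gives nondegeneracy. Crossings are the times when
  \<open>k v + (t - c) *\<^sub>R d v\<close> vanishes for some nonzero \<open>v\<close>, finite in
  number.\<close>

lemma regular_affine_path:
  fixes L0 :: "'n::finite sympl set"
  assumes W: "transv W L0" and ab: "a < b" and k: "chart W L0 k" and d: "chart W L0 d"
    and def: "(\<forall>v\<in>L0. v \<noteq> 0 \<longrightarrow> omega0 v (d v) > 0) \<or> (\<forall>v\<in>L0. v \<noteq> 0 \<longrightarrow> omega0 v (d v) < 0)"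
    and l: "\<And>s. s \<in> {a..b} \<Longrightarrow> l s = graph_over L0 (\<lambda>v. k v + (s - c) *\<^sub>R d v)"
  shows "regular_path L0 l a b"
proof -
  have ks: "chart W L0 (\<lambda>v. k v + (s - c) *\<^sub>R d v)" for s
    using chart_combination[OF W k d, of 1 "s - c"] by simp
  have sl: "slope W (l s) v = k v + (s - c) *\<^sub>R d v" if "s \<in> {a..b}" "v \<in> L0" for s v
    using chart_graph_slope[OF W ks[of s] that(2)] l[OF that(1)] by simp
  have tl: "transv W (l s)" if "s \<in> {a..b}" for s
    using chart_graph_transv[OF W ks[of s]] l[OF that] by simp
  have "lag_frame L0 (\<lambda>s v. v + (k v + (s - c) *\<^sub>R d v)) {a..b}"
    by (rule chart_lag_frame[OF W ks]) (intro continuous_intros)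
  moreover have "lag_frame_C1_axioms (\<lambda>s v. v + (k v + (s - c) *\<^sub>R d v)) a b d"
    using d unfolding lag_frame_C1_axioms_def chart_def by (simp add: algebra_simps)
  ultimately have "lag_frame_C1 L0 (\<lambda>s v. v + (k v + (s - c) *\<^sub>R d v)) a b d"
    by (rule lag_frame_C1.intro)
  then have C1: "lag_path_C1 l a b"
    by (rule lag_frame_C1.path_C1) (simp add: l graph_over_def)
  have "crossings L0 l a b \<subseteq> {t. \<exists>v\<in>L0. v \<noteq> 0 \<and> k v + (t - c) *\<^sub>R d v = 0}"
  proof
    fix t assume t: "t \<in> crossings L0 l a b"
    then have tab: "t \<in> {a..b}" and ne: "l t \<inter> L0 \<noteq> {0}" by (simp_all add: crossings_def)
    have "0 \<in> l t \<inter> L0" using subspace_0 transvD(4)[OF tl[OF tab]] transvD(4)[OF W] by blast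
    then obtain v where v: "v \<in> l t" "v \<in> L0" "v \<noteq> 0" using ne by blast
    have "k v + (t - c) *\<^sub>R d v = 0"
      using sl[OF tab v(2)] slope_eq_0_iff[OF tl[OF tab], of v] v(1) by simp
    then show "t \<in> {t. \<exists>v\<in>L0. v \<noteq> 0 \<and> k v + (t - c) *\<^sub>R d v = 0}" using v by blast
  qed
  moreover have "finite {t. \<exists>v\<in>L0. v \<noteq> 0 \<and> k v + (t - c) *\<^sub>R d v = 0}"
    by (rule finite_affine_kernel_times[OF k d]) (use def in force)
  ultimately have fin: "finite (crossings L0 l a b)" by (rule finite_subset)
  have "nondeg_form (crossing_form l a b t) (l t \<inter> L0)" if t: "t \<in> {a..b}" for t
  proof -
    obtain D where "crossing l a b t D" using lag_path_C1_crossing[OF C1 ab t] .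
    then interpret crossing l a b t D .
    let ?S = "l t \<inter> L0"
    have S: "subspace ?S" using transvD(4)[OF tl[OF t]] transvD(4)[OF W] by (rule subspace_inter)
    have cf: "crossing_form l a b t v = omega0 v (d v)" if v: "v \<in> ?S" for v
    proof (rule derivative_unique)
      have v': "v \<in> l t" "v \<in> L0" using v by blast+
      show "((\<lambda>s. omega0 v (slope W (l s) v)) has_real_derivative crossing_form l a b t v) T0"
        using sform_has_derivative[OF tl[OF t] v'(1)] crossing_form_eq[OF v'(1)] by simp
      have "((\<lambda>s. omega0 v (k v) + (s - c) * omega0 v (d v)) has_real_derivative omega0 v (d v)) T0"
        by (auto intro!: derivative_eq_intros)
      then show "((\<lambda>s. omega0 v (slope W (l s) v)) has_real_derivative omega0 v (d v)) T0"
        by (rule has_field_derivative_transform_within[OF _ zero_less_one t]) (simp add: sl v' omega0_simps)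
    qed
    from def show ?thesis
    proof
      assume "\<forall>v\<in>L0. v \<noteq> 0 \<longrightarrow> omega0 v (d v) > 0"
      then have p: "crossing_form l a b t v > 0" if "v \<in> ?S" "v \<noteq> 0" for v using cf[OF that(1)] that by simp
      show ?thesis
        using nondeg_form_definite[OF S, of "crossing_form l a b t"] p by (simp add: nondeg_form_def n_minus_def)
    next
      assume "\<forall>v\<in>L0. v \<noteq> 0 \<longrightarrow> omega0 v (d v) < 0"
      then have p: "- crossing_form l a b t v > 0" if "v \<in> ?S" "v \<noteq> 0" for v using cf[OF that(1)] that by simp
      show ?thesis
        using nondeg_form_definite[OF S, of "\<lambda>v. - crossing_form l a b t v"] p by (simp add: nondeg_form_def n_minus_def)
    qed
  qed
  then show ?thesis using C1 fin unfolding regular_path_def crossings_def by blast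
qed

text \<open>\<open>i v\<close> is the component of \<open>J0 v\<close> in \<open>W\<close> along
  \<open>A\<close>; dropping the part in \<open>A\<close> does not change the pairing with
  \<open>A\<close>, which is the inner product. It supplies a positive definite direction.\<close>

lemma chart_inner:
  assumes W: "transv W A"
  obtains i where "chart W A i" "\<And>v. v \<in> A \<Longrightarrow> omega0 v (i v) = inner v v"
proof -
  define i where "i v = - slope W A (J0 v)" for v
  have om: "omega0 v (i v') = inner v v'" if "v \<in> A" for v v'
  proof -
    have "omega0 v (J0 v' + slope W A (J0 v')) = 0"
      by (rule lagrangian_omega0[OF transvD(2)[OF W] that slope_add_in[OF W]])
    then show ?thesis by (simp add: i_def omega0_simps)
  qed
  have "linear i"
    unfolding i_def using linear_compose[OF linear_J0 slope_linear[OF W]]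
    by (intro linear_compose_neg) (simp add: o_def)
  moreover have "i v \<in> W" for v unfolding i_def by (rule subspace_neg[OF transvD(3)[OF W] slope_in[OF W]])
  ultimately have "chart W A i" unfolding chart_def using om by (simp add: inner_commute)
  then show ?thesis using that om by blast
qed

section \<open>Uniqueness from the axioms\<close>

lemma clm_axiomsD:
  assumes "clm_axioms \<mu>"
  shows "\<not> (lagrangian L0 \<and> a < b \<and> lag_path l a b) \<Longrightarrow> \<mu> L0 l a b = 0"
    and "lagrangian L0 \<Longrightarrow> a < b \<Longrightarrow> regular_path L0 l a b \<Longrightarrow> \<mu> L0 l a b = crossing_sum L0 l a b"
    and "lagrangian L0 \<Longrightarrow> a < b \<Longrightarrow> lag_homotopy H a b \<Longrightarrow> \<forall>s\<in>{0..1}. H s a = H 0 a \<and> H s b = H 0 b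
      \<Longrightarrow> \<mu> L0 (H 0) a b = \<mu> L0 (H 1) a b"
    and "lagrangian L0 \<Longrightarrow> a < c \<Longrightarrow> c < b \<Longrightarrow> lag_path l a b \<Longrightarrow> \<mu> L0 l a b = \<mu> L0 l a c + \<mu> L0 l c b"
proof -
  note ax = assms[unfolded clm_axioms_def]
  show "\<not> (lagrangian L0 \<and> a < b \<and> lag_path l a b) \<Longrightarrow> \<mu> L0 l a b = 0"
    by (rule ax[THEN conjunct1, rule_format])
  show "lagrangian L0 \<Longrightarrow> a < b \<Longrightarrow> regular_path L0 l a b \<Longrightarrow> \<mu> L0 l a b = crossing_sum L0 l a b"
    by (rule ax[THEN conjunct2, THEN conjunct1, rule_format]) (intro conjI)
  show "lagrangian L0 \<Longrightarrow> a < b \<Longrightarrow> lag_homotopy H a b \<Longrightarrow> \<forall>s\<in>{0..1}. H s a = H 0 a \<and> H s b = H 0 b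
      \<Longrightarrow> \<mu> L0 (H 0) a b = \<mu> L0 (H 1) a b"
    by (rule ax[THEN conjunct2, THEN conjunct2, THEN conjunct1, THEN spec, THEN spec, THEN spec, THEN spec, THEN mp])
       (intro conjI)
  show "lagrangian L0 \<Longrightarrow> a < c \<Longrightarrow> c < b \<Longrightarrow> lag_path l a b \<Longrightarrow> \<mu> L0 l a b = \<mu> L0 l a c + \<mu> L0 l c b"
    by (rule ax[THEN conjunct2, THEN conjunct2, THEN conjunct2, rule_format]) (intro conjI)
qed

text \<open>In a chart, every path is homotopic with fixed endpoints to one that first moves in a positive
  definite and then in a negative definite direction; such a path is piecewise regular.\<close>

lemma clm_determined_in_chart:
  assumes W: "transv W L0" and uv: "u < v" and path: "lag_path l u v" and tl: "\<And>s. s \<in> {u..v} \<Longrightarrow> transv W (l s)"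
  shows "\<exists>c. \<forall>\<mu>. clm_axioms \<mu> \<longrightarrow> \<mu> L0 l u v = c"
proof -
  have L0: "lagrangian L0" using transvD[OF W] by blast
  define k where "k s = slope W (l s)" for s
  have ck: "chart W L0 (k s)" if "s \<in> {u..v}" for s unfolding k_def by (rule chart_slope[OF W tl[OF that]])
  have gk: "graph_over L0 (k s) = l s" if "s \<in> {u..v}" for s unfolding k_def by (rule graph_slope[OF W tl[OF that]])
  have contk: "continuous_on {u..v} (\<lambda>s. k s x)" for x
    unfolding continuous_on_def k_def
    using slope_tendsto[OF lag_family_tendsto[OF path[unfolded lag_path_family]] tl] by blast
  obtain i where i: "chart W L0 i" "\<And>x. x \<in> L0 \<Longrightarrow> omega0 x (i x) = inner x x" using chart_inner[OF W] by blast
  define m where "m = (u + v) / 2"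
  have m: "u < m" "m < v" using uv by (simp_all add: m_def)
  have muv: "u \<in> {u..v}" "v \<in> {u..v}" using uv by simp_all
  have lin: "linear (\<lambda>x. k v x - k u x)" using ck[OF muv(1)] ck[OF muv(2)]
    unfolding chart_def by (intro linear_compose_sub) blast+
  obtain K1 where K1: "\<And>x. norm (k v x - k u x) \<le> norm x * K1"
    using bounded_linear.bounded lin unfolding linear_conv_bounded_linear by blast
  obtain K0 where K0: "K0 > 0" "\<And>x y :: 'a sympl. norm (omega0 x y) \<le> norm x * norm y * K0"
    using bounded_bilinear.pos_bounded[OF bounded_bilinear_omega0] by blast
  \<comment> \<open>Large enough that velocity \<open>R *\<^sub>R i\<close> carries
    \<open>k u\<close> beyond \<open>k v\<close>, in the order of forms, by time \<open>m\<close>;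
    \<open>K1\<close> bounds \<open>k v - k u\<close> and \<open>K0\<close> bounds
    \<open>omega0\<close>.\<close>
  define R where "R = (\<bar>K1\<bar> * K0 + 1) / (m - u)"
  have R: "R > 0" using m K0 by (simp add: R_def add_nonneg_pos)
  have Rb: "omega0 x (k v x) - omega0 x (k u x) < (m - u) * R * inner x x" if "x \<noteq> 0" for x
  proof -
    have "omega0 x (k v x) - omega0 x (k u x) = omega0 x (k v x - k u x)" by (simp add: omega0_simps)
    also have "\<dots> \<le> norm x * norm (k v x - k u x) * K0" using K0(2)[of x "k v x - k u x"] by simp
    also have "\<dots> \<le> norm x * (norm x * \<bar>K1\<bar>) * K0"
      using K0(1) order_trans[OF K1 mult_left_mono[OF abs_ge_self]] by (intro mult_right_mono mult_left_mono) auto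
    also have "\<dots> = \<bar>K1\<bar> * K0 * inner x x" by (simp add: power2_norm_eq_inner[symmetric] power2_eq_square)
    also have "\<dots> < (\<bar>K1\<bar> * K0 + 1) * inner x x" using that by (intro mult_strict_right_mono) auto
    also have "\<dots> = (m - u) * R * inner x x" using m by (simp add: R_def)
    finally show ?thesis .
  qed
  \<comment> \<open>The velocity that reaches \<open>k v\<close> at time \<open>v\<close> from the
    position at \<open>m\<close>; the overshoot makes it negative definite.\<close>
  define dd where "dd x = (1 / (v - m)) *\<^sub>R (k v x - k u x - ((m - u) * R) *\<^sub>R i x)" for x
  have cdd: "chart W L0 dd"
  proof -
    have "chart W L0 (\<lambda>x. 1 *\<^sub>R (1 *\<^sub>R k v x + (-1) *\<^sub>R k u x) + (- ((m - u) * R)) *\<^sub>R i x)"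
      by (intro chart_combination[OF W] ck muv i(1))
    from chart_scale[OF W this, of "1 / (v - m)"] show ?thesis by (simp add: dd_def[abs_def])
  qed
  have ddneg: "omega0 x (dd x) < 0" if "x \<in> L0" "x \<noteq> 0" for x
    using Rb[OF that(2)] i(2)[OF that(1)] m
    by (simp add: dd_def omega0_simps divide_less_0_iff)
  \<comment> \<open>With \<open>min\<close> and \<open>max\<close> one formula describes both
    halves: the first motion stops at \<open>m\<close>, where the second starts.\<close>
  define kk where "kk s x = k u x + ((min s m - u) * R) *\<^sub>R i x + (max s m - m) *\<^sub>R dd x" for s x
  have ckk: "chart W L0 (kk s)" for s
  proof -
    have "chart W L0 (\<lambda>x. 1 *\<^sub>R (1 *\<^sub>R k u x + ((min s m - u) * R) *\<^sub>R i x) + (max s m - m) *\<^sub>R dd x)"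
      by (intro chart_combination[OF W] ck muv i(1) cdd)
    then show ?thesis by (simp add: kk_def[abs_def])
  qed
  have kku: "kk u = k u" using m by (auto simp: kk_def fun_eq_iff)
  have kkv: "kk v = k v" using m by (simp add: kk_def dd_def fun_eq_iff)
  define h where "h p x = (1 - fst p) *\<^sub>R k (snd p) x + fst p *\<^sub>R kk (snd p) x" for p :: "real \<times> real" and x
  \<comment> \<open>At \<open>\<sigma> = 0\<close> the value is \<open>l\<close> itself, not its
    chart graph, because the homotopy axiom speaks of \<open>H 0\<close> as a function on all
    reals.\<close>
  define H where "H \<sigma> s = (if \<sigma> = 0 then l s else graph_over L0 (h (\<sigma>, s)))" for \<sigma> s
  have H: "H \<sigma> s = graph_over L0 (h (\<sigma>, s))" if "s \<in> {u..v}" for \<sigma> s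
    using gk[OF that] by (simp add: H_def h_def[abs_def])
  have "lag_frame L0 (\<lambda>p x. x + h p x) ({0..1} \<times> {u..v})"
  proof (rule chart_lag_frame[OF W])
    show "chart W L0 (h p)" if "p \<in> {0..1} \<times> {u..v}" for p
      unfolding h_def[abs_def] by (intro chart_combination[OF W] ck ckk) (use that in \<open>simp add: mem_Times_iff\<close>)
    show "continuous_on ({0..1} \<times> {u..v}) (\<lambda>p. h p z)" for z
      unfolding h_def kk_def by (intro continuous_intros continuous_on_compose2[OF contk]) auto
  qed
  then have fam: "lag_family (\<lambda>p. graph_over L0 (h p)) ({0..1} \<times> {u..v})"
    unfolding graph_over_def by (rule lag_frame.family)
  have hom: "lag_homotopy H u v"
    unfolding lag_homotopy_def
  proof (intro conjI ballI allI)
    show "lagrangian (H \<sigma> s)" if "\<sigma> \<in> {0..1}" "s \<in> {u..v}" for \<sigma> s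
      using fam H[OF that(2)] that unfolding lag_family_def by simp
    have "continuous_on ({0..1} \<times> {u..v}) (\<lambda>p. closest_point (graph_over L0 (h p)) x)" for x
      using fam unfolding lag_family_def by blast
    then show "continuous_on ({0..1} \<times> {u..v}) (\<lambda>(s,t). closest_point (H s t) x)" for x
      by (rule continuous_on_eq) (auto simp: H)
  qed
  have fixed: "H \<sigma> u = H 0 u \<and> H \<sigma> v = H 0 v" for \<sigma>
  proof -
    have "h (\<sigma>, u) = k u" "h (\<sigma>, v) = k v"
      by (simp_all add: h_def[abs_def] kku kkv scaleR_left_distrib[symmetric])
    then show ?thesis using gk[OF muv(1)] gk[OF muv(2)] by (simp add: H_def)
  qed
  have H0: "H 0 = l" by (simp add: H_def[abs_def])
  have path1: "lag_path (H 1) u v"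
  proof -
    have "lag_family (\<lambda>s. graph_over L0 (h (1, s))) {u..v}"
      by (rule lag_family_compose[OF fam, of "{u..v}" "\<lambda>s. (1, s)"]) (auto intro: continuous_intros)
    then show ?thesis by (simp add: lag_path_family H_def[abs_def])
  qed
  have reg1: "regular_path L0 (H 1) u m"
  proof (rule regular_affine_path[OF W m(1) ck[OF muv(1)] chart_scale[OF W i(1), of R]])
    show "(\<forall>x\<in>L0. x \<noteq> 0 \<longrightarrow> omega0 x (R *\<^sub>R i x) > 0) \<or> (\<forall>x\<in>L0. x \<noteq> 0 \<longrightarrow> omega0 x (R *\<^sub>R i x) < 0)"
      using i(2) R by (intro disjI1) (simp add: omega0_simps)
    show "H 1 s = graph_over L0 (\<lambda>x. k u x + (s - u) *\<^sub>R R *\<^sub>R i x)" if "s \<in> {u..m}" for s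
      using that by (simp add: H_def h_def[abs_def] kk_def max_def min_def)
  qed
  have reg2: "regular_path L0 (H 1) m v"
  proof (rule regular_affine_path[OF W m(2) ckk cdd])
    show "(\<forall>x\<in>L0. x \<noteq> 0 \<longrightarrow> omega0 x (dd x) > 0) \<or> (\<forall>x\<in>L0. x \<noteq> 0 \<longrightarrow> omega0 x (dd x) < 0)"
      using ddneg by blast
    show "H 1 s = graph_over L0 (\<lambda>x. kk m x + (s - m) *\<^sub>R dd x)" if "s \<in> {m..v}" for s
      using that by (simp add: H_def h_def[abs_def] kk_def max_absorb1 min_absorb2)
  qed
  have "\<mu> L0 l u v = crossing_sum L0 (H 1) u m + crossing_sum L0 (H 1) m v" if mu: "clm_axioms \<mu>" for \<mu>
  proof -
    have "\<mu> L0 (H 0) u v = \<mu> L0 (H 1) u v"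
      using clm_axiomsD(3)[OF mu L0 uv hom] fixed by blast
    moreover have "\<mu> L0 (H 1) u v = \<mu> L0 (H 1) u m + \<mu> L0 (H 1) m v"
      by (rule clm_axiomsD(4)[OF mu L0 m path1])
    moreover have "\<mu> L0 (H 1) u m = crossing_sum L0 (H 1) u m" "\<mu> L0 (H 1) m v = crossing_sum L0 (H 1) m v"
      using clm_axiomsD(2)[OF mu L0] m reg1 reg2 by blast+
    ultimately show ?thesis using H0 by simp
  qed
  then show ?thesis by blast
qed

text \<open>The path is bisected until each piece stays in one chart, where the axioms fix the
  value; additivity assembles the pieces.\<close>

lemma clm_axioms_unique:
  assumes mu: "clm_axioms \<mu>" and mu': "clm_axioms \<mu>'"
  shows "\<mu> = \<mu>'"
proof (intro ext)
  fix L0 :: "'a sympl set" and l a b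
  show "\<mu> L0 l a b = \<mu>' L0 l a b"
  proof (cases "lagrangian L0 \<and> a < b \<and> lag_path l a b")
    case False
    then show ?thesis using clm_axiomsD(1)[OF mu] clm_axiomsD(1)[OF mu'] by simp
  next
    case True
    then have L0: "lagrangian L0" and ab: "a < b" and path: "lag_path l a b" by blast+
    have sub: "lag_path l u v" if "a \<le> u" "v \<le> b" for u v
      using path that lag_family_subset[of l "{a..b}" "{u..v}"] unfolding lag_path_family by simp
    define P where "P u v \<longleftrightarrow> (a \<le> u \<longrightarrow> v \<le> b \<longrightarrow> u < v \<longrightarrow> \<mu> L0 l u v = \<mu>' L0 l u v)" for u v
    have "P a b"
    proof (induction rule: Bolzano[OF less_imp_le[OF ab]])
      case (1 u v w)
      show ?case
        unfolding P_def
      proof (intro impI)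
        assume h: "a \<le> u" "w \<le> b" "u < w"
        show "\<mu> L0 l u w = \<mu>' L0 l u w"
        proof (cases "u = v \<or> v = w")
          case True
          then show ?thesis using 1 h by (auto simp: P_def)
        next
          case False
          then have uv: "u < v" "v < w" using 1 by auto
          have "\<mu> L0 l u w = \<mu> L0 l u v + \<mu> L0 l v w" "\<mu>' L0 l u w = \<mu>' L0 l u v + \<mu>' L0 l v w"
            using clm_axiomsD(4)[OF mu L0 uv] clm_axiomsD(4)[OF mu' L0 uv] sub[OF h(1,2)] by blast+
          then show ?thesis using 1 h uv by (simp add: P_def)
        qed
      qed
    next
      case (2 x)
      then have x: "x \<in> {a..b}" by simp
      have fam: "lag_family l {a..b}" using path by (simp add: lag_path_family)
      obtain W where W: "transv W L0" "transv W (l x)"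
        using exists_transv2[OF L0] fam x unfolding lag_family_def by blast
      obtain e where e: "e > 0" "\<And>q. q \<in> {a..b} \<Longrightarrow> q \<noteq> x \<Longrightarrow> dist q x < e \<Longrightarrow> transv W (l q)"
        using eventually_transv[OF lag_family_tendsto[OF fam x] W(2)] unfolding eventually_at by blast
      have "\<mu> L0 l u v = \<mu>' L0 l u v" if uv: "u \<le> x" "x \<le> v" "v - u < e" "a \<le> u" "v \<le> b" "u < v" for u v
      proof -
        have "transv W (l s)" if "s \<in> {u..v}" for s
          using e(2)[of s] W(2) that uv by (cases "s = x") (auto simp: dist_real_def)
        then obtain c where c: "\<forall>\<mu>. clm_axioms \<mu> \<longrightarrow> \<mu> L0 l u v = c"
          using clm_determined_in_chart[OF W(1) uv(6) sub[OF uv(4,5)]] by blast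
        show ?thesis using c[rule_format, OF mu] c[rule_format, OF mu'] by simp
      qed
      then show ?case using e(1) by (intro exI[of _ e]) (auto simp: P_def)
    qed
    then show ?thesis using ab by (simp add: P_def)
  qed
qed

lemma clm_index_eq_maslov: "clm_index = maslov"
  unfolding clm_index_def using clm_axioms_maslov clm_axioms_unique by (intro the_equality)

section \<open>Comparison of Maslov indices\<close>

text \<open>All three indices are transported to the middle Lagrangian \<open>B\<close>, where they
  belong to minus the form of \<open>A\<close>, to the form of \<open>C\<close> and to their sum;
  the two radicals are the intersections with \<open>B\<close>.\<close>

lemma hind_triangle:
  fixes A :: "'n::finite sympl set"
  assumes A: "transv W A" and B: "transv W B" and C: "transv W C"
  shows "hind W A C \<le> hind W A B + hind W B C"
    and "hind W A B + hind W B C + dim (span (A \<inter> B \<union> B \<inter> C)) \<le> hind W A C + CARD('n)"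
proof -
  have lB: "lagrangian B" using transvD[OF B] by blast
  let ?b = "\<lambda>x y. - sform W A x y" and ?c = "sform W C"
  have b: "sym_form ?b B" and c: "sym_form ?c B"
    using sym_form.uminus[OF sym_form_sform[OF A lB]] sym_form_sform[OF C lB] .
  have z: "sform W B z z = 0" if "z \<in> B" for z
    using slope_eq_0_iff[OF B, of z] that by (simp add: sform_def omega0_simps)
  have AB: "hind W A B = n_plus (\<lambda>v. ?b v v) B"
    unfolding hind_change_base[OF A B B] by (rule n_plus_cong) (simp add: z)
  have BC: "hind W B C = n_plus (\<lambda>v. ?c v v) B" by (simp add: hind_def)
  have AC: "hind W A C = n_plus (\<lambda>v. ?b v v + ?c v v) B"
    unfolding hind_change_base[OF A B C] by (rule n_plus_cong) simp
  have "rad ?b B = rad (sform W A) B" by (simp add: rad_def)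
  then have rb: "rad ?b B = A \<inter> B" using rad_sform[OF B A] by (simp add: Int_commute)
  show "hind W A C \<le> hind W A B + hind W B C"
    unfolding AB BC AC by (rule n_plus_subadd[OF b c])
  show "hind W A B + hind W B C + dim (span (A \<inter> B \<union> B \<inter> C)) \<le> hind W A C + CARD('n)"
    using n_plus_add_ge[OF b c] unfolding AB BC AC rb rad_sform[OF B C] lagrangian_dim[OF lB] .
qed

text \<open>The correction terms of the exchange identity depend on one Lagrangian each, so they
  cancel around the triple.\<close>

lemma hind_triple_independent:
  assumes W: "transv W A" "transv W B" "transv W C" and W': "transv W' A" "transv W' B" "transv W' C"
  shows "int (hind W A B) + int (hind W B C) - int (hind W A C)
       = int (hind W' A B) + int (hind W' B C) - int (hind W' A C)"
  using hind_exchange[OF W(1,2) W'(1,2)] hind_exchange[OF W(2,3) W'(2,3)] hind_exchange[OF W(1,3) W'(1,3)]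
  by linarith

text \<open>\<open>W\<close> is transversal to the path at its ends only. In between, local charts
  are used: the difference of the primitives changes like a triple index, which does not depend on
  the chart.\<close>

lemma maslov_diff:
  assumes L1: "lagrangian L1" and L2: "lagrangian L2" and ab: "a < b" and l: "lag_path l a b"
    and W: "transv W L1" "transv W L2" "transv W (l a)" "transv W (l b)"
  shows "maslov L2 l a b - maslov L1 l a b =
     (int (hind W L2 (l b)) - int (hind W L1 (l b))) - (int (hind W L2 (l a)) - int (hind W L1 (l a)))"
proof -
  have fam: "lag_family l {a..b}" using l by (simp add: lag_path_family)
  obtain F1 where F1: "primitive L1 l {a..b} F1" using primitive_exists_path[OF l L1] ab by auto
  obtain F2 where F2: "primitive L2 l {a..b} F2" using primitive_exists_path[OF l L2] ab by auto
  define adm where "adm t W \<longleftrightarrow> transv W L1 \<and> transv W L2 \<and> transv W (l t)" for t W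
  \<comment> \<open>The term \<open>hind W L1 L2\<close> completes a triple index and so removes the
    dependence on \<open>W\<close>; it cancels in the final difference.\<close>
  define \<tau> where "\<tau> W t = int (hind W L1 L2) + int (hind W L2 (l t)) - int (hind W L1 (l t))" for W t
  define \<theta> where "\<theta> t = \<tau> (SOME W. adm t W) t" for t
  have theta: "\<theta> t = \<tau> W' t" if "adm t W'" for t W'
  proof -
    have "adm t (SOME W. adm t W)" using that by (rule someI)
    then show ?thesis unfolding \<theta>_def \<tau>_def using that hind_triple_independent unfolding adm_def by blast
  qed
  have "F2 a - F1 a - \<theta> a = F2 b - F1 b - \<theta> b"
  proof (rule connected_local_const[of "{a..b}"])
    show "\<forall>t\<in>{a..b}. eventually (\<lambda>s. F2 t - F1 t - \<theta> t = F2 s - F1 s - \<theta> s) (at t within {a..b})"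
    proof
      fix t assume t: "t \<in> {a..b}"
      have "lagrangian (l t)" using fam t by (simp add: lag_family_def)
      then obtain W' where "\<And>X. X \<in> {L1, L2, l t} \<Longrightarrow> transv W' X"
        using exists_transv[of "{L1, L2, l t}"] L1 L2 by blast
      then have W': "transv W' L1" "transv W' L2" "transv W' (l t)" by blast+
      have "eventually (\<lambda>s. F1 s - int (hind W' L1 (l s)) = F1 t - int (hind W' L1 (l t))) (at t within {a..b})"
        "eventually (\<lambda>s. F2 s - int (hind W' L2 (l s)) = F2 t - int (hind W' L2 (l t))) (at t within {a..b})"
        using F1 F2 W' t unfolding primitive_def by blast+
      with eventually_transv[OF lag_family_tendsto[OF fam t] W'(3)]
      show "eventually (\<lambda>s. F2 t - F1 t - \<theta> t = F2 s - F1 s - \<theta> s) (at t within {a..b})"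
      proof eventually_elim
        case (elim s)
        have "\<theta> t = \<tau> W' t" "\<theta> s = \<tau> W' s"
          by (rule theta, use W' elim(1) in \<open>simp add: adm_def\<close>)+
        then show ?case using elim(2,3) by (simp add: \<tau>_def)
      qed
    qed
  qed (use ab in simp_all)
  moreover have "\<theta> a = \<tau> W a" "\<theta> b = \<tau> W b"
    by (rule theta, use W in \<open>simp add: adm_def\<close>)+
  ultimately show ?thesis
    using maslov_eq[OF L1 ab l F1] maslov_eq[OF L2 ab l F2] by (simp add: \<tau>_def)
qed

section \<open>The flow and the comparison of the two indices\<close>

lemma J0L_apply: "blinfun_apply J0L = J0"
  unfolding J0L_def
  by (rule bounded_linear_Blinfun_apply) (use linear_J0 in \<open>simp add: linear_conv_bounded_linear\<close>)

text \<open>The equation turns the derivative of the pairing into a difference of two inner products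
  with \<open>B s\<close>, which vanishes by symmetry of \<open>B s\<close>.\<close>

lemma flow_symplectic:
  fixes B \<phi> :: "real \<Rightarrow> ('n::finite sympl \<Rightarrow>\<^sub>L 'n sympl)"
  assumes B_sym: "\<forall>t\<in>{0..T}. \<forall>x y. inner (B t x) y = inner x (B t y)"
    and ode: "\<forall>t\<in>{0..T}. (\<phi> has_vector_derivative (J0L o\<^sub>L B t o\<^sub>L \<phi> t)) (at t within {0..T})"
    and phi0: "\<phi> 0 = id_blinfun" and t: "t \<in> {0..T}"
  shows "omega0 (\<phi> t x) (\<phi> t y) = omega0 x y"
proof -
  have der: "((\<lambda>t. \<phi> t x) has_vector_derivative J0 (B s (\<phi> s x))) (at s within {0..T})" if "s \<in> {0..T}" for s x
    using bounded_linear.has_vector_derivative[OF blinfun.bounded_linear_left ode[rule_format, OF that], of x]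
    by (simp add: J0L_apply)
  have "((\<lambda>t. omega0 (\<phi> t x) (\<phi> t y)) has_vector_derivative 0) (at s within {0..T})" if s: "s \<in> {0..T}" for s
  proof -
    have "inner (B s (\<phi> s x)) (\<phi> s y) = inner (\<phi> s x) (B s (\<phi> s y))" using B_sym s by blast
    then show ?thesis
      using bounded_bilinear.has_vector_derivative[OF bounded_bilinear_omega0 der[OF s, of x] der[OF s, of y]] by simp
  qed
  then obtain c where c: "\<And>s. s \<in> {0..T} \<Longrightarrow> omega0 (\<phi> s x) (\<phi> s y) = c"
    using has_vector_derivative_zero_constant[of "{0..T}" "\<lambda>t. omega0 (\<phi> t x) (\<phi> t y)"] by blast
  show ?thesis using c[OF t] c[of 0] t phi0 by simp
qed

lemma flow_lag_path:
  fixes \<phi> :: "real \<Rightarrow> ('n::finite sympl \<Rightarrow>\<^sub>L 'n sympl)"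
  assumes L: "lagrangian L" and cont: "continuous_on {0..T} \<phi>"
    and symp: "\<And>t x y. t \<in> {0..T} \<Longrightarrow> omega0 (\<phi> t x) (\<phi> t y) = omega0 x y"
  shows "lag_path (\<lambda>t. blinfun_apply (\<phi> t) ` L) 0 T"
proof -
  have lin: "linear (blinfun_apply (\<phi> t))" for t by (rule bounded_linear.linear[OF blinfun.bounded_linear_right])
  \<comment> \<open>Pairing with \<open>J0 x\<close> recovers the squared norm of \<open>x\<close>,
    so a map preserving \<open>omega0\<close> is injective.\<close>
  have inj: "x = 0" if "t \<in> {0..T}" "\<phi> t x = 0" for t x
    using symp[OF that(1), of x "J0 x"] that(2) by (simp add: omega0_simps)
  have "lag_frame L (\<lambda>t. blinfun_apply (\<phi> t)) {0..T}"
  proof (rule lag_frame.intro)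
    show "lagrangian (blinfun_apply (\<phi> t) ` L)" if "t \<in> {0..T}" for t
      using lagrangian_omega0[OF L] symp[OF that] inj[OF that] by (intro lagrangianI_image[OF L lin]) simp_all
    show "continuous_on {0..T} (\<lambda>t. \<phi> t z)" for z by (intro continuous_intros cont)
  qed (use L lin inj in blast)+
  then show ?thesis unfolding lag_path_family by (rule lag_frame.family)
qed

theorem theorem2p10:
  fixes B :: "real \<Rightarrow> ('n::finite sympl \<Rightarrow>\<^sub>L 'n sympl)"
    and \<phi> :: "real \<Rightarrow> ('n sympl \<Rightarrow>\<^sub>L 'n sympl)"
    and T :: real
    and L L1 L2 :: "'n sympl set"
  assumes T: "0 < T"
    and B_cont: "continuous_on {0..T} B"
    and B_sym: "\<forall>t\<in>{0..T}. \<forall>x y. inner (B t x) y = inner x (B t y)"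
    and phi_ode: "\<forall>t\<in>{0..T}. (\<phi> has_vector_derivative (J0L o\<^sub>L B t o\<^sub>L \<phi> t)) (at t within {0..T})"
    and phi0: "\<phi> 0 = id_blinfun"
    and L: "lagrangian L" and L1: "lagrangian L1" and L2: "lagrangian L2"
  shows
    "let l = (\<lambda>t. blinfun_apply (\<phi> t) ` L);
         eps1 = span ((L \<inter> l T) \<union> (l T \<inter> L1));
         eps2 = span ((L \<inter> l T) \<union> (l T \<inter> L2));
         del1 = span ((L \<inter> L1) \<union> (L1 \<inter> L2));
         del2 = span ((l T \<inter> L1) \<union> (L1 \<inter> L2));
         k1 = min (dim eps1) (dim eps2);
         k2 = min (dim del1) (dim del2);
         k = max k1 k2
     in \<bar>clm_index L2 l 0 T - clm_index L1 l 0 T\<bar> \<le> int CARD('n) - int k"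
proof -
  define l where "l = (\<lambda>t. blinfun_apply (\<phi> t) ` L)"
  have cont: "continuous_on {0..T} \<phi>"
    using phi_ode unfolding continuous_on_eq_continuous_within by (blast intro: has_vector_derivative_continuous)
  have path: "lag_path l 0 T"
    unfolding l_def by (rule flow_lag_path[OF L cont flow_symplectic[OF B_sym phi_ode phi0]])
  have l0: "l 0 = L" by (simp add: l_def phi0)
  have lT: "lagrangian (l T)" using path T by (simp add: lag_path_def)
  obtain W where "\<And>X. X \<in> {L1, L2, L, l T} \<Longrightarrow> transv W X"
    using exists_transv[of "{L1, L2, L, l T}"] L L1 L2 lT by blast
  then have W: "transv W L1" "transv W L2" "transv W L" "transv W (l T)" by blast+
  have diff: "clm_index L2 l 0 T - clm_index L1 l 0 T =
     (int (hind W L2 (l T)) - int (hind W L1 (l T))) - (int (hind W L2 L) - int (hind W L1 L))"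
    unfolding clm_index_eq_maslov
    using maslov_diff[OF L1 L2 T path W(1,2) _ W(4)] W(3) unfolding l0 by blast
  have e1: "L1 \<inter> l T \<union> l T \<inter> L = (L \<inter> l T) \<union> (l T \<inter> L1)" by blast
  have e2: "L2 \<inter> l T \<union> l T \<inter> L = (L \<inter> l T) \<union> (l T \<inter> L2)" by blast
  have d1: "L2 \<inter> L1 \<union> L1 \<inter> L = (L \<inter> L1) \<union> (L1 \<inter> L2)" by blast
  have d2: "L2 \<inter> L1 \<union> L1 \<inter> l T = (l T \<inter> L1) \<union> (L1 \<inter> L2)" by blast
  \<comment> \<open>Each estimate places a triple index between 0 and \<open>CARD('n)\<close> minus
    a dimension. The difference of the Maslov indices is a difference of two such integers, once
    from \<open>E1\<close> and \<open>E2\<close>, once from \<open>D1\<close> and \<open>D2\<close>;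
    it is at most \<open>CARD('n)\<close> minus the smaller dimension, so \<open>k1\<close> and
    \<open>k2\<close> both serve as bounds.\<close>
  note E1 = hind_triangle[OF W(1) W(4) W(3), unfolded e1]
    and E2 = hind_triangle[OF W(2) W(4) W(3), unfolded e2]
    and D1 = hind_triangle[OF W(2) W(1) W(3), unfolded d1]
    and D2 = hind_triangle[OF W(2) W(1) W(4), unfolded d2]
  show ?thesis
    unfolding Let_def l_def[symmetric] diff using E1 E2 D1 D2 by linarith
qed

end
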